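(* Let $1\le p_1\le p_2<\infty$, $1\le q_1\le q_2<\infty$, $p_2\ge2$, $q_2\ge2$. Then there exists $a=a(p_2,q_2)>0$ such that for all $m,k,n\in\mathbb N$ satisfying $n\le amk$, $$d_n(B^{m,k}_{p_1,q_1},\,l^{m,k}_{p_2,q_2})\asymp\Phi_0=\Phi_0(m,k,n,p_1,p_2,q_1,q_2),$$ with constants in $\asymp$ depending only on $p_1,p_2,q_1,q_2$, where $$\Phi_0=\min\bigl\{1,\ n^{-1/2}m^{1/p_2}k^{1/q_2}\bigr\}\quad\text{if } p_1\le2,\ q_1\le2;$$ $$\Phi_0=\min\Bigl\{1,\ \bigl(n^{-1/2}m^{1/p_2}k^{1/q_2}\bigr)^{\lambda(\mathbf p)},\ m^{\frac1{p_2}-\frac1{p_1}}\bigl(n^{-1/2}m^{1/2}k^{1/q_2}\bigr)^{\lambda(\mathbf q)}\Bigr\}\quad\text{if }\lambda(\mathbf p)\le\lambda(\mathbf q)\text{ and }\lambda(\mathbf p)<1;$$ $$\Phi_0=\min\Bigl\{1,\ \bigl(n^{-1/2}m^{1/p_2}k^{1/q_2}\bigr)^{\lambda(\mathbf q)},\ k^{\frac1{q_2}-\frac1{q_1}}\bigl(n^{-1/2}m^{1/p_2}k^{1/2}\bigr)^{\lambda(\mathbf p)}\Bigr\}\quad\text{if }\lambda(\mathbf p)\ge\lambda(\mathbf q)\text{ and }\lambda(\mathbf q)<1.$$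
   Context: For $m,k\in\mathbb N$, $1\le p,q<\infty$, $l^{m,k}_{p,q}$ is the space $\mathbb R^{mk}$ with the norm $\|(x_{ij})_{1\le i\le m,\,1\le j\le k}\|_{l^{m,k}_{p,q}}=\Bigl(\sum_{j=1}^k\bigl(\sum_{i=1}^m|x_{ij}|^p\bigr)^{q/p}\Bigr)^{1/q}$, and $B^{m,k}_{p,q}$ is its unit ball. For a normed space $X$ and $M\subset X$, the Kolmogorov $n$-width is $d_n(M,X)=\inf_L\sup_{x\in M}\inf_{y\in L}\|x-y\|_X$, the first infimum over linear subspaces $L\subset X$ of dimension at most $n$. With $\mathbf p=(p_1,p_2)$, $\lambda(\mathbf p)=\min\Bigl\{\frac{1/p_1-1/p_2}{1/2-1/p_2},\,1\Bigr\}$ if $p_2>2$ and $\lambda(\mathbf p)=1$ if $p_2=2$; $\lambda(\mathbf q)$ with $\mathbf q=(q_1,q_2)$ is defined in the same way. $A\asymp B$ with constants depending on given parameters means $cB\le A\le CB$ with $c,C>0$ depending only on these parameters. *)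

theory Defs
  imports "HOL-Analysis.Analysis" "HOL-Analysis.Finite_Function_Topology"
begin

text \<open>
  A normed space is given by a subspace \<open>X\<close> of a real vector space together with a norm
  \<open>N\<close> on it. The width takes values in the extended nonnegative reals, so that infima and
  suprema need no boundedness side conditions. Since \<^term>\<open>dim L\<close> is \<open>0\<close> when \<open>L\<close> has
  infinite dimension, finite dimensionality is required separately.
\<close>

definition kolmogorov_width ::
    "nat \<Rightarrow> 'a::real_vector set \<Rightarrow> 'a set \<Rightarrow> ('a \<Rightarrow> real) \<Rightarrow> ennreal" where
  "kolmogorov_width n M X N =
     (INF L \<in> {L. subspace L \<and> L \<subseteq> X \<and> (\<exists>B. finite B \<and> L = span B) \<and> dim L \<le> n}.
        SUP x \<in> M. INF y \<in> L. ennreal (N (x - y)))"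

text \<open>
  The space of \<open>m \<times> k\<close> arrays is the subspace of the finitely supported functions on
  \<open>nat \<times> nat\<close> whose support lies in \<open>{1..m} \<times> {1..k}\<close>. This keeps \<open>m\<close> and \<open>k\<close> at the
  term level, so that they can be quantified after the constants.
\<close>

definition lmk_space :: "nat \<Rightarrow> nat \<Rightarrow> (nat \<times> nat \<Rightarrow>\<^sub>0 real) set" where
  "lmk_space m k = {x. Poly_Mapping.keys x \<subseteq> {1..m} \<times> {1..k}}"

definition lmk_norm ::
    "nat \<Rightarrow> nat \<Rightarrow> real \<Rightarrow> real \<Rightarrow> (nat \<times> nat \<Rightarrow>\<^sub>0 real) \<Rightarrow> real" where
  "lmk_norm m k p q x =
     (\<Sum>j=1..k. (\<Sum>i=1..m. \<bar>Poly_Mapping.lookup x (i, j)\<bar> powr p) powr (q / p)) powr (1 / q)"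

definition lmk_ball ::
    "nat \<Rightarrow> nat \<Rightarrow> real \<Rightarrow> real \<Rightarrow> (nat \<times> nat \<Rightarrow>\<^sub>0 real) set" where
  "lmk_ball m k p q = {x \<in> lmk_space m k. lmk_norm m k p q x \<le> 1}"

definition lam :: "real \<Rightarrow> real \<Rightarrow> real" where
  "lam p1 p2 = (if p2 > 2 then min ((1 / p1 - 1 / p2) / (1 / 2 - 1 / p2)) 1 else 1)"

text \<open>
  The third branch is the case \<^prop>\<open>lam p1 p2 \<ge> lam q1 q2\<close> and \<^prop>\<open>lam q1 q2 < 1\<close>.
  The order of the branches does not matter: see \<open>Phi0_cases\<close> below.
\<close>

definition Phi0 ::
    "nat \<Rightarrow> nat \<Rightarrow> nat \<Rightarrow> real \<Rightarrow> real \<Rightarrow> real \<Rightarrow> real \<Rightarrow> real" where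
  "Phi0 m k n p1 p2 q1 q2 =
     (if p1 \<le> 2 \<and> q1 \<le> 2 then
        min 1 (real n powr (-1/2) * real m powr (1/p2) * real k powr (1/q2))
      else if lam p1 p2 \<le> lam q1 q2 \<and> lam p1 p2 < 1 then
        Min {1,
          (real n powr (-1/2) * real m powr (1/p2) * real k powr (1/q2)) powr lam p1 p2,
          real m powr (1/p2 - 1/p1)
            * (real n powr (-1/2) * real m powr (1/2) * real k powr (1/q2)) powr lam q1 q2}
      else
        Min {1,
          (real n powr (-1/2) * real m powr (1/p2) * real k powr (1/q2)) powr lam q1 q2,
          real k powr (1/q2 - 1/q1)
            * (real n powr (-1/2) * real m powr (1/p2) * real k powr (1/2)) powr lam p1 p2})"

lemma lam_eq_1_iff:
  assumes "1 \<le> p1" "p1 \<le> p2" "2 \<le> p2"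
  shows "lam p1 p2 = 1 \<longleftrightarrow> p1 \<le> 2"
proof (cases "p2 > 2")
  case True
  then have pos: "1 / 2 - 1 / p2 > 0" by (simp add: field_simps)
  have "lam p1 p2 = 1 \<longleftrightarrow> 1 / 2 - 1 / p2 \<le> 1 / p1 - 1 / p2"
  proof -
    have "lam p1 p2 = 1 \<longleftrightarrow> 1 \<le> (1 / p1 - 1 / p2) / (1 / 2 - 1 / p2)"
      unfolding lam_def min_def using True by (metis linorder_not_le nle_le)
    then show ?thesis by (simp only: pos_le_divide_eq[OF pos] mult_1)
  qed
  also have "\<dots> \<longleftrightarrow> p1 \<le> 2" using assms by (simp add: field_simps)
  finally show ?thesis .
next
  case False
  then show ?thesis using assms by (simp add: lam_def)
qed

lemma lam_le_1: "lam p1 p2 \<le> 1"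
  by (simp add: lam_def)

lemma lam_exponent:
  assumes "lam p1 p2 < 1"
  shows "1 / p2 - 1 / p1 + lam p1 p2 / 2 = lam p1 p2 / p2"
proof -
  have gt: "p2 > 2" using assms by (auto simp: lam_def split: if_splits)
  then have pos: "1 / 2 - 1 / p2 > 0" by (simp add: field_simps)
  have "lam p1 p2 = (1 / p1 - 1 / p2) / (1 / 2 - 1 / p2)"
    using assms gt by (auto simp: lam_def min_def split: if_splits)
  then have "lam p1 p2 * (1 / 2 - 1 / p2) = 1 / p1 - 1 / p2"
    using pos by (metis nonzero_eq_divide_eq less_numeral_extra(3))
  then show ?thesis by (simp add: right_diff_distrib)
qed

lemma Phi0_cases:
  assumes p: "1 \<le> p1" "p1 \<le> p2" "2 \<le> p2" and q: "1 \<le> q1" "q1 \<le> q2" "2 \<le> q2"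
  shows "p1 \<le> 2 \<Longrightarrow> q1 \<le> 2 \<Longrightarrow> Phi0 m k n p1 p2 q1 q2 =
      min 1 (real n powr (-1/2) * real m powr (1/p2) * real k powr (1/q2))"
    and "lam p1 p2 \<le> lam q1 q2 \<Longrightarrow> lam p1 p2 < 1 \<Longrightarrow> Phi0 m k n p1 p2 q1 q2 =
      Min {1,
        (real n powr (-1/2) * real m powr (1/p2) * real k powr (1/q2)) powr lam p1 p2,
        real m powr (1/p2 - 1/p1)
          * (real n powr (-1/2) * real m powr (1/2) * real k powr (1/q2)) powr lam q1 q2}"
    and "lam p1 p2 \<ge> lam q1 q2 \<Longrightarrow> lam q1 q2 < 1 \<Longrightarrow> Phi0 m k n p1 p2 q1 q2 =
      Min {1,
        (real n powr (-1/2) * real m powr (1/p2) * real k powr (1/q2)) powr lam q1 q2,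
        real k powr (1/q2 - 1/q1)
          * (real n powr (-1/2) * real m powr (1/p2) * real k powr (1/2)) powr lam p1 p2}"
    and "(p1 \<le> 2 \<and> q1 \<le> 2) \<or> (lam p1 p2 \<le> lam q1 q2 \<and> lam p1 p2 < 1)
      \<or> (lam p1 p2 \<ge> lam q1 q2 \<and> lam q1 q2 < 1)"
proof -
  note lp = lam_eq_1_iff[OF p] lam_le_1[of p1 p2]
  note lq = lam_eq_1_iff[OF q] lam_le_1[of q1 q2]
  show "p1 \<le> 2 \<Longrightarrow> q1 \<le> 2 \<Longrightarrow> Phi0 m k n p1 p2 q1 q2 =
      min 1 (real n powr (-1/2) * real m powr (1/p2) * real k powr (1/q2))"
    by (simp add: Phi0_def)
  show "Phi0 m k n p1 p2 q1 q2 =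
      Min {1,
        (real n powr (-1/2) * real m powr (1/p2) * real k powr (1/q2)) powr lam p1 p2,
        real m powr (1/p2 - 1/p1)
          * (real n powr (-1/2) * real m powr (1/2) * real k powr (1/q2)) powr lam q1 q2}"
    if "lam p1 p2 \<le> lam q1 q2" "lam p1 p2 < 1"
    using that lp unfolding Phi0_def by auto
  show "Phi0 m k n p1 p2 q1 q2 =
      Min {1,
        (real n powr (-1/2) * real m powr (1/p2) * real k powr (1/q2)) powr lam q1 q2,
        real k powr (1/q2 - 1/q1)
          * (real n powr (-1/2) * real m powr (1/p2) * real k powr (1/2)) powr lam p1 p2}"
    if le: "lam p1 p2 \<ge> lam q1 q2" and less: "lam q1 q2 < 1"
  proof (cases "lam p1 p2 = lam q1 q2")
    case False
    then show ?thesis using le less lq unfolding Phi0_def by auto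
  next
    case True
    let ?l = "lam q1 q2"
    let ?t = "(real n powr (-1/2) * real m powr (1/p2) * real k powr (1/q2)) powr ?l"
    have "real m powr (1/p2 - 1/p1)
        * (real n powr (-1/2) * real m powr (1/2) * real k powr (1/q2)) powr ?l
        = (real n powr (-1/2)) powr ?l * real m powr (1/p2 - 1/p1 + ?l/2)
          * (real k powr (1/q2)) powr ?l"
      by (simp add: powr_mult powr_powr powr_add)
    also have "1/p2 - 1/p1 + ?l/2 = 1/p2 * ?l"
      using lam_exponent[of p1 p2] True less by simp
    also have "(real n powr (-1/2)) powr ?l * real m powr (1/p2 * ?l)
          * (real k powr (1/q2)) powr ?l = ?t"
      by (simp add: powr_mult powr_powr)
    finally have A: "real m powr (1/p2 - 1/p1)
        * (real n powr (-1/2) * real m powr (1/2) * real k powr (1/q2)) powr ?l = ?t" .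
    have "real k powr (1/q2 - 1/q1)
        * (real n powr (-1/2) * real m powr (1/p2) * real k powr (1/2)) powr ?l
        = (real n powr (-1/2)) powr ?l * (real m powr (1/p2)) powr ?l
          * real k powr (1/q2 - 1/q1 + ?l/2)"
      by (simp add: powr_mult powr_powr powr_add)
    also have "1/q2 - 1/q1 + ?l/2 = 1/q2 * ?l"
      using lam_exponent[of q1 q2] less by simp
    also have "(real n powr (-1/2)) powr ?l * (real m powr (1/p2)) powr ?l
          * real k powr (1/q2 * ?l) = ?t"
      by (simp add: powr_mult powr_powr)
    finally have B: "real k powr (1/q2 - 1/q1)
        * (real n powr (-1/2) * real m powr (1/p2) * real k powr (1/2)) powr ?l = ?t" .
    have "\<not> (p1 \<le> 2 \<and> q1 \<le> 2)" using less lq by auto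
    then show ?thesis using True less by (simp only: Phi0_def A B) simp
  qed
  show "(p1 \<le> 2 \<and> q1 \<le> 2) \<or> (lam p1 p2 \<le> lam q1 q2 \<and> lam p1 p2 < 1)
      \<or> (lam p1 p2 \<ge> lam q1 q2 \<and> lam q1 q2 < 1)"
    using lp lq by linarith
qed

end

theory Submission
  imports Defs
begin

text \<open>
  Put \<open>A = n powr (-1/2) * m powr (1/p2) * k powr (1/q2)\<close>.

  Upper bounds. The core is the estimate \<open>C * n powr (-1/2) * N powr (1/Q)\<close> for the width of the
  Euclidean ball of dimension \<open>N\<close> in \<open>l\<^sub>Q\<close>; with \<open>Q = max p2 q2\<close> it gives \<open>C * A\<close> in the mixed norm.
  The approximating subspace is the row space of an \<open>n \<times> N\<close> sign matrix \<open>G\<close>. A point \<open>x\<close> is rounded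
  to a point \<open>y\<close> of a scaled integer grid, which is automatically sparse, and approximated by
  \<open>G\<^sup>T G y / (16 n)\<close>. For a suitable \<open>G\<close> the error is small in \<open>l\<^sub>Q\<close> up to a remainder whose Euclidean
  norm is at most a fixed \<open>\<kappa> < 1\<close>; iterating removes the remainder. For \<open>0 \<le> \<theta> \<le> 1\<close> and the exponents
  \<open>1/p = (1 - \<theta>)/p2 + \<theta>/2\<close>, \<open>1/q = (1 - \<theta>)/q2 + \<theta>/2\<close>, splitting a point of the unit ball into a part
  small in the \<open>(p2, q2)\<close> norm and a part small in the Euclidean norm gives \<open>C * A powr \<theta>\<close>. All terms
  of \<open>\<Phi>\<^sub>0\<close> follow by including the given ball in a multiple of such a ball, with \<open>\<theta> = 0\<close>,
  \<open>\<theta> = \<lambda>(p)\<close>, \<open>\<theta> = \<lambda>(q)\<close>.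

  Lower bounds. If \<open>P\<close> is the orthogonal projection onto a subspace of dimension at most \<open>n \<le> mk/2\<close>,
  some signed indicator \<open>x\<close> of an \<open>r \<times> l\<close> rectangle satisfies \<open>\<bar>P x\<bar>\<^sup>2 \<le> r l / 2\<close>. Pairing \<open>x - y\<close> with
  \<open>x - P x\<close> bounds the distance of \<open>x\<close> to the subspace from below, and \<open>r\<close>, \<open>l\<close> are then chosen to
  match \<open>\<Phi>\<^sub>0\<close>.
\<close>

section \<open>Rademacher sums\<close>

text \<open>The order \<open>n powr (-1/2) * N powr (1/Q)\<close> leaves no room for a logarithm,
  and this shapes the Euclidean step. One \<open>G\<close> has to serve all grid points, so a union
  bound allows at most exponentially many of them in \<open>n\<close>, and each failure must be
  exponentially rare in \<open>n\<close>. At that level of rarity there is no useful bound on every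
  single entry of \<open>G\<^sup>T G y\<close> off the support of \<open>y\<close>: a few may be
  large. The entries are therefore controlled jointly by one exponential weight, and the large ones,
  which carry little Euclidean mass, stay in the remainder; this is why a step only contracts. The
  divisor \<open>16 n\<close> bounds the squared norm of \<open>G\<close> on sparse vectors, so that
  the step is a damped gradient step on the support. The grid is so coarse that the
  \<open>ln (N / n)\<close> from counting is outweighed by a power of \<open>N / n\<close>. In the
  lower bounds \<open>x - P x\<close> annihilates the subspace; its two pieces have separate dual
  norms, which produce the two terms of a minimum, and the sides of the rectangle balance these
  terms.\<close>

lemma cosh_le_exp_half_square: "cosh (t::real) \<le> exp (t\<^sup>2 / 2)"
proof -
  have main: "cosh u \<le> exp (u\<^sup>2 / 2)" if "0 \<le> u" for u :: real
  proof -
    have d1: "((\<lambda>x. x * cosh x - sinh x) has_real_derivative x * sinh x) (at x)" for x :: real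
      by (auto intro!: derivative_eq_intros)
    have s: "sinh x \<le> x * cosh x" if "0 \<le> x" for x :: real
    proof -
      have "0 * cosh 0 - sinh 0 \<le> x * cosh x - sinh (x::real)"
        by (rule DERIV_nonneg_imp_nondecreasing[OF that]) (use d1 in force)
      then show ?thesis by simp
    qed
    have d2: "((\<lambda>x. - (exp (- x\<^sup>2 / 2) * cosh x)) has_real_derivative
        exp (- x\<^sup>2 / 2) * (x * cosh x - sinh x)) (at x)" for x :: real
      by (auto intro!: derivative_eq_intros simp: algebra_simps)
    have "- (exp (- 0\<^sup>2 / 2) * cosh 0) \<le> - (exp (- u\<^sup>2 / 2) * cosh u)"
      by (rule DERIV_nonneg_imp_nondecreasing[OF that])
        (use d2 s in \<open>force intro!: mult_nonneg_nonneg\<close>)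
    then have "exp (- u\<^sup>2 / 2) * cosh u \<le> 1" by simp
    then show ?thesis by (simp add: exp_minus field_simps)
  qed
  show ?thesis using main[of t] main[of "-t"] by (cases "0 \<le> t") auto
qed

text \<open>A sum over \<open>signs K\<close> is \<open>2 ^ card K\<close> times an expectation over
  independent Rademacher signs. Extensionality outside \<open>K\<close> makes the set
  finite.\<close>

definition signs :: "'a set \<Rightarrow> ('a \<Rightarrow> real) set" where
  "signs K = PiE K (\<lambda>_. {-1, 1})"

lemma finite_signs [simp]: "finite K \<Longrightarrow> finite (signs K)"
  unfolding signs_def by (intro finite_PiE) auto

lemma card_signs: "finite K \<Longrightarrow> card (signs K) = 2 ^ card K"
  unfolding signs_def by (simp add: card_PiE card_insert_if numeral_2_eq_2)

lemma signs_abs: "\<epsilon> \<in> signs K \<Longrightarrow> k \<in> K \<Longrightarrow> \<bar>\<epsilon> k\<bar> = 1"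
  unfolding signs_def by (drule PiE_mem) auto

lemma sum_signs_empty [simp]: "(\<Sum>\<epsilon>\<in>signs {}. f \<epsilon>) = f (\<lambda>_. undefined)"
  by (simp add: signs_def)

lemma sum_signs_insert:
  assumes "finite K" "i \<notin> K"
  shows "(\<Sum>\<epsilon>\<in>signs (insert i K). f \<epsilon>) = (\<Sum>\<epsilon>\<in>signs K. f (\<epsilon>(i := 1)) + f (\<epsilon>(i := -1)) :: real)"
proof -
  have inj: "inj_on (\<lambda>(y, g). g(i := y)) ({-1, 1::real} \<times> signs K)"
    unfolding signs_def using assms(2) by (rule inj_combinator)
  have "(\<Sum>\<epsilon>\<in>signs (insert i K). f \<epsilon>) = (\<Sum>\<epsilon>\<in>(\<lambda>(y, g). g(i := y)) ` ({-1, 1} \<times> signs K). f \<epsilon>)"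
    by (simp add: signs_def PiE_insert_eq)
  also have "\<dots> = (\<Sum>(y, g)\<in>{-1, 1} \<times> signs K. f (g(i := y)))"
    by (subst sum.reindex[OF inj]) (auto intro!: sum.cong)
  also have "\<dots> = (\<Sum>y\<in>{-1, 1}. \<Sum>g\<in>signs K. f (g(i := y)))"
    by (rule sum.cartesian_product[symmetric])
  finally show ?thesis by (simp add: sum.distrib)
qed

lemma sum_fun_upd_signs:
  assumes "finite K" "i \<notin> K"
  shows "(\<Sum>k\<in>insert i K. (\<epsilon>(i := y)) k * b k) = y * b i + (\<Sum>k\<in>K. \<epsilon> k * (b k :: real))"
proof -
  have "(\<Sum>k\<in>K. (\<epsilon>(i := y)) k * b k) = (\<Sum>k\<in>K. \<epsilon> k * b k)"
    using assms by (intro sum.cong) auto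
  then show ?thesis using assms by simp
qed

text \<open>The square does not factor over the signs, so the induction carries a free offset
  \<open>x\<close>: fixing one sign moves the offset by \<open>b i\<close> either way, and averaging
  the two cases leaves a \<open>cosh\<close>. The shape \<open>(x\<^sup>2 + B) / (v - 2 * B)\<close>
  reproduces itself, each coefficient \<open>c\<close> lowering the denominator by
  \<open>2 * c\<^sup>2\<close>.\<close>

lemma sum_signs_exp_square_le:
  fixes b :: "'a \<Rightarrow> real"
  assumes "finite K" "2 * (\<Sum>k\<in>K. (b k)\<^sup>2) < v"
  shows "(\<Sum>\<epsilon>\<in>signs K. exp ((x + (\<Sum>k\<in>K. \<epsilon> k * b k))\<^sup>2 / v))
      \<le> 2 ^ card K * exp ((x\<^sup>2 + (\<Sum>k\<in>K. (b k)\<^sup>2)) / (v - 2 * (\<Sum>k\<in>K. (b k)\<^sup>2)))"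
  using assms
proof (induction K arbitrary: x rule: finite_induct)
  case empty
  then show ?case by (simp add: card_signs)
next
  case (insert i K)
  define B where "B = (\<Sum>k\<in>K. (b k)\<^sup>2)"
  define w where "w = v - 2 * B"
  define c where "c = b i"
  have B: "0 \<le> B" by (simp add: B_def sum_nonneg)
  have w1: "2 * c\<^sup>2 < w"
    using insert.prems insert.hyps by (simp add: w_def B_def c_def)
  then have w: "2 * c\<^sup>2 < w" "0 < w"
    using zero_le_power2[of c] by linarith+
  have IH: "(\<Sum>\<epsilon>\<in>signs K. exp ((z + (\<Sum>k\<in>K. \<epsilon> k * b k))\<^sup>2 / v)) \<le> 2 ^ card K * exp ((z\<^sup>2 + B) / w)" for z
    using insert.IH[of z] insert.prems insert.hyps unfolding B_def w_def
    by (smt (verit) sum.insert zero_le_power2)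
  have "(\<Sum>\<epsilon>\<in>signs (insert i K). exp ((x + (\<Sum>k\<in>insert i K. \<epsilon> k * b k))\<^sup>2 / v))
      = (\<Sum>\<epsilon>\<in>signs K. exp (((x + c) + (\<Sum>k\<in>K. \<epsilon> k * b k))\<^sup>2 / v))
        + (\<Sum>\<epsilon>\<in>signs K. exp (((x - c) + (\<Sum>k\<in>K. \<epsilon> k * b k))\<^sup>2 / v))"
    unfolding sum_signs_insert[OF insert.hyps] sum_fun_upd_signs[OF insert.hyps] sum.distrib c_def
    by (simp add: algebra_simps)
  also have "\<dots> \<le> 2 ^ card K * exp (((x + c)\<^sup>2 + B) / w) + 2 ^ card K * exp (((x - c)\<^sup>2 + B) / w)"
    by (intro add_mono IH)
  also have "\<dots> = 2 ^ card K * 2 * (exp ((x\<^sup>2 + c\<^sup>2 + B) / w) * cosh (2 * x * c / w))"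
  proof -
    have "((x + c)\<^sup>2 + B) / w = (x\<^sup>2 + c\<^sup>2 + B) / w + 2 * x * c / w"
         "((x - c)\<^sup>2 + B) / w = (x\<^sup>2 + c\<^sup>2 + B) / w + - (2 * x * c / w)"
      using w by (auto simp: field_simps power2_eq_square)
    from this[THEN arg_cong[where f = exp]] show ?thesis
      unfolding exp_add cosh_field_def by (simp add: algebra_simps)
  qed
  also have "\<dots> \<le> 2 ^ card K * 2 * (exp ((x\<^sup>2 + c\<^sup>2 + B) / w) * exp ((2 * x * c / w)\<^sup>2 / 2))"
    by (intro mult_left_mono cosh_le_exp_half_square) auto
  also have "\<dots> \<le> 2 ^ card K * 2 * exp ((x\<^sup>2 + (c\<^sup>2 + B)) / (w - 2 * c\<^sup>2))"
  proof -
    have "x\<^sup>2 / w + (2 * x * c / w)\<^sup>2 / 2 = x\<^sup>2 * ((w + 2 * c\<^sup>2) / w\<^sup>2)"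
      using w by (simp add: field_simps power2_eq_square)
    also have "\<dots> \<le> x\<^sup>2 * (1 / (w - 2 * c\<^sup>2))"
    proof (intro mult_left_mono)
      have "(w + 2 * c\<^sup>2) * (w - 2 * c\<^sup>2) = w\<^sup>2 - (2 * c\<^sup>2)\<^sup>2"
        by (simp add: algebra_simps power2_eq_square)
      then have "(w + 2 * c\<^sup>2) * (w - 2 * c\<^sup>2) \<le> w\<^sup>2" by simp
      then show "(w + 2 * c\<^sup>2) / w\<^sup>2 \<le> 1 / (w - 2 * c\<^sup>2)"
        using w by (simp add: divide_simps)
    qed auto
    finally have 1: "x\<^sup>2 / w + (2 * x * c / w)\<^sup>2 / 2 \<le> x\<^sup>2 / (w - 2 * c\<^sup>2)" by simp
    have 2: "(c\<^sup>2 + B) / w \<le> (c\<^sup>2 + B) / (w - 2 * c\<^sup>2)"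
      using w B by (intro divide_left_mono) auto
    have "(x\<^sup>2 + c\<^sup>2 + B) / w + (2 * x * c / w)\<^sup>2 / 2 \<le> (x\<^sup>2 + (c\<^sup>2 + B)) / (w - 2 * c\<^sup>2)"
      using 1 2 by (simp add: add_divide_distrib)
    then show ?thesis by (simp flip: exp_add)
  qed
  finally show ?case
    using insert.hyps by (simp add: w_def B_def c_def algebra_simps)
qed

text \<open>The same induction with the exponent negated. Here the \<open>cosh\<close> works against
  the decay; the larger change \<open>4 * c\<^sup>2\<close> of the denominator pays for it, and
  \<open>4 * B \<le> v\<close> makes
  \<open>w\<^sup>2 \<le> (w - 2 * c\<^sup>2) * (w + 4 * c\<^sup>2)\<close> true.\<close>

lemma sum_signs_exp_minus_square_le:
  fixes b :: "'a \<Rightarrow> real"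
  assumes "finite K" "4 * (\<Sum>k\<in>K. (b k)\<^sup>2) \<le> v" "0 < v"
  shows "(\<Sum>\<epsilon>\<in>signs K. exp (- (x + (\<Sum>k\<in>K. \<epsilon> k * b k))\<^sup>2 / v))
      \<le> 2 ^ card K * exp (- (x\<^sup>2 + (\<Sum>k\<in>K. (b k)\<^sup>2)) / (v + 4 * (\<Sum>k\<in>K. (b k)\<^sup>2)))"
  using assms(1,2)
proof (induction K arbitrary: x rule: finite_induct)
  case empty
  then show ?case by (simp add: card_signs)
next
  case (insert i K)
  define B where "B = (\<Sum>k\<in>K. (b k)\<^sup>2)"
  define w where "w = v + 4 * B"
  define c where "c = b i"
  have B: "0 \<le> B" by (simp add: B_def sum_nonneg)
  have w: "4 * c\<^sup>2 \<le> w" "0 < w"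
    using insert.prems insert.hyps B assms(3) by (auto simp: w_def c_def B_def)
  have IH: "(\<Sum>\<epsilon>\<in>signs K. exp (- (z + (\<Sum>k\<in>K. \<epsilon> k * b k))\<^sup>2 / v)) \<le> 2 ^ card K * exp (- (z\<^sup>2 + B) / w)" for z
    using insert.IH[of z] insert.prems insert.hyps unfolding B_def w_def
    by (smt (verit) sum.insert zero_le_power2)
  have "(\<Sum>\<epsilon>\<in>signs (insert i K). exp (- (x + (\<Sum>k\<in>insert i K. \<epsilon> k * b k))\<^sup>2 / v))
      = (\<Sum>\<epsilon>\<in>signs K. exp (- ((x + c) + (\<Sum>k\<in>K. \<epsilon> k * b k))\<^sup>2 / v))
        + (\<Sum>\<epsilon>\<in>signs K. exp (- ((x - c) + (\<Sum>k\<in>K. \<epsilon> k * b k))\<^sup>2 / v))"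
    unfolding sum_signs_insert[OF insert.hyps] sum_fun_upd_signs[OF insert.hyps] sum.distrib c_def
    by (simp add: algebra_simps)
  also have "\<dots> \<le> 2 ^ card K * exp (- ((x + c)\<^sup>2 + B) / w) + 2 ^ card K * exp (- ((x - c)\<^sup>2 + B) / w)"
    by (intro add_mono IH)
  also have "\<dots> = 2 ^ card K * 2 * (exp (- (x\<^sup>2 + c\<^sup>2 + B) / w) * cosh (2 * x * c / w))"
  proof -
    have "- ((x + c)\<^sup>2 + B) / w = - (x\<^sup>2 + c\<^sup>2 + B) / w + - (2 * x * c / w)"
         "- ((x - c)\<^sup>2 + B) / w = - (x\<^sup>2 + c\<^sup>2 + B) / w + 2 * x * c / w"
      using w by (auto simp: field_simps power2_eq_square)
    from this[THEN arg_cong[where f = exp]] show ?thesis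
      unfolding exp_add cosh_field_def by (simp add: algebra_simps)
  qed
  also have "\<dots> \<le> 2 ^ card K * 2 * (exp (- (x\<^sup>2 + c\<^sup>2 + B) / w) * exp ((2 * x * c / w)\<^sup>2 / 2))"
    by (intro mult_left_mono cosh_le_exp_half_square) auto
  also have "\<dots> \<le> 2 ^ card K * 2 * exp (- (x\<^sup>2 + (c\<^sup>2 + B)) / (w + 4 * c\<^sup>2))"
  proof -
    have "x\<^sup>2 / w - (2 * x * c / w)\<^sup>2 / 2 = x\<^sup>2 * ((w - 2 * c\<^sup>2) / w\<^sup>2)"
      using w by (simp add: field_simps power2_eq_square)
    also have "\<dots> \<ge> x\<^sup>2 * (1 / (w + 4 * c\<^sup>2))"
    proof (intro mult_left_mono)
      have "0 \<le> 2 * c\<^sup>2 * (w - 4 * c\<^sup>2)" using w by (intro mult_nonneg_nonneg) auto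
      then have "w\<^sup>2 \<le> (w - 2 * c\<^sup>2) * (w + 4 * c\<^sup>2)"
        by (simp add: algebra_simps power2_eq_square)
      moreover have "0 < w + 4 * c\<^sup>2" using w by (simp add: add_pos_nonneg)
      ultimately show "1 / (w + 4 * c\<^sup>2) \<le> (w - 2 * c\<^sup>2) / w\<^sup>2"
        using w by (simp add: divide_simps)
    qed auto
    finally have 1: "x\<^sup>2 / (w + 4 * c\<^sup>2) \<le> x\<^sup>2 / w - (2 * x * c / w)\<^sup>2 / 2" by simp
    have 2: "(c\<^sup>2 + B) / (w + 4 * c\<^sup>2) \<le> (c\<^sup>2 + B) / w"
      using w B by (intro divide_left_mono) (auto intro!: mult_pos_pos add_pos_nonneg)
    have "- (x\<^sup>2 + c\<^sup>2 + B) / w + (2 * x * c / w)\<^sup>2 / 2 \<le> - (x\<^sup>2 + (c\<^sup>2 + B)) / (w + 4 * c\<^sup>2)"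
      using 1 2 by (simp add: add_divide_distrib diff_divide_distrib minus_divide_left[symmetric])
    then show ?thesis by (simp flip: exp_add)
  qed
  finally show ?case
    using insert.hyps by (simp add: w_def B_def c_def algebra_simps)
qed

lemma sum_signs_square:
  fixes b :: "'a \<Rightarrow> real"
  assumes "finite K"
  shows "(\<Sum>\<epsilon>\<in>signs K. (x + (\<Sum>k\<in>K. \<epsilon> k * b k))\<^sup>2) = 2 ^ card K * (x\<^sup>2 + (\<Sum>k\<in>K. (b k)\<^sup>2))"
  using assms
proof (induction K arbitrary: x rule: finite_induct)
  case empty
  then show ?case by (simp add: card_signs)
next
  case (insert i K)
  have "(\<Sum>\<epsilon>\<in>signs (insert i K). (x + (\<Sum>k\<in>insert i K. \<epsilon> k * b k))\<^sup>2)
      = (\<Sum>\<epsilon>\<in>signs K. ((x + b i) + (\<Sum>k\<in>K. \<epsilon> k * b k))\<^sup>2)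
        + (\<Sum>\<epsilon>\<in>signs K. ((x - b i) + (\<Sum>k\<in>K. \<epsilon> k * b k))\<^sup>2)"
    unfolding sum_signs_insert[OF insert.hyps] sum_fun_upd_signs[OF insert.hyps] sum.distrib
    by (simp add: algebra_simps)
  then show ?case unfolding insert.IH
    using insert.hyps by (simp add: algebra_simps power2_eq_square)
qed

section \<open>Random sign matrices\<close>

text \<open>\<open>G i\<close> is the column with index \<open>i\<close> and has \<open>n\<close>
  entries. Storing columns makes those on and off the support of a vector separate factors of the
  product.\<close>

definition sign_matrices :: "'a set \<Rightarrow> nat \<Rightarrow> ('a \<Rightarrow> nat \<Rightarrow> real) set" where
  "sign_matrices I n = PiE I (\<lambda>_. signs {..<n})"

text \<open>Coordinate \<open>r\<close> of the product \<open>G x\<close>.\<close>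

definition row_sum :: "'a set \<Rightarrow> ('a \<Rightarrow> nat \<Rightarrow> real) \<Rightarrow> ('a \<Rightarrow> real) \<Rightarrow> nat \<Rightarrow> real" where
  "row_sum I G x r = (\<Sum>i\<in>I. x i * G i r)"

lemma finite_sign_matrices [simp]: "finite I \<Longrightarrow> finite (sign_matrices I n)"
  unfolding sign_matrices_def by (intro finite_PiE) auto

lemma card_sign_matrices: "finite I \<Longrightarrow> card (sign_matrices I n) = 2 ^ (card I * n)"
  unfolding sign_matrices_def by (simp add: card_PiE card_signs power_mult mult.commute)

text \<open>Rows of a uniform sign matrix are independent and uniform, so the mean of a product over
  rows is a power. The bijection is transposition, with restrictions keeping both sides
  extensional.\<close>

lemma sum_sign_matrices_prod_rows:
  fixes F :: "('a \<Rightarrow> real) \<Rightarrow> real"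
  assumes "finite I"
  shows "(\<Sum>G\<in>sign_matrices I n. \<Prod>r<n. F (\<lambda>i\<in>I. G i r)) = (\<Sum>\<epsilon>\<in>signs I. F \<epsilon>) ^ n"
proof -
  have "(\<Sum>\<epsilon>\<in>signs I. F \<epsilon>) ^ n = (\<Prod>r<n. \<Sum>\<epsilon>\<in>signs I. F \<epsilon>)" by simp
  also have "\<dots> = (\<Sum>H\<in>PiE {..<n} (\<lambda>_. signs I). \<Prod>r<n. F (H r))"
    using assms by (intro prod_sum_PiE) auto
  also have "\<dots> = (\<Sum>G\<in>sign_matrices I n. \<Prod>r<n. F (\<lambda>i\<in>I. G i r))"
  proof (rule sum.reindex_bij_witness[where
        i = "\<lambda>G. \<lambda>r\<in>{..<n}. \<lambda>i\<in>I. G i r" and j = "\<lambda>H. \<lambda>i\<in>I. \<lambda>r\<in>{..<n}. H r i"])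
    fix H assume H: "H \<in> PiE {..<n} (\<lambda>_. signs I)"
    have e: "(\<lambda>i\<in>I. H r i) = H r" if "r < n" for r
      using PiE_mem[OF H, of r] that by (auto simp: signs_def intro: PiE_restrict)
    show "(\<lambda>r\<in>{..<n}. \<lambda>i\<in>I. (\<lambda>i\<in>I. \<lambda>r\<in>{..<n}. H r i) i r) = H"
    proof
      fix r
      show "(\<lambda>r\<in>{..<n}. \<lambda>i\<in>I. (\<lambda>i\<in>I. \<lambda>r\<in>{..<n}. H r i) i r) r = H r"
      proof (cases "r < n")
        case True
        then have "(\<lambda>i\<in>I. (\<lambda>i\<in>I. \<lambda>r\<in>{..<n}. H r i) i r) = (\<lambda>i\<in>I. H r i)" by (intro restrict_ext) auto
        then show ?thesis using True e by simp
      next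
        case False
        then show ?thesis using PiE_arb[OF H, of r] by simp
      qed
    qed
    show "(\<lambda>i\<in>I. \<lambda>r\<in>{..<n}. H r i) \<in> sign_matrices I n"
      using H by (auto simp: sign_matrices_def signs_def PiE_iff)
    show "(\<Prod>r<n. F (\<lambda>i\<in>I. (\<lambda>i\<in>I. \<lambda>r\<in>{..<n}. H r i) i r)) = (\<Prod>r<n. F (H r))"
    proof (intro prod.cong refl)
      fix r assume "r \<in> {..<n}"
      then have "(\<lambda>i\<in>I. (\<lambda>i\<in>I. \<lambda>r\<in>{..<n}. H r i) i r) = H r"
        by (subst e[of r, symmetric]) (auto intro!: restrict_ext)
      then show "F (\<lambda>i\<in>I. (\<lambda>i\<in>I. \<lambda>r\<in>{..<n}. H r i) i r) = F (H r)" by simp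
    qed
  next
    fix G assume G: "G \<in> sign_matrices I n"
    show "(\<lambda>i\<in>I. \<lambda>r\<in>{..<n}. (\<lambda>r\<in>{..<n}. \<lambda>i\<in>I. G i r) r i) = G"
    proof (intro ext)
      fix i r
      show "(\<lambda>i\<in>I. \<lambda>r\<in>{..<n}. (\<lambda>r\<in>{..<n}. \<lambda>i\<in>I. G i r) r i) i r = G i r"
        using G by (auto simp: sign_matrices_def signs_def PiE_iff extensional_def restrict_def fun_eq_iff)
    qed
    show "(\<lambda>r\<in>{..<n}. \<lambda>i\<in>I. G i r) \<in> PiE {..<n} (\<lambda>_. signs I)"
      using G by (auto simp: sign_matrices_def signs_def PiE_iff)
  qed
  finally show ?thesis by simp
qed

text \<open>Fubini for two independent blocks of columns.\<close>

lemma sum_PiE_Un_disjoint: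
  fixes F :: "('a \<Rightarrow> 'b) \<Rightarrow> ('a \<Rightarrow> 'b) \<Rightarrow> real"
  assumes "S \<inter> T = {}"
  shows "(\<Sum>G\<in>PiE (S \<union> T) (\<lambda>_. Z). F (restrict G S) (restrict G T))
    = (\<Sum>G\<in>PiE S (\<lambda>_. Z). \<Sum>H\<in>PiE T (\<lambda>_. Z). F G H)"
  unfolding sum.cartesian_product
proof (rule sum.reindex_bij_witness[where
      j = "\<lambda>G. (restrict G S, restrict G T)" and
      i = "\<lambda>(G, H) i. if i \<in> S then G i else if i \<in> T then H i else undefined"])
  fix G assume "G \<in> PiE (S \<union> T) (\<lambda>_. Z)"
  then show "(case (restrict G S, restrict G T) of
      (G, H) \<Rightarrow> \<lambda>i. if i \<in> S then G i else if i \<in> T then H i else undefined) = G"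
    by (auto simp: fun_eq_iff PiE_iff extensional_def)
next
  fix p assume p: "p \<in> PiE S (\<lambda>_. Z) \<times> PiE T (\<lambda>_. Z)"
  obtain G H where [simp]: "p = (G, H)" by (cases p)
  show "(restrict (case p of (G, H) \<Rightarrow> \<lambda>i. if i \<in> S then G i else if i \<in> T then H i else undefined) S,
      restrict (case p of (G, H) \<Rightarrow> \<lambda>i. if i \<in> S then G i else if i \<in> T then H i else undefined) T) = p"
    using p assms by (auto simp: fun_eq_iff PiE_iff extensional_def restrict_def)
qed (auto simp: PiE_iff extensional_def)

section \<open>Tail bounds by Markov's inequality for the counting measure\<close>

lemma card_mult_le_sum:
  fixes f :: "'a \<Rightarrow> real"
  assumes "finite M" "\<And>x. x \<in> M \<Longrightarrow> 0 \<le> f x" "\<And>x. x \<in> M \<Longrightarrow> P x \<Longrightarrow> c \<le> f x"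
  shows "real (card {x \<in> M. P x}) * c \<le> (\<Sum>x\<in>M. f x)"
proof -
  have "real (card {x \<in> M. P x}) * c \<le> (\<Sum>x\<in>{x \<in> M. P x}. f x)"
    using assms(3) by (intro sum_bounded_below) auto
  also have "\<dots> \<le> (\<Sum>x\<in>M. f x)"
    using assms by (intro sum_mono2) auto
  finally show ?thesis .
qed

lemma row_sum_restrict: "row_sum I G x r = (\<Sum>i\<in>I. (\<lambda>i\<in>I. G i r) i * x i)"
  unfolding row_sum_def by (intro sum.cong) auto

text \<open>Exponential Markov inequality: one row contributes to
  \<open>exp (\<bar>G x\<bar>\<^sup>2 / (4 * s))\<close> a factor of mean at most
  \<open>exp (1 / 2)\<close>, while the whole product is at least \<open>exp n\<close> on the
  event.\<close>

lemma card_large_image: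
  fixes x :: "'a \<Rightarrow> real"
  assumes I: "finite I" and s: "0 < (\<Sum>i\<in>I. (x i)\<^sup>2)"
  shows "real (card {G \<in> sign_matrices I n. 4 * real n * (\<Sum>i\<in>I. (x i)\<^sup>2) < (\<Sum>r<n. (row_sum I G x r)\<^sup>2)})
     \<le> exp (- real n / 2) * 2 ^ (card I * n)"
proof -
  define s where "s = (\<Sum>i\<in>I. (x i)\<^sup>2)"
  have s: "0 < s" using assms by (simp add: s_def)
  define F where "F \<epsilon> = exp ((0 + (\<Sum>i\<in>I. \<epsilon> i * x i))\<^sup>2 / (4 * s))" for \<epsilon>
  have "real (card {G \<in> sign_matrices I n. 4 * real n * s < (\<Sum>r<n. (row_sum I G x r)\<^sup>2)}) * exp (real n)
      \<le> (\<Sum>G\<in>sign_matrices I n. \<Prod>r<n. F (\<lambda>i\<in>I. G i r))"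
  proof (intro card_mult_le_sum)
    fix G assume "4 * real n * s < (\<Sum>r<n. (row_sum I G x r)\<^sup>2)"
    then have "real n \<le> (\<Sum>r<n. (row_sum I G x r)\<^sup>2) / (4 * s)"
      using s by (simp add: field_simps)
    then have "exp (real n) \<le> exp (\<Sum>r<n. (row_sum I G x r)\<^sup>2 / (4 * s))"
      by (simp add: sum_divide_distrib)
    also have "\<dots> = (\<Prod>r<n. F (\<lambda>i\<in>I. G i r))"
      by (simp add: exp_sum F_def row_sum_restrict)
    finally show "exp (real n) \<le> (\<Prod>r<n. F (\<lambda>i\<in>I. G i r))" .
  qed (use I in \<open>auto simp: F_def prod_nonneg\<close>)
  also have "\<dots> = (\<Sum>\<epsilon>\<in>signs I. F \<epsilon>) ^ n"
    by (rule sum_sign_matrices_prod_rows[OF I])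
  also have "\<dots> \<le> (2 ^ card I * exp (1 / 2)) ^ n"
  proof (intro power_mono)
    have "(\<Sum>\<epsilon>\<in>signs I. F \<epsilon>) \<le> 2 ^ card I * exp ((0\<^sup>2 + s) / (4 * s - 2 * s))"
      unfolding F_def s_def using s s_def by (intro sum_signs_exp_square_le I) auto
    also have "(0\<^sup>2 + s) / (4 * s - 2 * s) = 1 / 2" using s by (simp add: field_simps)
    finally show "(\<Sum>\<epsilon>\<in>signs I. F \<epsilon>) \<le> 2 ^ card I * exp (1 / 2)" .
  qed (auto simp: F_def sum_nonneg)
  also have "\<dots> = 2 ^ (card I * n) * exp (real n / 2)"
    by (simp add: power_mult power_mult_distrib flip: exp_of_nat_mult)
  also have "exp (real n / 2) = exp (- real n / 2) * exp (real n)"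
    by (simp flip: exp_add)
  finally show ?thesis unfolding s_def by (simp add: mult.commute)
qed

text \<open>The same with the negative exponent: a row has mean at most
  \<open>exp (- 1 / 8)\<close>, and the product is at least \<open>exp (- n / 16)\<close> on the
  event, which leaves half of the decay.\<close>

lemma card_small_image:
  fixes x :: "'a \<Rightarrow> real"
  assumes I: "finite I" and s: "0 < (\<Sum>i\<in>I. (x i)\<^sup>2)"
  shows "real (card {G \<in> sign_matrices I n. (\<Sum>r<n. (row_sum I G x r)\<^sup>2) < real n / 4 * (\<Sum>i\<in>I. (x i)\<^sup>2)})
     \<le> exp (- real n / 16) * 2 ^ (card I * n)"
proof -
  define s where "s = (\<Sum>i\<in>I. (x i)\<^sup>2)"
  have s: "0 < s" using assms by (simp add: s_def)
  define F where "F \<epsilon> = exp (- (0 + (\<Sum>i\<in>I. \<epsilon> i * x i))\<^sup>2 / (4 * s))" for \<epsilon>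
  have "real (card {G \<in> sign_matrices I n. (\<Sum>r<n. (row_sum I G x r)\<^sup>2) < real n / 4 * s}) * exp (- real n / 16)
      \<le> (\<Sum>G\<in>sign_matrices I n. \<Prod>r<n. F (\<lambda>i\<in>I. G i r))"
  proof (intro card_mult_le_sum)
    fix G assume "(\<Sum>r<n. (row_sum I G x r)\<^sup>2) < real n / 4 * s"
    then have "- real n / 16 \<le> - ((\<Sum>r<n. (row_sum I G x r)\<^sup>2) / (4 * s))"
      using s by (simp add: field_simps)
    then have "exp (- real n / 16) \<le> exp (\<Sum>r<n. - (row_sum I G x r)\<^sup>2 / (4 * s))"
      by (simp add: sum_divide_distrib sum_negf)
    also have "\<dots> = (\<Prod>r<n. F (\<lambda>i\<in>I. G i r))"
      by (simp add: exp_sum F_def row_sum_restrict)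
    finally show "exp (- real n / 16) \<le> (\<Prod>r<n. F (\<lambda>i\<in>I. G i r))" .
  qed (use I in \<open>auto simp: F_def prod_nonneg\<close>)
  also have "\<dots> = (\<Sum>\<epsilon>\<in>signs I. F \<epsilon>) ^ n"
    by (rule sum_sign_matrices_prod_rows[OF I])
  also have "\<dots> \<le> (2 ^ card I * exp (- 1 / 8)) ^ n"
  proof (intro power_mono)
    have "(\<Sum>\<epsilon>\<in>signs I. F \<epsilon>) \<le> 2 ^ card I * exp (- (0\<^sup>2 + s) / (4 * s + 4 * s))"
      unfolding F_def s_def using s s_def by (intro sum_signs_exp_minus_square_le I) auto
    also have "- (0\<^sup>2 + s) / (4 * s + 4 * s) = - 1 / 8" using s by (simp add: field_simps)
    finally show "(\<Sum>\<epsilon>\<in>signs I. F \<epsilon>) \<le> 2 ^ card I * exp (- 1 / 8)" .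
  qed (auto simp: F_def sum_nonneg)
  also have "\<dots> = 2 ^ (card I * n) * exp (- real n / 8)"
    by (simp add: power_mult power_mult_distrib flip: exp_of_nat_mult)
  also have "exp (- real n / 8) = exp (- real n / 16) * exp (- real n / 16)"
    by (simp flip: exp_add)
  finally show ?thesis unfolding s_def by (simp add: mult.commute)
qed

lemma exp_half_le_2: "exp (1 / 2 :: real) \<le> 2"
proof -
  have "exp (1 / 2 :: real) ^ 2 \<le> 2 ^ 2"
    using exp_le by (simp flip: exp_of_nat_mult)
  then show ?thesis by (rule power2_le_imp_le) simp
qed

text \<open>With \<open>\<beta>\<close> of order \<open>n / N\<close> the mean of this weight is only \<open>exp (O(n))\<close>, while a bound \<open>exp (O(n))\<close>
  on the weight itself controls the large and the small entries outside the support at once.\<close>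

definition off_support_weight ::
    "'a set \<Rightarrow> nat \<Rightarrow> real \<Rightarrow> ('a \<Rightarrow> nat \<Rightarrow> real) \<Rightarrow> ('a \<Rightarrow> real) \<Rightarrow> real" where
  "off_support_weight I n \<beta> G x = (\<Prod>i\<in>{i \<in> I. x i = 0}.
     1 + \<beta> * exp ((\<Sum>r<n. G i r * row_sum I G x r)\<^sup>2 / (16 * real n * (\<Sum>i\<in>I. (x i)\<^sup>2))))"

text \<open>\<open>G x\<close> depends only on the columns in the support of \<open>x\<close>. Once
  these are fixed, the factors of the weight are independent, each of mean at most
  \<open>1 + 2 * \<beta>\<close>.\<close>

lemma card_large_off_support_weight:
  fixes x :: "'a \<Rightarrow> real"
  assumes I: "finite I" and s: "0 < (\<Sum>i\<in>I. (x i)\<^sup>2)" and \<beta>: "0 \<le> \<beta>" and n: "0 < n"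
  shows "real (card {G \<in> sign_matrices I n. (\<Sum>r<n. (row_sum I G x r)\<^sup>2) \<le> 4 * real n * (\<Sum>i\<in>I. (x i)\<^sup>2)
       \<and> w < off_support_weight I n \<beta> G x}) * w
     \<le> exp (2 * \<beta> * card I) * 2 ^ (card I * n)"
proof -
  define s where "s = (\<Sum>i\<in>I. (x i)\<^sup>2)"
  have s: "0 < s" using assms by (simp add: s_def)
  define S where "S = {i \<in> I. x i \<noteq> 0}"
  define T where "T = {i \<in> I. x i = 0}"
  have ST: "S \<inter> T = {}" "S \<union> T = I" "finite S" "finite T"
    using I by (auto simp: S_def T_def)
  define \<phi> where "\<phi> g b = 1 + \<beta> * exp ((0 + (\<Sum>r<n. g r * b r))\<^sup>2 / (16 * real n * s))" for g b :: "nat \<Rightarrow> real"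
  \<comment> \<open>The indicator keeps only those support columns for which the exponential moment
    of a fresh column is under control; for the others the inner sum is zero.\<close>
  define F where "F G H = of_bool ((\<Sum>r<n. (row_sum S G x r)\<^sup>2) \<le> 4 * real n * s)
      * (\<Prod>i\<in>T. \<phi> (H i) (row_sum S G x))" for G H
  have row: "row_sum I G x = row_sum S (restrict G S) x" for G
    unfolding row_sum_def fun_eq_iff S_def using I
    by (auto intro!: sum.mono_neutral_cong_right)
  have \<phi>1: "1 \<le> \<phi> g b" for g b using \<beta> by (simp add: \<phi>_def)
  have weight: "off_support_weight I n \<beta> G x = (\<Prod>i\<in>T. \<phi> (restrict G T i) (row_sum S (restrict G S) x))" for G
    unfolding off_support_weight_def T_def[symmetric] \<phi>_def s_def row by (intro prod.cong) auto
  have "real (card {G \<in> sign_matrices I n. (\<Sum>r<n. (row_sum I G x r)\<^sup>2) \<le> 4 * real n * s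
       \<and> w < off_support_weight I n \<beta> G x}) * w
      \<le> (\<Sum>G\<in>sign_matrices I n. F (restrict G S) (restrict G T))"
  proof (intro card_mult_le_sum)
    fix G
    show "0 \<le> F (restrict G S) (restrict G T)"
      unfolding F_def using \<phi>1 by (auto intro!: mult_nonneg_nonneg prod_nonneg intro: order_trans[OF zero_le_one])
    assume "(\<Sum>r<n. (row_sum I G x r)\<^sup>2) \<le> 4 * real n * s \<and> w < off_support_weight I n \<beta> G x"
    then show "w \<le> F (restrict G S) (restrict G T)"
      unfolding F_def weight row by simp
  qed (use I in auto)
  also have "\<dots> = (\<Sum>G\<in>PiE S (\<lambda>_. signs {..<n}). \<Sum>H\<in>PiE T (\<lambda>_. signs {..<n}). F G H)"
    unfolding sign_matrices_def ST(2)[symmetric] by (rule sum_PiE_Un_disjoint[OF ST(1)])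
  also have "\<dots> \<le> (\<Sum>G\<in>PiE S (\<lambda>_. signs {..<n}). (2 ^ n * (1 + 2 * \<beta>)) ^ card T)"
  proof (intro sum_mono)
    fix G :: "'a \<Rightarrow> nat \<Rightarrow> real"
    define b where "b = row_sum S G x"
    define B where "B = (\<Sum>r<n. (b r)\<^sup>2)"
    show "(\<Sum>H\<in>PiE T (\<lambda>_. signs {..<n}). F G H) \<le> (2 ^ n * (1 + 2 * \<beta>)) ^ card T"
    proof (cases "B \<le> 4 * real n * s")
      case True
      have ns: "0 < real n * s" using n s by simp
      have B0: "0 \<le> B" by (simp add: B_def sum_nonneg)
      have "(\<Sum>H\<in>PiE T (\<lambda>_. signs {..<n}). F G H) = (\<Sum>H\<in>PiE T (\<lambda>_. signs {..<n}). \<Prod>i\<in>T. \<phi> (H i) b)"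
        using True by (simp add: F_def b_def B_def)
      also have "\<dots> = (\<Prod>i\<in>T. \<Sum>g\<in>signs {..<n}. \<phi> g b)"
        using ST by (intro prod_sum_PiE[symmetric]) auto
      also have "\<dots> = (\<Sum>g\<in>signs {..<n}. \<phi> g b) ^ card T" by simp
      also have "\<dots> \<le> (2 ^ n * (1 + 2 * \<beta>)) ^ card T"
      proof (intro power_mono)
        have "(\<Sum>g\<in>signs {..<n}. exp ((0 + (\<Sum>r<n. g r * b r))\<^sup>2 / (16 * real n * s)))
            \<le> 2 ^ card {..<n} * exp ((0\<^sup>2 + B) / (16 * real n * s - 2 * B))"
          unfolding B_def
        proof (intro sum_signs_exp_square_le)
          show "2 * (\<Sum>r<n. (b r)\<^sup>2) < 16 * real n * s"
            using True[unfolded B_def] ns by linarith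
        qed simp
        \<comment> \<open>From \<open>B \<le> 4 * n * s\<close> the quotient is at most
          \<open>4 / (16 - 8)\<close>. This is why the exponent of the weight has the divisor
          \<open>16 * n * s\<close>.\<close>
        also have "(0\<^sup>2 + B) / (16 * real n * s - 2 * B) \<le> 1 / 2"
        proof -
          have "0 < 16 * real n * s - 2 * B" using True ns by linarith
          moreover have "2 * B \<le> 16 * real n * s - 2 * B" using True by linarith
          ultimately show ?thesis by (simp add: divide_simps)
        qed
        then have "exp ((0\<^sup>2 + B) / (16 * real n * s - 2 * B)) \<le> 2"
          using exp_half_le_2 by (meson exp_le_cancel_iff order_trans)
        finally have "(\<Sum>g\<in>signs {..<n}. exp ((0 + (\<Sum>r<n. g r * b r))\<^sup>2 / (16 * real n * s))) \<le> 2 ^ n * 2"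
          by simp
        from mult_left_mono[OF this \<beta>] show "(\<Sum>g\<in>signs {..<n}. \<phi> g b) \<le> 2 ^ n * (1 + 2 * \<beta>)"
          unfolding \<phi>_def sum.distrib sum_distrib_left[symmetric] by (simp add: card_signs algebra_simps)
      qed (intro sum_nonneg order_trans[OF zero_le_one \<phi>1])
      finally show ?thesis .
    next
      case False
      then show ?thesis using \<beta> by (simp add: F_def b_def B_def)
    qed
  qed
  also have "\<dots> = 2 ^ (card I * n) * (1 + 2 * \<beta>) ^ card T"
    using ST card_Un_disjoint[of S T]
    by (simp add: card_PiE card_signs power_mult_distrib flip: power_mult power_add)
      (simp add: algebra_simps flip: power_add)
  also have "\<dots> \<le> 2 ^ (card I * n) * exp (2 * \<beta>) ^ card I"
  proof (intro mult_left_mono)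
    have "(1 + 2 * \<beta>) ^ card T \<le> (1 + 2 * \<beta>) ^ card I"
      using \<beta> I by (intro power_increasing card_mono) (auto simp: T_def)
    also have "\<dots> \<le> exp (2 * \<beta>) ^ card I"
      using \<beta> by (intro power_mono exp_ge_add_one_self) auto
    finally show "(1 + 2 * \<beta>) ^ card T \<le> exp (2 * \<beta>) ^ card I" .
  qed auto
  also have "\<dots> = exp (2 * \<beta> * card I) * 2 ^ (card I * n)"
    by (simp flip: exp_of_nat_mult add: mult_ac)
  finally show ?thesis unfolding s_def .
qed

text \<open>Union bound. With \<open>\<beta> = n / (64 * card I)\<close> the mean of the weight is
  at most \<open>exp (n / 32)\<close>, against the threshold \<open>exp (n / 16)\<close>; so each of
  the three failures has probability at most \<open>exp (- n / 32)\<close> per point, and there are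
  at most \<open>exp (n / 64)\<close> points.\<close>

lemma exists_good_sign_matrix:
  fixes A :: "('a \<Rightarrow> real) set"
  assumes I: "finite I" "I \<noteq> {}" and n: "128 \<le> n"
    and A: "finite A" "real (card A) \<le> exp (real n / 64)" "\<And>x. x \<in> A \<Longrightarrow> 0 < (\<Sum>i\<in>I. (x i)\<^sup>2)"
  obtains G where "G \<in> sign_matrices I n"
    "\<And>x. x \<in> A \<Longrightarrow> (\<Sum>r<n. (row_sum I G x r)\<^sup>2) \<le> 4 * real n * (\<Sum>i\<in>I. (x i)\<^sup>2)"
    "\<And>x. x \<in> A \<Longrightarrow> real n / 4 * (\<Sum>i\<in>I. (x i)\<^sup>2) \<le> (\<Sum>r<n. (row_sum I G x r)\<^sup>2)"
    "\<And>x. x \<in> A \<Longrightarrow> off_support_weight I n (real n / (64 * card I)) G x \<le> exp (real n / 16)"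
proof -
  define \<beta> where "\<beta> = real n / (64 * card I)"
  have cI: "0 < card I" using I by (simp add: card_gt_0_iff)
  define M where "M = (2::real) ^ (card I * n)"
  define big where "big x = {G \<in> sign_matrices I n. 4 * real n * (\<Sum>i\<in>I. (x i)\<^sup>2) < (\<Sum>r<n. (row_sum I G x r)\<^sup>2)}" for x
  define small where "small x = {G \<in> sign_matrices I n. (\<Sum>r<n. (row_sum I G x r)\<^sup>2) < real n / 4 * (\<Sum>i\<in>I. (x i)\<^sup>2)}" for x
  define off where "off x = {G \<in> sign_matrices I n. (\<Sum>r<n. (row_sum I G x r)\<^sup>2) \<le> 4 * real n * (\<Sum>i\<in>I. (x i)\<^sup>2)
       \<and> exp (real n / 16) < off_support_weight I n \<beta> G x}" for x
  have fin: "finite (sign_matrices I n)" using I by simp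
  define bad where "bad = (\<Union>x\<in>A. big x \<union> small x \<union> off x)"
  have one: "real (card (big x \<union> small x \<union> off x)) \<le> 3 * (exp (- real n / 32) * M)" if x: "x \<in> A" for x
  proof -
    note s = A(3)[OF x]
    have "real (card (big x)) \<le> exp (- real n / 2) * M"
      unfolding big_def M_def by (rule card_large_image[OF I(1) s])
    also have "\<dots> \<le> exp (- real n / 32) * M" by (intro mult_right_mono) (auto simp: M_def)
    finally have 1: "real (card (big x)) \<le> exp (- real n / 32) * M" .
    have "real (card (small x)) \<le> exp (- real n / 16) * M"
      unfolding small_def M_def by (rule card_small_image[OF I(1) s])
    also have "\<dots> \<le> exp (- real n / 32) * M" by (intro mult_right_mono) (auto simp: M_def)
    finally have 2: "real (card (small x)) \<le> exp (- real n / 32) * M" .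
    have "real (card (off x)) * exp (real n / 16) \<le> exp (2 * \<beta> * card I) * M"
      unfolding off_def M_def using n
      by (intro card_large_off_support_weight[OF I(1) s]) (auto simp: \<beta>_def)
    also have "2 * \<beta> * card I = - real n / 32 + real n / 16" using cI by (simp add: \<beta>_def)
    finally have 3: "real (card (off x)) \<le> exp (- real n / 32) * M"
      unfolding exp_add by simp
    have "card (big x \<union> small x \<union> off x) \<le> card (big x) + card (small x) + card (off x)"
      by (meson add_le_mono1 card_Un_le order_trans)
    then show ?thesis using 1 2 3 by linarith
  qed
  have "real (card bad) \<le> (\<Sum>x\<in>A. real (card (big x \<union> small x \<union> off x)))"
    unfolding bad_def using card_UN_le[OF A(1), of "\<lambda>x. big x \<union> small x \<union> off x"]
    by (simp flip: of_nat_sum)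
  also have "\<dots> \<le> real (card A) * (3 * (exp (- real n / 32) * M))"
    using one by (rule sum_bounded_above)
  also have "\<dots> \<le> exp (real n / 64) * (3 * (exp (- real n / 32) * M))"
    using A(2) by (intro mult_right_mono) (auto simp: M_def)
  also have "\<dots> = 3 * exp (- real n / 64) * M"
    by (simp flip: exp_add add: field_simps)
  also have "\<dots> < 1 * M"
  proof (intro mult_strict_right_mono)
    \<comment> \<open>The bound \<open>128 \<le> n\<close> serves here: the three failures per point
      require \<open>3 < exp (n / 64)\<close>.\<close>
    have "3 < exp (2::real)" using exp_ge_one_plus_x_over_n_power_n[of 2 2] by simp
    also have "\<dots> \<le> exp (real n / 64)" using n by simp
    finally show "3 * exp (- real n / 64) < 1" by (simp add: exp_minus field_simps)
  qed (auto simp: M_def)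
  also have "1 * M = real (card (sign_matrices I n))" by (simp add: M_def card_sign_matrices I)
  finally have "card bad < card (sign_matrices I n)" by linarith
  moreover have "finite bad"
    unfolding bad_def big_def small_def off_def using A(1) fin by auto
  ultimately obtain G where G: "G \<in> sign_matrices I n" "G \<notin> bad"
    by (meson card_mono leD subsetI)
  have up: "(\<Sum>r<n. (row_sum I G x r)\<^sup>2) \<le> 4 * real n * (\<Sum>i\<in>I. (x i)\<^sup>2)" if "x \<in> A" for x
    using G that by (auto simp: bad_def big_def)
  show ?thesis
  proof (rule that[OF G(1) up])
    show "real n / 4 * (\<Sum>i\<in>I. (x i)\<^sup>2) \<le> (\<Sum>r<n. (row_sum I G x r)\<^sup>2)" if "x \<in> A" for x
      using G that by (auto simp: bad_def small_def)
    show "off_support_weight I n (real n / (64 * card I)) G x \<le> exp (real n / 16)" if "x \<in> A" for x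
      using G that up[OF that] by (auto simp: bad_def off_def \<beta>_def)
  qed
qed

section \<open>Finite sequence norms and the integer grid\<close>

definition lq_norm :: "'a set \<Rightarrow> real \<Rightarrow> ('a \<Rightarrow> real) \<Rightarrow> real" where
  "lq_norm I q x = (\<Sum>i\<in>I. \<bar>x i\<bar> powr q) powr (1 / q)"

lemma lq_norm_nonneg [simp]: "0 \<le> lq_norm I q x"
  by (simp add: lq_norm_def)

lemma lq_norm_cong: "(\<And>i. i \<in> I \<Longrightarrow> x i = y i) \<Longrightarrow> lq_norm I q x = lq_norm I q y"
  unfolding lq_norm_def by (metis (mono_tags, lifting) sum.cong)

lemma lq_norm_scale: "0 < q \<Longrightarrow> lq_norm I q (\<lambda>i. c * x i) = \<bar>c\<bar> * lq_norm I q x"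
  unfolding lq_norm_def
  by (simp add: abs_mult powr_mult powr_powr sum_nonneg flip: sum_distrib_left)

lemma powr_inverse_le_iff:
  assumes "0 < q" "0 \<le> S" "0 \<le> c"
  shows "S powr (1 / q) \<le> c \<longleftrightarrow> S \<le> c powr (q :: real)"
proof
  assume "S powr (1 / q) \<le> c"
  then have "(S powr (1 / q)) powr q \<le> c powr q" using assms by (intro powr_mono2) auto
  then show "S \<le> c powr q" using assms by (simp add: powr_powr)
next
  assume "S \<le> c powr q"
  then have "S powr (1 / q) \<le> (c powr q) powr (1 / q)" using assms by (intro powr_mono2) auto
  then show "S powr (1 / q) \<le> c" using assms by (simp add: powr_powr)
qed

lemma lq_norm_le_iff: "0 < q \<Longrightarrow> 0 \<le> c \<Longrightarrow> lq_norm I q x \<le> c \<longleftrightarrow> (\<Sum>i\<in>I. \<bar>x i\<bar> powr q) \<le> c powr q"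
  unfolding lq_norm_def by (rule powr_inverse_le_iff) (auto intro: sum_nonneg)

text \<open>Convexity of the power on the closed half line. When one of \<open>u\<close>,
  \<open>v\<close> vanishes it reduces to \<open>a powr q \<le> a\<close> for
  \<open>0 < a \<le> 1\<close>.\<close>

lemma powr_convex_combination:
  fixes u v s t q :: real
  assumes q: "1 \<le> q" and uv: "0 \<le> u" "0 \<le> v" and st: "0 \<le> s" "0 \<le> t" "s + t = 1"
  shows "(s * u + t * v) powr q \<le> s * u powr q + t * v powr q"
proof -
  have z: "(a * b) powr q \<le> a * b powr q" if "0 \<le> a" "a \<le> 1" "0 \<le> b" for a b :: real
  proof (cases "a = 0")
    case False
    then have "a powr q \<le> a" using that q by (intro powr_le_one_le) auto
    then show ?thesis using that by (simp add: powr_mult mult_right_mono)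
  qed (use that in simp)
  consider "u = 0" | "v = 0" | "0 < u" "0 < v" using uv by linarith
  then show ?thesis
  proof cases
    case 3
    have "s = 1 - t" using st by simp
    then show ?thesis
      using convex_onD[OF powr_convex[OF q], of t u v] 3 st \<open>s = 1 - t\<close> by simp
  qed (use z[of t v] z[of s u] uv st in auto)
qed

text \<open>Minkowski's inequality from convexity: \<open>x + y\<close> is \<open>a + b\<close>
  times a convex combination of \<open>x / a\<close> and \<open>y / b\<close>. Positive upper bounds
  \<open>a\<close>, \<open>b\<close> stand in for the norms, so that a vanishing norm is covered by
  letting them decrease.\<close>

lemma lq_norm_triangle:
  assumes q: "1 \<le> q"
  shows "lq_norm I q (\<lambda>i. x i + y i) \<le> lq_norm I q x + lq_norm I q y"
proof -
  have key: "lq_norm I q (\<lambda>i. x i + y i) \<le> a + b"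
    if a: "lq_norm I q x \<le> a" "0 < a" and b: "lq_norm I q y \<le> b" "0 < b" for a b
  proof -
    have conv: "\<bar>x i + y i\<bar> powr q \<le> (a + b) powr q * (a / (a + b) * (\<bar>x i\<bar> powr q / a powr q) + b / (a + b) * (\<bar>y i\<bar> powr q / b powr q))" for i
    proof -
      have "\<bar>x i + y i\<bar> powr q \<le> ((a + b) * (a / (a + b) * (\<bar>x i\<bar> / a) + b / (a + b) * (\<bar>y i\<bar> / b))) powr q"
      proof (intro powr_mono2)
        have "(a + b) * (a / (a + b) * (\<bar>x i\<bar> / a) + b / (a + b) * (\<bar>y i\<bar> / b)) = \<bar>x i\<bar> + \<bar>y i\<bar>"
        proof -
          have "a / (a + b) * (\<bar>x i\<bar> / a) = \<bar>x i\<bar> / (a + b)" "b / (a + b) * (\<bar>y i\<bar> / b) = \<bar>y i\<bar> / (a + b)"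
            using a b by auto
          then show ?thesis using a b by (simp flip: add_divide_distrib)
        qed
        then show "\<bar>x i + y i\<bar> \<le> (a + b) * (a / (a + b) * (\<bar>x i\<bar> / a) + b / (a + b) * (\<bar>y i\<bar> / b))"
          by simp
      qed (use q in auto)
      also have "\<dots> = (a + b) powr q * (a / (a + b) * (\<bar>x i\<bar> / a) + b / (a + b) * (\<bar>y i\<bar> / b)) powr q"
        by (rule powr_mult)
      also have "(a / (a + b) * (\<bar>x i\<bar> / a) + b / (a + b) * (\<bar>y i\<bar> / b)) powr q
          \<le> a / (a + b) * (\<bar>x i\<bar> / a) powr q + b / (a + b) * (\<bar>y i\<bar> / b) powr q"
        using q a b by (intro powr_convex_combination) (auto simp: add_divide_distrib[symmetric])
      finally show ?thesis
        using a b by (simp add: powr_divide mult_left_mono)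
    qed
    have X: "(\<Sum>i\<in>I. \<bar>x i\<bar> powr q) \<le> a powr q" and Y: "(\<Sum>i\<in>I. \<bar>y i\<bar> powr q) \<le> b powr q"
      using a b q by (simp_all add: lq_norm_le_iff)
    have "(\<Sum>i\<in>I. \<bar>x i + y i\<bar> powr q)
        \<le> (\<Sum>i\<in>I. (a + b) powr q * (a / (a + b) * (\<bar>x i\<bar> powr q / a powr q) + b / (a + b) * (\<bar>y i\<bar> powr q / b powr q)))"
      by (intro sum_mono conv)
    also have "\<dots> = (a + b) powr q * (a / (a + b) * ((\<Sum>i\<in>I. \<bar>x i\<bar> powr q) / a powr q) + b / (a + b) * ((\<Sum>i\<in>I. \<bar>y i\<bar> powr q) / b powr q))"
      by (simp only: sum.distrib sum_distrib_left[symmetric] sum_divide_distrib[symmetric])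
    also have "\<dots> \<le> (a + b) powr q * (a / (a + b) * 1 + b / (a + b) * 1)"
      using a b X Y by (intro mult_left_mono add_mono) auto
    also have "a / (a + b) * 1 + b / (a + b) * 1 = 1" using a b by (simp flip: add_divide_distrib)
    finally show ?thesis using a b q by (simp add: lq_norm_le_iff)
  qed
  show ?thesis
  proof (rule field_le_epsilon)
    fix e :: real assume "0 < e"
    then show "lq_norm I q (\<lambda>i. x i + y i) \<le> lq_norm I q x + lq_norm I q y + e"
      using key[of "lq_norm I q x + e / 2" "lq_norm I q y + e / 2"]
      by (simp add: add_nonneg_pos)
  qed
qed

text \<open>Of the \<open>q\<close> powers of an entry, \<open>q - 2\<close> are spent on the sup
  bound \<open>h\<close> and the other two on the Euclidean norm.\<close>

lemma lq_norm_interpolation: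
  assumes q: "2 \<le> q" and I: "finite I" and x: "(\<Sum>i\<in>I. (x i)\<^sup>2) \<le> 1" "\<And>i. i \<in> I \<Longrightarrow> \<bar>x i\<bar> \<le> h" and h: "0 < h"
  shows "lq_norm I q x \<le> h powr (1 - 2 / q)"
proof -
  have "(\<Sum>i\<in>I. \<bar>x i\<bar> powr q) \<le> (\<Sum>i\<in>I. h powr (q - 2) * (x i)\<^sup>2)"
  proof (intro sum_mono)
    fix i assume i: "i \<in> I"
    have "\<bar>x i\<bar> powr q = \<bar>x i\<bar> powr ((q - 2) + 2)" by simp
    also have "\<dots> = \<bar>x i\<bar> powr (q - 2) * \<bar>x i\<bar> powr 2" by (rule powr_add)
    also have "\<bar>x i\<bar> powr 2 = (x i)\<^sup>2" by (cases "x i = 0") (auto simp: powr_numeral)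
    also have "\<bar>x i\<bar> powr (q - 2) * (x i)\<^sup>2 \<le> h powr (q - 2) * (x i)\<^sup>2"
      using q x(2)[OF i] by (intro mult_right_mono powr_mono2) auto
    finally show "\<bar>x i\<bar> powr q \<le> h powr (q - 2) * (x i)\<^sup>2" .
  qed
  also have "\<dots> = h powr (q - 2) * (\<Sum>i\<in>I. (x i)\<^sup>2)" by (simp add: sum_distrib_left)
  also have "\<dots> \<le> h powr (q - 2) * 1" using x by (intro mult_left_mono) auto
  also have "\<dots> = (h powr (1 - 2 / q)) powr q"
    using q by (simp add: powr_powr algebra_simps)
  finally show ?thesis using q by (simp add: lq_norm_le_iff)
qed

lemma lq_norm_le_euclidean:
  assumes q: "2 \<le> q" and I: "finite I" and x: "(\<Sum>i\<in>I. (x i)\<^sup>2) \<le> c\<^sup>2" and c: "0 < c"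
  shows "lq_norm I q x \<le> c"
proof -
  define y where "y i = x i / c" for i
  have y: "(\<Sum>i\<in>I. (y i)\<^sup>2) \<le> 1"
    using x c by (simp add: y_def power_divide flip: sum_divide_distrib)
  have "\<bar>y i\<bar> \<le> 1" if "i \<in> I" for i
  proof -
    have "(y i)\<^sup>2 \<le> (\<Sum>i\<in>I. (y i)\<^sup>2)" using that I by (intro member_le_sum) auto
    then have "(y i)\<^sup>2 \<le> 1" using y by simp
    then show ?thesis by (simp add: abs_square_le_1)
  qed
  then have "lq_norm I q y \<le> 1 powr (1 - 2 / q)" using y q I by (intro lq_norm_interpolation) auto
  moreover have "lq_norm I q x = c * lq_norm I q y"
    using lq_norm_scale[of q I c y] q c by (simp add: y_def)
  ultimately show ?thesis using c by simp
qed

section \<open>Rounding to integers and counting the integer points of a ball\<close>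

definition trunc :: "real \<Rightarrow> int" where
  "trunc z = (if 0 \<le> z then \<lfloor>z\<rfloor> else \<lceil>z\<rceil>)"

text \<open>Rounding towards zero is chosen because all three bounds are used: the modulus does not
  grow, so the rounded point stays in the ball and small entries vanish; an error of at most 1 gives
  the sup bound; an error no larger than the entry gives the Euclidean bound.\<close>

lemma trunc_bounds:
  "\<bar>real_of_int (trunc z)\<bar> \<le> \<bar>z\<bar>" "\<bar>z - real_of_int (trunc z)\<bar> \<le> 1" "\<bar>z - real_of_int (trunc z)\<bar> \<le> \<bar>z\<bar>"
proof -
  have "0 \<le> real_of_int \<lfloor>z\<rfloor> \<and> real_of_int \<lfloor>z\<rfloor> \<le> z \<and> z \<le> real_of_int \<lfloor>z\<rfloor> + 1" if "0 \<le> z"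
    using that floor_correct[of z] by (simp add: le_floor_iff)
  moreover have "real_of_int \<lceil>z\<rceil> \<le> 0 \<and> z \<le> real_of_int \<lceil>z\<rceil> \<and> real_of_int \<lceil>z\<rceil> \<le> z + 1" if "\<not> 0 \<le> z"
    using that ceiling_correct[of z] by (simp add: ceiling_le_iff)
  ultimately show "\<bar>real_of_int (trunc z)\<bar> \<le> \<bar>z\<bar>" "\<bar>z - real_of_int (trunc z)\<bar> \<le> 1"
      "\<bar>z - real_of_int (trunc z)\<bar> \<le> \<bar>z\<bar>"
    unfolding trunc_def by (cases "0 \<le> z"; simp add: abs_if; linarith)+
qed

lemma trunc_0 [simp]: "trunc 0 = 0"
  by (simp add: trunc_def)

text \<open>The integer points of the Euclidean ball of radius \<open>sqrt t\<close>. The bounded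
  range makes finiteness visible, and \<open>integer_gridI\<close> shows that it contains every
  entry, since an integer is at most its square in modulus.\<close>

definition integer_grid :: "'a set \<Rightarrow> real \<Rightarrow> ('a \<Rightarrow> real) set" where
  "integer_grid I t = {x \<in> PiE I (\<lambda>_. real_of_int ` {- int (nat \<lfloor>t\<rfloor>)..int (nat \<lfloor>t\<rfloor>)}). (\<Sum>i\<in>I. (x i)\<^sup>2) \<le> t}"

lemma finite_integer_grid: "finite I \<Longrightarrow> finite (integer_grid I t)"
  unfolding integer_grid_def by (intro finite_Collect_conjI disjI1) (simp add: finite_PiE)

lemma abs_of_int_le_square: "\<bar>real_of_int a\<bar> \<le> (real_of_int a)\<^sup>2"
proof -
  have "\<bar>a\<bar> * 1 \<le> \<bar>a\<bar> * \<bar>a\<bar>" by (cases "a = 0") (simp, intro mult_left_mono, auto)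
  then have "\<bar>a\<bar> \<le> a\<^sup>2" by (simp only: mult_1_right abs_mult_self_eq power2_eq_square)
  then show ?thesis by (metis of_int_abs of_int_le_iff of_int_power)
qed

lemma integer_gridI:
  assumes I: "finite I" and t: "(\<Sum>i\<in>I. (real_of_int (a i))\<^sup>2) \<le> t"
  shows "(\<lambda>i\<in>I. real_of_int (a i)) \<in> integer_grid I t"
proof -
  have "real_of_int (a i) \<in> real_of_int ` {- int (nat \<lfloor>t\<rfloor>)..int (nat \<lfloor>t\<rfloor>)}" if "i \<in> I" for i
  proof -
    have "\<bar>real_of_int (a i)\<bar> \<le> (real_of_int (a i))\<^sup>2" by (rule abs_of_int_le_square)
    also have "\<dots> \<le> (\<Sum>i\<in>I. (real_of_int (a i))\<^sup>2)" using that I by (intro member_le_sum) auto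
    finally have "\<bar>a i\<bar> \<le> \<lfloor>t\<rfloor>" using t by (simp add: le_floor_iff)
    then have "- int (nat \<lfloor>t\<rfloor>) \<le> a i \<and> a i \<le> int (nat \<lfloor>t\<rfloor>)" by linarith
    then show ?thesis by (intro imageI) simp
  qed
  moreover have "(\<Sum>i\<in>I. ((\<lambda>i\<in>I. real_of_int (a i)) i)\<^sup>2) \<le> t" using t by simp
  ultimately show ?thesis unfolding integer_grid_def by (simp del: image_eqI)
qed

text \<open>A geometric series; the subtracted tail term is what carries the induction, by
  \<open>\<zeta> \<le> 1 / 2\<close>.\<close>

lemma sum_powr_abs_le:
  assumes z: "0 < \<zeta>" "\<zeta> \<le> 1 / 2"
  shows "(\<Sum>j\<in>{- int T..int T}. \<zeta> powr \<bar>real_of_int j\<bar>) \<le> 1 + 4 * \<zeta> - 4 * \<zeta> ^ Suc T"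
proof (induction T)
  case 0
  then show ?case using z by simp
next
  case (Suc T)
  have e: "{- int (Suc T)..int (Suc T)} = insert (- int (Suc T)) (insert (int (Suc T)) {- int T..int T})"
    by auto
  have p: "\<zeta> powr \<bar>real_of_int (int (Suc T))\<bar> = \<zeta> ^ Suc T"
    using z by (metis abs_of_nat of_int_of_nat_eq powr_realpow)
  have "(\<Sum>j\<in>{- int (Suc T)..int (Suc T)}. \<zeta> powr \<bar>real_of_int j\<bar>)
      = 2 * \<zeta> ^ Suc T + (\<Sum>j\<in>{- int T..int T}. \<zeta> powr \<bar>real_of_int j\<bar>)"
    unfolding e using p by (subst sum.insert, simp, simp)+ (simp del: of_nat_Suc of_int_of_nat_eq)
  also have "\<dots> \<le> 1 + 4 * \<zeta> - 4 * \<zeta> ^ Suc (Suc T)"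
  proof -
    have "\<zeta> * \<zeta> ^ Suc T \<le> 1 / 2 * \<zeta> ^ Suc T" using z by (intro mult_right_mono) auto
    then have "4 * \<zeta> ^ Suc (Suc T) \<le> 2 * \<zeta> ^ Suc T" by simp
    then show ?thesis using Suc by linarith
  qed
  finally show ?case .
qed

text \<open>Rankin's trick: a point is weighted by \<open>\<zeta>\<close> to the power of its l1
  norm. On the grid this weight is at least \<open>\<zeta> powr t\<close>, because
  \<open>\<bar>j\<bar> \<le> j\<^sup>2\<close> for integers, and it factors over the
  coordinates.\<close>

lemma card_integer_grid:
  assumes I: "finite I" and z: "0 < \<zeta>" "\<zeta> \<le> 1 / 2"
  shows "real (card (integer_grid I t)) * \<zeta> powr t \<le> exp (4 * \<zeta> * card I)"
proof -
  define T where "T = nat \<lfloor>t\<rfloor>"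
  define Z where "Z = real_of_int ` {- int T..int T}"
  have "real (card (integer_grid I t)) * \<zeta> powr t \<le> (\<Sum>x\<in>PiE I (\<lambda>_. Z). \<Prod>i\<in>I. \<zeta> powr \<bar>x i\<bar>)"
    unfolding integer_grid_def T_def[symmetric] Z_def[symmetric]
  proof (intro card_mult_le_sum)
    show "finite (PiE I (\<lambda>_. Z))" using I by (intro finite_PiE) (auto simp: Z_def)
    fix x assume x: "x \<in> PiE I (\<lambda>_. Z)" "(\<Sum>i\<in>I. (x i)\<^sup>2) \<le> t"
    have "(\<Sum>i\<in>I. \<bar>x i\<bar>) \<le> (\<Sum>i\<in>I. (x i)\<^sup>2)"
    proof (intro sum_mono)
      fix i assume "i \<in> I"
      then have "x i \<in> Z" using x by auto
      then show "\<bar>x i\<bar> \<le> (x i)\<^sup>2" using abs_of_int_le_square by (auto simp: Z_def)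
    qed
    then have "\<zeta> powr t \<le> \<zeta> powr (\<Sum>i\<in>I. \<bar>x i\<bar>)" using x z by (intro powr_mono') auto
    also have "\<dots> = (\<Prod>i\<in>I. \<zeta> powr \<bar>x i\<bar>)" using z by (simp add: powr_sum)
    finally show "\<zeta> powr t \<le> (\<Prod>i\<in>I. \<zeta> powr \<bar>x i\<bar>)" .
  qed (auto intro: prod_nonneg)
  also have "\<dots> = (\<Prod>i\<in>I. \<Sum>j\<in>Z. \<zeta> powr \<bar>j\<bar>)"
    using I by (intro prod_sum_PiE[symmetric]) (auto simp: Z_def)
  also have "\<dots> = (\<Sum>j\<in>Z. \<zeta> powr \<bar>j\<bar>) ^ card I" by simp
  also have "(\<Sum>j\<in>Z. \<zeta> powr \<bar>j\<bar>) = (\<Sum>j\<in>{- int T..int T}. \<zeta> powr \<bar>real_of_int j\<bar>)"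
    unfolding Z_def by (subst sum.reindex) (auto simp: inj_on_def)
  also have "\<dots> ^ card I \<le> exp (4 * \<zeta>) ^ card I"
  proof (intro power_mono)
    have "0 \<le> 4 * \<zeta> ^ Suc T" using z by simp
    then have "(\<Sum>j\<in>{- int T..int T}. \<zeta> powr \<bar>real_of_int j\<bar>) \<le> 1 + 4 * \<zeta>"
      using sum_powr_abs_le[OF z, of T] by linarith
    also have "\<dots> \<le> exp (4 * \<zeta>)" by (rule exp_ge_add_one_self)
    finally show "(\<Sum>j\<in>{- int T..int T}. \<zeta> powr \<bar>real_of_int j\<bar>) \<le> exp (4 * \<zeta>)" .
  qed (auto intro: sum_nonneg)
  also have "\<dots> = exp (4 * \<zeta> * card I)" by (simp flip: exp_of_nat_mult add: mult.commute)
  finally show ?thesis .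
qed

section \<open>Sign matrices acting on vectors of small support\<close>

lemma row_sum_add: "row_sum I G (\<lambda>i. x i + y i) r = row_sum I G x r + row_sum I G y r"
  by (simp add: row_sum_def sum.distrib algebra_simps)

lemma row_sum_scale: "row_sum I G (\<lambda>i. c * x i) r = c * row_sum I G x r"
  by (simp add: row_sum_def sum_distrib_left mult_ac)

lemma row_sum_cong: "(\<And>i. i \<in> I \<Longrightarrow> x i = y i) \<Longrightarrow> row_sum I G x r = row_sum I G y r"
  unfolding row_sum_def by (intro sum.cong) auto

lemma L2_set_scale: "L2_set (\<lambda>i. c * f i) A = \<bar>c\<bar> * L2_set f A"
proof -
  have "L2_set (\<lambda>i. c * f i) A = L2_set (\<lambda>i. \<bar>c\<bar> * f i) A"
    by (simp add: L2_set_def power_mult_distrib)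
  then show ?thesis by (simp add: L2_set_right_distrib)
qed

lemma L2_set_square: "(L2_set f A)\<^sup>2 = (\<Sum>i\<in>A. (f i)\<^sup>2)"
  by (simp add: L2_set_def sum_nonneg)

text \<open>A vector is within half its length of a grid point, so the norm on the grid controls the
  operator norm up to a factor 2.\<close>

lemma sparse_operator_norm:
  fixes G :: "'a \<Rightarrow> nat \<Rightarrow> real" and v :: "'a \<Rightarrow> real"
  assumes I: "finite I" and s: "0 < s" and S: "S \<subseteq> I" "real (card S) \<le> s"
    and G: "G \<in> sign_matrices I n"
    and up: "\<And>x. x \<in> integer_grid I (4 * s) \<Longrightarrow> (\<Sum>r<n. (row_sum I G x r)\<^sup>2) \<le> 4 * real n * (\<Sum>i\<in>I. (x i)\<^sup>2)"
    and v: "\<And>i. i \<in> I \<Longrightarrow> i \<notin> S \<Longrightarrow> v i = 0"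
  shows "(\<Sum>r<n. (row_sum I G v r)\<^sup>2) \<le> 16 * real n * (\<Sum>i\<in>I. (v i)\<^sup>2)"
proof -
  define N where "N x = L2_set (row_sum I G x) {..<n}" for x
  define B where "B = {x :: 'a \<Rightarrow> real. (\<forall>i\<in>I. i \<notin> S \<longrightarrow> x i = 0) \<and> (\<Sum>i\<in>I. (x i)\<^sup>2) \<le> 1}"
  have N_scale: "N (\<lambda>i. c * x i) = \<bar>c\<bar> * N x" for c x
    unfolding N_def row_sum_scale by (rule L2_set_scale)
  have "N x \<le> real n * real (card I)" if "x \<in> B" for x
  proof -
    have "N x \<le> (\<Sum>r<n. \<bar>row_sum I G x r\<bar>)" unfolding N_def by (rule L2_set_le_sum_abs)
    also have "\<dots> \<le> (\<Sum>r<n. \<Sum>i\<in>I. 1)"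
    proof (intro sum_mono)
      fix r assume r: "r \<in> {..<n}"
      have "\<bar>row_sum I G x r\<bar> \<le> (\<Sum>i\<in>I. \<bar>x i * G i r\<bar>)" unfolding row_sum_def by (rule sum_abs)
      also have "\<dots> \<le> (\<Sum>i\<in>I. 1)"
      proof (intro sum_mono)
        fix i assume i: "i \<in> I"
        have "\<bar>G i r\<bar> = 1" 
          using G i r by (intro signs_abs[of _ "{..<n}"]) (auto simp: sign_matrices_def)
        moreover have "(x i)\<^sup>2 \<le> 1"
          using that i I member_le_sum[of i I "\<lambda>i. (x i)\<^sup>2"] by (auto simp: B_def)
        ultimately show "\<bar>x i * G i r\<bar> \<le> 1" by (simp add: abs_mult abs_square_le_1)
      qed
      finally show "\<bar>row_sum I G x r\<bar> \<le> (\<Sum>i\<in>I. 1)" .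
    qed
    finally show ?thesis by simp
  qed
  \<comment> \<open>Finiteness of the supremum is what allows the term \<open>M / 2\<close> to be
    absorbed below.\<close>
  then have bdd: "bdd_above (N ` B)" by (auto intro!: bdd_aboveI)
  have zero: "(\<lambda>_. 0) \<in> B" by (simp add: B_def)
  define M where "M = (SUP x\<in>B. N x)"
  have le_M: "N x \<le> M" if "x \<in> B" for x
    unfolding M_def using bdd that by (rule cSUP_upper2) simp
  have "N x \<le> 2 * sqrt n + M / 2" if x: "x \<in> B" for x
  proof -
    \<comment> \<open>The mesh \<open>1 / (2 * sqrt s)\<close> makes the error on at most
      \<open>s\<close> coordinates at most 1/2 in Euclidean norm, while the integer point stays
      within the grid of parameter \<open>4 * s\<close>. \<open>z\<close> is twice the error, hence
      again in the unit ball.\<close>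
    define a where "a i = trunc (2 * sqrt s * x i)" for i
    define y where "y = (\<lambda>i\<in>I. real_of_int (a i))"
    define z where "z i = 2 * (x i - real_of_int (a i) / (2 * sqrt s))" for i
    have y2: "(\<Sum>i\<in>I. (y i)\<^sup>2) \<le> 4 * s"
    proof -
      have "(\<Sum>i\<in>I. (y i)\<^sup>2) \<le> (\<Sum>i\<in>I. 4 * s * (x i)\<^sup>2)"
      proof (intro sum_mono)
        fix i assume "i \<in> I"
        have "\<bar>real_of_int (a i)\<bar>\<^sup>2 \<le> \<bar>2 * sqrt s * x i\<bar>\<^sup>2"
          unfolding a_def by (intro power_mono trunc_bounds) auto
        then show "(y i)\<^sup>2 \<le> 4 * s * (x i)\<^sup>2"
          using s \<open>i \<in> I\<close> by (simp add: y_def power_mult_distrib)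
      qed
      also have "\<dots> \<le> 4 * s * 1"
        unfolding sum_distrib_left[symmetric] using x s by (intro mult_left_mono) (auto simp: B_def)
      finally show ?thesis by simp
    qed
    then have grid: "y \<in> integer_grid I (4 * s)"
      using integer_gridI[OF I, of a "4 * s"] by (simp add: y_def)
    have Ny: "N y \<le> 4 * sqrt s * sqrt n"
    proof (rule power2_le_imp_le)
      have "(N y)\<^sup>2 \<le> 4 * real n * (\<Sum>i\<in>I. (y i)\<^sup>2)"
        unfolding N_def L2_set_square by (rule up[OF grid])
      also have "\<dots> \<le> 4 * real n * (4 * s)" using y2 by (intro mult_left_mono) auto
      also have "\<dots> = (4 * sqrt s * sqrt n)\<^sup>2" using s by (simp add: power_mult_distrib)
      finally show "(N y)\<^sup>2 \<le> (4 * sqrt s * sqrt n)\<^sup>2" .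
    qed (use s in auto)
    have z0: "z i = 0" if "i \<in> I" "i \<notin> S" for i
      using x that by (simp add: z_def a_def B_def)
    have z_le: "(z i)\<^sup>2 \<le> 1 / s" for i
    proof -
      have "z i = (2 * sqrt s * x i - real_of_int (a i)) / sqrt s"
        using s by (simp add: z_def field_simps)
      moreover have "\<bar>2 * sqrt s * x i - real_of_int (a i)\<bar>\<^sup>2 \<le> 1\<^sup>2"
        unfolding a_def by (intro power_mono trunc_bounds) auto
      ultimately show ?thesis using s by (simp add: power_divide divide_right_mono)
    qed
    have "z \<in> B"
    proof -
      have "(\<Sum>i\<in>I. (z i)\<^sup>2) = (\<Sum>i\<in>S. (z i)\<^sup>2)"
        using I S z0 by (intro sum.mono_neutral_right) auto
      also have "\<dots> \<le> real (card S) * (1 / s)" using z_le by (rule sum_bounded_above)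
      also have "\<dots> \<le> 1" using S s by simp
      finally show ?thesis using z0 by (simp add: B_def)
    qed
    have "N x \<le> N (\<lambda>i. 1 / (2 * sqrt s) * y i) + N (\<lambda>i. 1 / 2 * z i)"
    proof -
      have "row_sum I G x r = row_sum I G (\<lambda>i. 1 / (2 * sqrt s) * y i + 1 / 2 * z i) r" for r
        by (rule row_sum_cong) (simp add: y_def z_def diff_divide_distrib)
      then show ?thesis unfolding N_def row_sum_add
        using L2_set_triangle_ineq[of "row_sum I G (\<lambda>i. 1 / (2 * sqrt s) * y i)" "row_sum I G (\<lambda>i. 1 / 2 * z i)"]
        by (simp add: row_sum_add cong: L2_set_cong)
    qed
    also have "\<dots> = N y / (2 * sqrt s) + N z / 2" unfolding N_scale using s by simp
    also have "\<dots> \<le> 4 * sqrt s * sqrt n / (2 * sqrt s) + M / 2"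
      using s by (intro add_mono divide_right_mono Ny le_M \<open>z \<in> B\<close>) auto
    also have "\<dots> = 2 * sqrt n + M / 2" using s by simp
    finally show ?thesis .
  qed
  then have "M \<le> 2 * sqrt n + M / 2"
    unfolding M_def using zero by (intro cSUP_least) auto
  then have M: "M \<le> 4 * sqrt n" by simp
  define c where "c = L2_set v I"
  show ?thesis
  proof (cases "c = 0")
    case True
    then have "\<forall>i\<in>I. v i = 0" using I by (simp add: c_def L2_set_eq_0_iff)
    then show ?thesis by (simp add: row_sum_def)
  next
    case False
    then have c: "0 < c" using L2_set_nonneg[of v I] unfolding c_def by linarith
    define x where "x i = 1 / c * v i" for i
    have c2: "c\<^sup>2 = (\<Sum>i\<in>I. (v i)\<^sup>2)" by (simp add: c_def L2_set_square)
    have "(\<Sum>i\<in>I. (x i)\<^sup>2) = 1"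
      using c by (simp add: x_def power_divide c2[symmetric] flip: sum_divide_distrib)
    then have "x \<in> B" using v by (simp add: B_def x_def)
    then have "N x \<le> 4 * sqrt n" using le_M M by force
    moreover have "N v = c * N x"
      using N_scale[of "1 / c" v] c by (simp add: x_def[abs_def])
    ultimately have "N v \<le> c * (4 * sqrt n)" using c by simp
    then have "(N v)\<^sup>2 \<le> (c * (4 * sqrt n))\<^sup>2" by (intro power_mono) (auto simp: N_def)
    then show ?thesis by (simp add: N_def L2_set_square power_mult_distrib c2 mult_ac)
  qed
qed

text \<open>With \<open>z = \<beta> * exp E\<close> and \<open>t = \<beta> * exp (E / 2)\<close>,
  the logarithm is at least \<open>z / (1 + z)\<close>, which is at least \<open>t / 2\<close> once
  \<open>t \<le> 1\<close> and \<open>t \<le> z\<close>. The upper bound on \<open>E\<close> yields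
  \<open>t \<le> 1\<close>.\<close>

lemma ln_one_plus_lower:
  fixes \<beta> E :: real
  assumes "0 < \<beta>" "\<beta> \<le> 1" "0 \<le> E" "E < 2 * ln (1 / \<beta>)"
  shows "\<beta> / 2 * exp (E / 2) \<le> ln (1 + \<beta> * exp E)"
proof -
  define z where "z = \<beta> * exp E"
  define t where "t = \<beta> * exp (E / 2)"
  have z: "0 < z" using assms by (simp add: z_def)
  have "exp (E / 2) \<le> 1 / \<beta>" using assms by (metis divide_pos_pos exp_le_cancel_iff exp_ln
        less_eq_real_def linordered_field_no_ub mult.commute pos_divide_less_eq zero_less_numeral zero_less_one)
  then have t1: "t \<le> 1" using assms by (simp add: t_def field_simps)
  have tz: "t \<le> z" using assms by (simp add: t_def z_def)
  have "ln (1 / (1 + z)) \<le> 1 / (1 + z) - 1" using z by (intro ln_le_minus_one) auto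
  then have "z / (1 + z) \<le> ln (1 + z)" using z by (simp add: ln_div field_simps)
  moreover have "t / 2 \<le> z / (1 + z)"
  proof -
    have "t * (1 + z) \<le> 2 * z"
    proof -
      have "t * z \<le> 1 * z" using t1 z by (intro mult_right_mono) auto
      then show ?thesis using tz by (simp add: algebra_simps)
    qed
    then show ?thesis using z by (simp add: field_simps)
  qed
  ultimately have "t / 2 \<le> ln (1 + z)" by linarith
  then show ?thesis by (simp add: t_def z_def)
qed

text \<open>\<open>E / q \<le> exp (E / q)\<close>, raised to the power \<open>q / 2\<close>. This
  trades the exponential moment for an l_q bound and is the origin of the factor
  \<open>q powr (1 / 2)\<close> later.\<close>

lemma powr_le_exp_half:
  fixes E q :: real
  assumes "0 \<le> E" "0 < q"
  shows "E powr (q / 2) \<le> q powr (q / 2) * exp (E / 2)"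
proof -
  have "E / q \<le> exp (E / q)" using exp_ge_add_one_self[of "E / q"] by linarith
  then have "(E / q) powr (q / 2) \<le> exp (E / q) powr (q / 2)"
    using assms by (intro powr_mono2) auto
  also have "\<dots> = exp (E / 2)" using assms by (simp add: powr_def)
  finally show ?thesis using assms by (simp add: powr_divide field_simps)
qed

text \<open>The coefficients \<open>E i\<close> are the exponents in the off-support weight. Large ones carry little
  Euclidean mass; the exponential moment of the others is bounded by the dimension.\<close>

lemma off_support_split:
  fixes E :: "'a \<Rightarrow> real" and \<beta> d :: real
  assumes T: "finite T" and \<beta>: "0 < \<beta>" "\<beta> \<le> 1" and E: "\<And>i. i \<in> T \<Longrightarrow> 0 \<le> E i"
    and w: "(\<Prod>i\<in>T. 1 + \<beta> * exp (E i)) \<le> exp d"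
  obtains W where "W \<subseteq> T" "(\<Sum>i\<in>W. E i) \<le> 2 * d" "(\<Sum>i\<in>T - W. exp (E i / 2)) \<le> 2 * d / \<beta>"
proof -
  define L where "L i = ln (1 + \<beta> * exp (E i))" for i
  \<comment> \<open>The threshold is where \<open>\<beta> * exp (E i / 2)\<close> reaches 1. Above
    it a factor of the product is at least \<open>exp (E i / 2)\<close>, so its logarithm pays for
    \<open>E i / 2\<close>; below it \<open>ln_one_plus_lower\<close> applies.\<close>
  define W where "W = {i \<in> T. 2 * ln (1 / \<beta>) \<le> E i}"
  have W: "W \<subseteq> T" by (auto simp: W_def)
  have pos: "0 < 1 + \<beta> * exp (E i)" for i using \<beta> by (simp add: add_pos_pos)
  have L0: "0 \<le> L i" for i using \<beta> by (simp add: L_def)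
  have sumL: "(\<Sum>i\<in>T. L i) \<le> d"
  proof -
    have "(\<Sum>i\<in>T. L i) = ln (\<Prod>i\<in>T. 1 + \<beta> * exp (E i))"
      unfolding L_def using pos T by (subst ln_prod) (auto simp: less_imp_neq[symmetric])
    also have "\<dots> \<le> ln (exp d)" using w pos by (subst ln_le_cancel_iff) (auto intro: prod_pos)
    finally show ?thesis by simp
  qed
  have "(\<Sum>i\<in>W. E i / 2) \<le> (\<Sum>i\<in>W. L i)"
  proof (intro sum_mono)
    fix i assume i: "i \<in> W"
    have "1 / \<beta> = exp (ln (1 / \<beta>))" using \<beta> by simp
    also have "\<dots> \<le> exp (E i / 2)" using i by (simp add: W_def)
    finally have "1 \<le> \<beta> * exp (E i / 2)" using \<beta> by (simp add: field_simps)
    then have "1 * exp (E i / 2) \<le> \<beta> * exp (E i / 2) * exp (E i / 2)"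
      by (intro mult_right_mono) auto
    also have "\<dots> = \<beta> * exp (E i)" by (simp add: mult.assoc flip: exp_add)
    finally have "exp (E i / 2) \<le> 1 + \<beta> * exp (E i)" by simp
    then have "ln (exp (E i / 2)) \<le> L i" unfolding L_def using pos by (subst ln_le_cancel_iff) auto
    then show "E i / 2 \<le> L i" by simp
  qed
  also have "\<dots> \<le> (\<Sum>i\<in>T. L i)" using W T L0 by (intro sum_mono2) auto
  finally have 1: "(\<Sum>i\<in>W. E i) \<le> 2 * d" using sumL by (simp flip: sum_divide_distrib)
  have "(\<Sum>i\<in>T - W. \<beta> / 2 * exp (E i / 2)) \<le> (\<Sum>i\<in>T - W. L i)"
    unfolding L_def using \<beta> E by (intro sum_mono ln_one_plus_lower) (auto simp: W_def)
  also have "\<dots> \<le> (\<Sum>i\<in>T. L i)" using T L0 by (intro sum_mono2) auto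
  finally have "\<beta> / 2 * (\<Sum>i\<in>T - W. exp (E i / 2)) \<le> d"
    using sumL by (simp add: sum_distrib_left)
  then have 2: "(\<Sum>i\<in>T - W. exp (E i / 2)) \<le> 2 * d / \<beta>" using \<beta> by (simp add: field_simps)
  from that[OF W 1 2] show ?thesis .
qed

section \<open>Euclidean balls\<close>

text \<open>A gradient step shortens the rounded point on its support, because there the quadratic
  form of \<open>G\<close> is comparable to \<open>n\<close>. The l_q part \<open>u\<close> collects
  the rounding error and the moderate entries off the support; the remainder \<open>w\<close>
  collects the shortened support part and the few large entries.\<close>

lemma one_step_approximation:
  fixes G :: "'a \<Rightarrow> nat \<Rightarrow> real" and x :: "'a \<Rightarrow> real" and q s :: real
  assumes I: "finite I" and s: "0 < s" and q: "2 \<le> q" and n: "0 < n" "n \<le> card I"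
    and G: "G \<in> sign_matrices I n"
    and up: "\<And>x. x \<in> integer_grid I (4 * s) \<Longrightarrow> (\<Sum>r<n. (row_sum I G x r)\<^sup>2) \<le> 4 * real n * (\<Sum>i\<in>I. (x i)\<^sup>2)"
    and low: "\<And>x. x \<in> integer_grid I (4 * s) \<Longrightarrow> real n / 4 * (\<Sum>i\<in>I. (x i)\<^sup>2) \<le> (\<Sum>r<n. (row_sum I G x r)\<^sup>2)"
    and off: "\<And>x. x \<in> integer_grid I (4 * s) \<Longrightarrow> 0 < (\<Sum>i\<in>I. (x i)\<^sup>2) \<Longrightarrow>
       off_support_weight I n (real n / (64 * card I)) G x \<le> exp (real n / 16)"
    and x: "(\<Sum>i\<in>I. (x i)\<^sup>2) \<le> 1"
  obtains c u w where "\<And>i. i \<in> I \<Longrightarrow> x i = (\<Sum>r<n. c r * G i r) + u i + w i"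
    "lq_norm I q u \<le> s powr (- (1 / 2 - 1 / q)) + q powr (1 / 2) * (8 * card I) powr (1 / q) * real n powr (- 1 / 2)"
    "(\<Sum>i\<in>I. (w i)\<^sup>2) \<le> 127 / 128"
proof -
  define a where "a i = trunc (sqrt s * x i)" for i
  define y where "y i = real_of_int (a i) / sqrt s" for i
  define A where "A = (\<lambda>i\<in>I. real_of_int (a i))"
  have ss: "0 < sqrt s" using s by simp
  have a_le: "\<bar>real_of_int (a i)\<bar> \<le> sqrt s * \<bar>x i\<bar>" for i
    using trunc_bounds(1)[of "sqrt s * x i"] s by (simp add: a_def abs_mult)
  have y_le: "(y i)\<^sup>2 \<le> (x i)\<^sup>2" for i
  proof -
    have "\<bar>y i\<bar> \<le> \<bar>x i\<bar>" using a_le[of i] ss by (simp add: y_def field_simps)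
    then show ?thesis by (simp add: abs_le_square_iff)
  qed
  have xy1: "\<bar>x i - y i\<bar> \<le> 1 / sqrt s" for i
  proof -
    have "x i - y i = (sqrt s * x i - real_of_int (a i)) / sqrt s" using ss by (simp add: y_def field_simps)
    then show ?thesis using trunc_bounds(2)[of "sqrt s * x i"] ss by (simp add: a_def divide_right_mono)
  qed
  have xy2: "(x i - y i)\<^sup>2 \<le> (x i)\<^sup>2" for i
  proof -
    have "x i - y i = (sqrt s * x i - real_of_int (a i)) / sqrt s" using ss by (simp add: y_def field_simps)
    then have "\<bar>x i - y i\<bar> \<le> \<bar>sqrt s * x i\<bar> / sqrt s"
      using trunc_bounds(3)[of "sqrt s * x i"] ss by (simp add: a_def divide_right_mono del: abs_mult)
    then show ?thesis using ss by (simp add: abs_mult abs_le_square_iff)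
  qed
  have V1: "(\<Sum>i\<in>I. (y i)\<^sup>2) \<le> 1" 
    by (rule order_trans[OF sum_mono x]) (rule y_le)
  have a2: "(\<Sum>i\<in>I. (real_of_int (a i))\<^sup>2) = s * (\<Sum>i\<in>I. (y i)\<^sup>2)"
    using s by (simp add: y_def power_divide sum_distrib_left)
  then have a2_le: "(\<Sum>i\<in>I. (real_of_int (a i))\<^sup>2) \<le> s" using V1 s by simp
  have grid: "A \<in> integer_grid I (4 * s)"
    unfolding A_def using a2_le s I by (intro integer_gridI) auto
  have A2: "(\<Sum>i\<in>I. (A i)\<^sup>2) = s * (\<Sum>i\<in>I. (y i)\<^sup>2)" using a2 by (simp add: A_def)
  have u0: "lq_norm I q (\<lambda>i. x i - y i) \<le> s powr (- (1 / 2 - 1 / q))"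
  proof -
    have "lq_norm I q (\<lambda>i. x i - y i) \<le> (1 / sqrt s) powr (1 - 2 / q)"
    proof (rule lq_norm_interpolation[OF q I])
      show "(\<Sum>i\<in>I. (x i - y i)\<^sup>2) \<le> 1" 
        by (rule order_trans[OF sum_mono x]) (rule xy2)
    qed (use xy1 ss in auto)
    also have "1 / sqrt s = s powr (- 1 / 2)"
      using s by (simp add: powr_half_sqrt[symmetric] powr_minus field_simps)
    finally show ?thesis by (simp add: powr_powr algebra_simps diff_divide_distrib)
  qed
  have rho: "0 \<le> q powr (1 / 2) * (8 * card I) powr (1 / q) * real n powr (- 1 / 2)" by simp
  define V where "V = (\<Sum>i\<in>I. (y i)\<^sup>2)"
  have V0: "0 \<le> V" by (simp add: V_def sum_nonneg)
  show ?thesis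
  proof (cases "V = 0")
    \<comment> \<open>Every entry rounds to zero, so \<open>x\<close> itself is the rounding error
      and is small in l_q.\<close>
    case True
    then have "y i = 0" if "i \<in> I" for i using that I by (simp add: V_def sum_nonneg_eq_0_iff)
    then have "lq_norm I q (\<lambda>i. x i - y i) = lq_norm I q x" by (intro lq_norm_cong) simp
    then have "lq_norm I q x \<le> s powr (- (1 / 2 - 1 / q)) + q powr (1 / 2) * (8 * card I) powr (1 / q) * real n powr (- 1 / 2)"
      using u0 rho by linarith
    then show ?thesis using that[of "\<lambda>_. 0" x "\<lambda>_. 0"] by simp
  next
    case False
    then have V: "0 < V" using V0 by simp
    define b where "b = row_sum I G y"
    define B where "B = (\<Sum>r<n. (b r)\<^sup>2)"
    define d where "d i = (\<Sum>r<n. G i r * b r)" for i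
    define T where "T = {i \<in> I. A i = 0}"
    define S where "S = I - T"
    have fin: "finite S" "finite T" "S \<inter> T = {}" "S \<union> T = I" "S \<subseteq> I" "T \<subseteq> I"
      using I by (auto simp: S_def T_def)
    have yT: "y i = 0" if "i \<in> T" for i using that by (auto simp: T_def A_def y_def)
    have rowA: "row_sum I G A r = sqrt s * b r" for r
    proof -
      have "row_sum I G A r = row_sum I G (\<lambda>i. sqrt s * y i) r"
        using ss by (intro row_sum_cong) (simp add: A_def y_def)
      then show ?thesis by (simp add: row_sum_scale b_def)
    qed
    have n0: "0 < real n" using n by simp
    have sumb: "(\<Sum>r<n. (row_sum I G A r)\<^sup>2) = s * B"
      using s by (simp add: rowA power_mult_distrib B_def sum_distrib_left)
    have B_low: "real n / 4 * V \<le> B"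
      using low[OF grid] s unfolding sumb A2 V_def[symmetric] by (simp add: field_simps)
    have B0: "0 \<le> B" by (simp add: B_def sum_nonneg)
    have cardS: "real (card S) \<le> s"
    proof -
      have "real (card S) = (\<Sum>i\<in>S. 1)" by simp
      also have "\<dots> \<le> (\<Sum>i\<in>S. (real_of_int (a i))\<^sup>2)"
      proof (intro sum_mono)
        fix i assume "i \<in> S"
        then have "a i \<noteq> 0" by (auto simp: S_def T_def A_def)
        then have "1 \<le> \<bar>real_of_int (a i)\<bar>" by linarith
        then show "1 \<le> (real_of_int (a i))\<^sup>2" using abs_of_int_le_square[of "a i"] by linarith
      qed
      also have "\<dots> \<le> (\<Sum>i\<in>I. (real_of_int (a i))\<^sup>2)" using fin I by (intro sum_mono2) auto
      finally show ?thesis using a2_le by linarith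
    qed
    define D where "D = (\<Sum>i\<in>S. (d i)\<^sup>2)"
    have D0: "0 \<le> D" by (simp add: D_def sum_nonneg)
    have swap: "(\<Sum>r<n. row_sum I G v r * b r) = (\<Sum>i\<in>I. v i * d i)" for v
      unfolding row_sum_def d_def sum_distrib_right sum_distrib_left
      by (subst sum.swap) (simp add: mult_ac)
    \<comment> \<open>Duality: pairing with \<open>v\<close>, the restriction of \<open>d\<close> to
      \<open>S\<close>, turns the operator bound on vectors supported in \<open>S\<close> into a
      bound on the restriction of \<open>G\<^sup>T b\<close>.\<close>
    have D_le: "D \<le> 16 * real n * B"
    proof (cases "D = 0")
      case False
      define v where "v i = (if i \<in> S then d i else 0)" for i
      have vd: "(\<Sum>i\<in>I. v i * d i) = D"
        unfolding D_def v_def using fin I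
        by (intro sum.mono_neutral_cong_right) (auto simp: power2_eq_square)
      have vv: "(\<Sum>i\<in>I. (v i)\<^sup>2) = D"
        unfolding D_def v_def using fin I by (intro sum.mono_neutral_cong_right) auto
      have "(\<Sum>r<n. (row_sum I G v r)\<^sup>2) \<le> 16 * real n * D"
        unfolding vv[symmetric] by (rule sparse_operator_norm[OF I s fin(5) cardS G up]) (auto simp: v_def)
      then have "(\<Sum>r<n. (row_sum I G v r)\<^sup>2) * B \<le> 16 * real n * D * B"
        using B0 by (rule mult_right_mono)
      moreover have "D\<^sup>2 \<le> (\<Sum>r<n. (row_sum I G v r)\<^sup>2) * B"
        unfolding B_def vd[symmetric] swap[symmetric] by (rule Cauchy_Schwarz_ineq_sum)
      ultimately have "D * D \<le> D * (16 * real n * B)" by (simp add: power2_eq_square mult_ac)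
      then show ?thesis using False D0 by simp
    qed (use B0 in simp)
    have yd: "(\<Sum>i\<in>S. y i * d i) = B"
    proof -
      have "(\<Sum>i\<in>S. y i * d i) = (\<Sum>i\<in>I. y i * d i)"
        using fin I yT by (intro sum.mono_neutral_left) auto
      also have "\<dots> = B" unfolding swap[symmetric] B_def b_def by (simp add: power2_eq_square)
      finally show ?thesis .
    qed
    have yy: "(\<Sum>i\<in>S. (y i)\<^sup>2) = V"
      unfolding V_def using fin I yT by (intro sum.mono_neutral_left) auto
    define h where "h i = y i - d i / (16 * real n)" for i
    \<comment> \<open>The cross term gains \<open>B / (8 * n)\<close> and the quadratic term loses
      at most half of that; \<open>n / 4 * V \<le> B\<close> turns what is left into
      \<open>V / 64\<close>.\<close>
    have hS: "(\<Sum>i\<in>S. (h i)\<^sup>2) \<le> V - V / 64"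
    proof -
      have "(\<Sum>i\<in>S. (h i)\<^sup>2) = (\<Sum>i\<in>S. (y i)\<^sup>2 - 1 / (8 * real n) * (y i * d i) + 1 / (256 * (real n)\<^sup>2) * (d i)\<^sup>2)"
        using n0 by (intro sum.cong) (auto simp: h_def power2_eq_square field_simps)
      also have "\<dots> = V - 1 / (8 * real n) * B + 1 / (256 * (real n)\<^sup>2) * D"
        unfolding sum.distrib sum_subtractf sum_distrib_left[symmetric] yy yd D_def ..
      also have "1 / (256 * (real n)\<^sup>2) * D \<le> 1 / (256 * (real n)\<^sup>2) * (16 * real n * B)"
        using D_le by (intro mult_left_mono) auto
      also have "\<dots> = 1 / (16 * real n) * B" using n0 by (simp add: power2_eq_square field_simps)
      finally have "(\<Sum>i\<in>S. (h i)\<^sup>2) \<le> V - 1 / (16 * real n) * B" using n0 by (simp add: field_simps)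
      moreover have "1 / (16 * real n) * (real n / 4 * V) \<le> 1 / (16 * real n) * B"
        using B_low n0 by (intro mult_left_mono) auto
      ultimately show ?thesis using n0 by simp
    qed
    define E where "E i = (d i)\<^sup>2 / (16 * real n * V)" for i
    have E_eq: "(\<Sum>r<n. G i r * row_sum I G A r)\<^sup>2 / (16 * real n * (\<Sum>i\<in>I. (A i)\<^sup>2)) = E i" for i
    proof -
      have "(\<Sum>r<n. G i r * row_sum I G A r) = sqrt s * d i"
        by (simp add: rowA d_def sum_distrib_left mult_ac)
      then show ?thesis using s V n0 unfolding A2 V_def[symmetric] E_def
        by (simp add: power_mult_distrib field_simps)
    qed
    have A_pos: "0 < (\<Sum>i\<in>I. (A i)\<^sup>2)" using V s by (simp add: A2 V_def)
    define \<beta> where "\<beta> = real n / (64 * card I)"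
    have cI: "0 < real (card I)" using n by simp
    have \<beta>: "0 < \<beta>" "\<beta> \<le> 1" using n cI by (auto simp: \<beta>_def field_simps)
    have prod: "(\<Prod>i\<in>T. 1 + \<beta> * exp (E i)) \<le> exp (real n / 16)"
      using off[OF grid A_pos] unfolding off_support_weight_def E_eq T_def[symmetric] \<beta>_def .
    have E0: "0 \<le> E i" for i using V by (simp add: E_def)
    obtain W where W: "W \<subseteq> T" "(\<Sum>i\<in>W. E i) \<le> 2 * (real n / 16)"
        "(\<Sum>i\<in>T - W. exp (E i / 2)) \<le> 2 * (real n / 16) / \<beta>"
      by (rule off_support_split[OF fin(2) \<beta> E0 prod])
    have hT: "(h i)\<^sup>2 = V / (16 * real n) * E i" if "i \<in> T" for i
      using yT[OF that] V n0 by (simp add: h_def E_def power2_eq_square field_simps)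
    \<comment> \<open>The large entries off the support give back at most half of the gain
      \<open>V / 64\<close>, which leaves the contraction factor 127/128.\<close>
    have hW: "(\<Sum>i\<in>W. (h i)\<^sup>2) \<le> V / 128"
    proof -
      have "(\<Sum>i\<in>W. (h i)\<^sup>2) = V / (16 * real n) * (\<Sum>i\<in>W. E i)"
        unfolding sum_distrib_left using W hT by (intro sum.cong) auto
      also have "\<dots> \<le> V / (16 * real n) * (2 * (real n / 16))"
        using W V n0 by (intro mult_left_mono) auto
      also have "\<dots> = V / 128" using n0 by simp
      finally show ?thesis .
    qed
    define w where "w i = (if i \<in> S \<union> W then h i else 0)" for i
    define g where "g i = (if i \<in> T - W then h i else 0)" for i
    have w2: "(\<Sum>i\<in>I. (w i)\<^sup>2) \<le> 127 / 128"
    proof -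
      have "(\<Sum>i\<in>I. (w i)\<^sup>2) = (\<Sum>i\<in>S \<union> W. (h i)\<^sup>2)"
        unfolding w_def using I fin W by (intro sum.mono_neutral_cong_right) auto
      also have "\<dots> = (\<Sum>i\<in>S. (h i)\<^sup>2) + (\<Sum>i\<in>W. (h i)\<^sup>2)"
        using fin W by (intro sum.union_disjoint) (auto intro: finite_subset)
      finally show ?thesis using hS hW V1 unfolding V_def[symmetric] by linarith
    qed
    \<comment> \<open>Here \<open>(h i)\<^sup>2 \<le> E i / n\<close>, since
      \<open>V \<le> 1\<close>; the \<open>q / 2\<close> power of \<open>E i\<close> is dominated by
      \<open>exp (E i / 2)\<close>, and the value of \<open>\<beta>\<close> makes these exponentials
      sum to at most \<open>8 * card I\<close>.\<close>
    have g_le: "lq_norm I q g \<le> q powr (1 / 2) * (8 * card I) powr (1 / q) * real n powr (- 1 / 2)"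
    proof -
      have q0: "0 < q" using q by simp
      have "(\<Sum>i\<in>I. \<bar>g i\<bar> powr q) = (\<Sum>i\<in>T - W. \<bar>h i\<bar> powr q)"
        unfolding g_def using I fin by (intro sum.mono_neutral_cong_right) auto
      also have "\<dots> \<le> (\<Sum>i\<in>T - W. real n powr (- (q / 2)) * (q powr (q / 2) * exp (E i / 2)))"
      proof (intro sum_mono)
        fix i assume i: "i \<in> T - W"
        have "(h i)\<^sup>2 \<le> E i / real n"
        proof -
          have "V / 16 * (E i / real n) \<le> 1 * (E i / real n)"
            using V1 E0 n0 unfolding V_def[symmetric] by (intro mult_right_mono) auto
          then show ?thesis using hT i by simp
        qed
        then have "((h i)\<^sup>2) powr (q / 2) \<le> (E i / real n) powr (q / 2)"
          using q0 by (intro powr_mono2) auto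
        also have "\<dots> = real n powr (- (q / 2)) * E i powr (q / 2)"
          by (simp add: powr_divide powr_minus field_simps)
        also have "\<dots> \<le> real n powr (- (q / 2)) * (q powr (q / 2) * exp (E i / 2))"
          by (intro mult_left_mono powr_le_exp_half E0 q0) auto
        also have "((h i)\<^sup>2) powr (q / 2) = \<bar>h i\<bar> powr q"
        proof -
          have "(h i)\<^sup>2 = \<bar>h i\<bar> powr 2" by (cases "h i = 0") (auto simp: powr_numeral)
          then show ?thesis by (simp only: powr_powr) simp
        qed
        finally show "\<bar>h i\<bar> powr q \<le> real n powr (- (q / 2)) * (q powr (q / 2) * exp (E i / 2))" .
      qed
      also have "\<dots> = real n powr (- (q / 2)) * q powr (q / 2) * (\<Sum>i\<in>T - W. exp (E i / 2))"
        by (simp add: sum_distrib_left mult_ac)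
      also have "\<dots> \<le> real n powr (- (q / 2)) * q powr (q / 2) * (8 * card I)"
      proof (intro mult_left_mono)
        have "2 * (real n / 16) / \<beta> = 8 * card I" using n0 cI by (simp add: \<beta>_def)
        then show "(\<Sum>i\<in>T - W. exp (E i / 2)) \<le> 8 * card I" using W by simp
      qed simp
      also have "\<dots> = (q powr (1 / 2) * (8 * card I) powr (1 / q) * real n powr (- 1 / 2)) powr q"
        using q0 cI n0 by (simp add: powr_mult powr_powr mult_ac)
      finally show ?thesis using q0 by (subst lq_norm_le_iff) auto
    qed
    show ?thesis
    proof (rule that[of "\<lambda>r. b r / (16 * real n)" "\<lambda>i. (x i - y i) + g i" w])
      fix i assume i: "i \<in> I"
      have "(\<Sum>r<n. b r / (16 * real n) * G i r) = d i / (16 * real n)"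
        by (simp add: d_def sum_divide_distrib mult.commute)
      moreover have "g i + w i = h i" using i fin W by (auto simp: g_def w_def)
      ultimately show "x i = (\<Sum>r<n. b r / (16 * real n) * G i r) + (x i - y i + g i) + w i"
        by (simp add: h_def)
    next
      have "1 \<le> q" using q by simp
      from lq_norm_triangle[OF this, of I "\<lambda>i. x i - y i" g] u0 g_le
      show "lq_norm I q (\<lambda>i. x i - y i + g i)
        \<le> s powr (- (1 / 2 - 1 / q)) + q powr (1 / 2) * (8 * card I) powr (1 / q) * real n powr (- 1 / 2)"
        by linarith
    qed (rule w2)
  qed
qed

text \<open>The remainder is rescaled to the unit ball and fed into the same step. All steps share
  \<open>G\<close>, so the coefficients \<open>c\<close> simply add up, and the l_q errors form a
  geometric series.\<close>

lemma iterate_approximation: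
  fixes G :: "'a \<Rightarrow> nat \<Rightarrow> real" and q \<rho> :: real
  assumes I: "finite I" and q: "2 \<le> q" and \<rho>: "0 < \<rho>"
    and step: "\<And>x. (\<Sum>i\<in>I. (x i)\<^sup>2) \<le> 1 \<Longrightarrow> \<exists>c u w. (\<forall>i\<in>I. x i = (\<Sum>r<n. c r * G i r) + u i + w i)
        \<and> lq_norm I q u \<le> \<rho> \<and> (\<Sum>i\<in>I. (w i)\<^sup>2) \<le> 127 / 128"
    and x: "(\<Sum>i\<in>I. (x i)\<^sup>2) \<le> 1"
  shows "\<exists>c. lq_norm I q (\<lambda>i. x i - (\<Sum>r<n. c r * G i r)) \<le> 257 * \<rho>"
proof -
  \<comment> \<open>The square of 255/256 is just above 127/128 = 1 - 2/256. The series then sums to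
    at most 256, and the last remainder contributes one more \<open>\<rho>\<close>: hence
    257.\<close>
  define \<kappa> :: real where "\<kappa> = 255 / 256"
  have k: "0 < \<kappa>" "\<kappa> < 1" "127 / 128 \<le> \<kappa>\<^sup>2" by (auto simp: \<kappa>_def power2_eq_square)
  have q1: "1 \<le> q" using q by simp
  have "\<exists>c w. lq_norm I q (\<lambda>i. x i - (\<Sum>r<n. c r * G i r) - w i) \<le> \<rho> * (\<Sum>l<j. \<kappa> ^ l)
      \<and> (\<Sum>i\<in>I. (w i)\<^sup>2) \<le> (\<kappa> ^ j)\<^sup>2" for j
  proof (induction j)
    case 0
    have "lq_norm I q (\<lambda>i. x i - (\<Sum>r<n. 0 * G i r) - x i) = 0" by (simp add: lq_norm_def)
    then show ?case using x by (intro exI[of _ "\<lambda>_. 0"] exI[of _ x]) simp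
  next
    case (Suc j)
    then obtain c w where c: "lq_norm I q (\<lambda>i. x i - (\<Sum>r<n. c r * G i r) - w i) \<le> \<rho> * (\<Sum>l<j. \<kappa> ^ l)"
      and w: "(\<Sum>i\<in>I. (w i)\<^sup>2) \<le> (\<kappa> ^ j)\<^sup>2" by blast
    define K where "K = \<kappa> ^ j"
    have K: "0 < K" using k by (simp add: K_def)
    have "(\<Sum>i\<in>I. (w i / K)\<^sup>2) \<le> 1"
      using w K by (simp add: K_def[symmetric] power_divide flip: sum_divide_distrib)
    from step[OF this] obtain c' u' w' where *: "\<forall>i\<in>I. w i / K = (\<Sum>r<n. c' r * G i r) + u' i + w' i"
      "lq_norm I q u' \<le> \<rho>" "(\<Sum>i\<in>I. (w' i)\<^sup>2) \<le> 127 / 128" by blast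
    define c'' where "c'' r = c r + K * c' r" for r
    define w'' where "w'' i = K * w' i" for i
    have "lq_norm I q (\<lambda>i. x i - (\<Sum>r<n. c'' r * G i r) - w'' i)
        = lq_norm I q (\<lambda>i. (x i - (\<Sum>r<n. c r * G i r) - w i) + K * u' i)"
    proof (rule lq_norm_cong)
      fix i assume "i \<in> I"
      then have "w i = K * ((\<Sum>r<n. c' r * G i r) + u' i + w' i)"
        using *(1) K by (metis less_irrefl nonzero_mult_div_cancel_left times_divide_eq_right)
      moreover have "(\<Sum>r<n. c'' r * G i r) = (\<Sum>r<n. c r * G i r) + K * (\<Sum>r<n. c' r * G i r)"
        by (simp add: c''_def algebra_simps sum.distrib sum_distrib_left)
      ultimately show "x i - (\<Sum>r<n. c'' r * G i r) - w'' i = (x i - (\<Sum>r<n. c r * G i r) - w i) + K * u' i"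
        by (simp add: w''_def algebra_simps)
    qed
    also have "\<dots> \<le> lq_norm I q (\<lambda>i. x i - (\<Sum>r<n. c r * G i r) - w i) + lq_norm I q (\<lambda>i. K * u' i)"
      by (rule lq_norm_triangle[OF q1])
    also have "lq_norm I q (\<lambda>i. K * u' i) = K * lq_norm I q u'"
      using q K by (subst lq_norm_scale) auto
    also have "\<dots> \<le> K * \<rho>" using * K by (intro mult_left_mono) auto
    finally have 1: "lq_norm I q (\<lambda>i. x i - (\<Sum>r<n. c'' r * G i r) - w'' i) \<le> \<rho> * (\<Sum>l<Suc j. \<kappa> ^ l)"
      using c by (simp add: K_def algebra_simps)
    have "(\<Sum>i\<in>I. (w'' i)\<^sup>2) = K\<^sup>2 * (\<Sum>i\<in>I. (w' i)\<^sup>2)"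
      by (simp add: w''_def power_mult_distrib sum_distrib_left)
    also have "\<dots> \<le> K\<^sup>2 * \<kappa>\<^sup>2" using * k by (intro mult_left_mono) auto
    also have "\<dots> = (\<kappa> ^ Suc j)\<^sup>2" by (simp add: K_def power_mult_distrib mult.commute)
    finally show ?case using 1 by blast
  qed
  \<comment> \<open>Finitely many rounds suffice: once the remainder is below \<open>\<rho>\<close>
    in Euclidean norm, it is so in l_q as well.\<close>
  moreover obtain j where j: "\<kappa> ^ j < \<rho>" using real_arch_pow_inv[OF \<rho> k(2)] by blast
  ultimately obtain c w where c: "lq_norm I q (\<lambda>i. x i - (\<Sum>r<n. c r * G i r) - w i) \<le> \<rho> * (\<Sum>l<j. \<kappa> ^ l)"
    and w: "(\<Sum>i\<in>I. (w i)\<^sup>2) \<le> (\<kappa> ^ j)\<^sup>2" by blast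
  have "(\<Sum>l<j. \<kappa> ^ l) = (1 - \<kappa> ^ j) / (1 - \<kappa>)" using k by (subst sum_gp_strict) auto
  also have "\<dots> \<le> 256" using k by (simp add: \<kappa>_def)
  finally have "\<rho> * (\<Sum>l<j. \<kappa> ^ l) \<le> \<rho> * 256" using \<rho> by (intro mult_left_mono) auto
  moreover have "lq_norm I q w \<le> \<kappa> ^ j" using w k by (intro lq_norm_le_euclidean q I) auto
  moreover have "lq_norm I q (\<lambda>i. x i - (\<Sum>r<n. c r * G i r))
      \<le> lq_norm I q (\<lambda>i. x i - (\<Sum>r<n. c r * G i r) - w i) + lq_norm I q w"
    using lq_norm_triangle[OF q1, of I "\<lambda>i. x i - (\<Sum>r<n. c r * G i r) - w i" w] by simp
  ultimately show ?thesis using c j by (intro exI[of _ c]) linarith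
qed

text \<open>The grid parameter \<open>t\<close> meets two opposing demands: few enough grid points
  for the union bound, and a mesh fine enough that the rounding error
  \<open>s powr (- (1 / 2 - 1 / q))\<close> has the target order. Both hold with a constant
  depending on \<open>q\<close> only.\<close>

theorem euclidean_ball_approximation:
  fixes q :: real
  assumes q: "2 \<le> q"
  obtains C where "0 < C" "\<And>(I :: 'a set) n. finite I \<Longrightarrow> 1 \<le> n \<Longrightarrow> n \<le> card I \<Longrightarrow>
    \<exists>G :: 'a \<Rightarrow> nat \<Rightarrow> real. \<forall>x. (\<Sum>i\<in>I. (x i)\<^sup>2) \<le> 1 \<longrightarrow>
      (\<exists>c. lq_norm I q (\<lambda>i. x i - (\<Sum>r<n. c r * G i r)) \<le> C * (real n powr (- 1 / 2) * real (card I) powr (1 / q)))"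
proof -
  \<comment> \<open>Chosen so that \<open>c * (512 + q) = 1 / 128\<close>, which gives
    \<open>t * ln (512 * R) \<le> n / 128\<close> below.\<close>
  define c where "c = 1 / (128 * (512 + q))"
  have c: "0 < c" "c \<le> 1" using q by (auto simp: c_def field_simps)
  define C1 where "C1 = 4 / c + q powr (1 / 2) * 8 powr (1 / q)"
  have C1: "0 < C1" using c by (auto simp: C1_def intro!: add_pos_nonneg)
  define C where "C = max 12 (257 * C1)"
  have q0: "0 < q" "1 \<le> q" using q by auto
  show ?thesis
  proof (rule that[of C])
    show "0 < C" by (simp add: C_def)
    fix I :: "'a set" and n :: nat
    assume I: "finite I" and n: "1 \<le> n" "n \<le> card I"
    define N where "N = real (card I)"
    define R where "R = N / real n"
    have N1: "1 \<le> N" using n by (simp add: N_def)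
    have n0: "0 < real n" using n by simp
    have R: "1 \<le> R" using n by (simp add: R_def N_def)
    define A where "A = real n powr (- 1 / 2) * N powr (1 / q)"
    have A0: "0 < A" using n0 N1 by (simp add: A_def)
    show "\<exists>G :: 'a \<Rightarrow> nat \<Rightarrow> real. \<forall>x. (\<Sum>i\<in>I. (x i)\<^sup>2) \<le> 1 \<longrightarrow>
      (\<exists>c. lq_norm I q (\<lambda>i. x i - (\<Sum>r<n. c r * G i r)) \<le> C * (real n powr (- 1 / 2) * real (card I) powr (1 / q)))"
    proof (cases "n < 128")
      \<comment> \<open>Below 128 rows the zero matrix is enough: the l_q norm is at most 1, and
        \<open>sqrt n \<le> 12\<close>.\<close>
      case True
      have "lq_norm I q x \<le> C * A" if "(\<Sum>i\<in>I. (x i)\<^sup>2) \<le> 1" for x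
      proof -
        have "lq_norm I q x \<le> 1" using that by (intro lq_norm_le_euclidean q I) auto
        also have "1 \<le> 12 * (1 / sqrt (real n))"
        proof -
          have "sqrt (real n) \<le> sqrt (12\<^sup>2)" using True by (intro real_sqrt_le_mono) simp
          then show ?thesis using n0 by (simp add: field_simps)
        qed
        also have "1 / sqrt (real n) = real n powr (- 1 / 2) * 1"
          using n0 by (simp add: powr_half_sqrt[symmetric] powr_minus field_simps)
        also have "12 * (real n powr (- 1 / 2) * 1) \<le> C * A"
          unfolding A_def using N1 q0 by (intro mult_mono ge_one_powr_ge_zero) (auto simp: C_def)
        finally show ?thesis .
      qed
      then show ?thesis unfolding A_def N_def
        by (intro exI[of _ "\<lambda>_ _. 0"]) simp
    next
      case False
      \<comment> \<open>The power of \<open>R\<close> removes the logarithm: \<open>ln R\<close> is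
        at most a multiple of \<open>R powr (2 / q)\<close>.\<close>
      define t where "t = c * real n * R powr (- 2 / q)"
      define s where "s = t / 4"
      have t: "0 < t" using c n0 R by (simp add: t_def)
      have s: "0 < s" "4 * s = t" using t by (auto simp: s_def)
      define Z where "Z = {x \<in> integer_grid I t. 0 < (\<Sum>i\<in>I. (x i)\<^sup>2)}"
      have finZ: "finite Z" using finite_integer_grid[OF I] by (simp add: Z_def)
      have cardZ: "real (card Z) \<le> exp (real n / 64)"
      proof -
        \<comment> \<open>This weight makes \<open>4 * z * card I = n / 128\<close>, half of the
          budget \<open>n / 64\<close> for the logarithm of the cardinality; the other half covers
          \<open>z powr t\<close>.\<close>
        define z where "z = 1 / (512 * R)"
        have z: "0 < z" "z \<le> 1 / 2" using R by (auto simp: z_def field_simps)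
        have "t * ln (512 * R) \<le> real n / 128"
        proof -
          define Y where "Y = R powr (2 / q)"
          have Y: "1 \<le> Y" using R q0 by (simp add: Y_def ge_one_powr_ge_zero)
          have "2 / q * ln R = ln Y" using R by (simp add: Y_def ln_powr)
          also have "\<dots> \<le> Y" using Y ln_le_minus_one[of Y] by simp
          finally have 1: "ln R \<le> q / 2 * Y" using q0 by (simp add: field_simps)
          have "ln (512 * R) = ln 512 + ln R" using R by (simp add: ln_mult)
          also have "\<dots> \<le> 512 * Y + q / 2 * Y"
            using 1 Y ln_le_minus_one[of 512] by (intro add_mono) auto
          also have "\<dots> \<le> (512 + q) * Y" using q0 Y by (simp add: algebra_simps)
          finally have "t * ln (512 * R) \<le> t * ((512 + q) * Y)" using t by (intro mult_left_mono) auto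
          also have "\<dots> = c * (512 + q) * real n * (R powr (- 2 / q) * Y)" by (simp add: t_def mult_ac)
          also have "R powr (- 2 / q) * Y = 1" using R unfolding Y_def by (simp flip: powr_add)
          also have "c * (512 + q) * real n * 1 = real n / 128"
          proof -
            have "c * (512 + q) = 1 / 128" using q0 unfolding c_def by (simp add: divide_simps)
            then show ?thesis by (simp only: mult_1_right)
          qed
          finally show ?thesis .
        qed
        then have "exp (- (real n / 128)) \<le> exp (- (t * ln (512 * R)))" by simp
        also have "\<dots> = z powr t" using z R by (simp add: powr_def z_def ln_div)
        finally have zt: "exp (- (real n / 128)) \<le> z powr t" .
        have "real (card Z) \<le> real (card (integer_grid I t))"
          unfolding Z_def using finite_integer_grid[OF I] by (intro of_nat_mono card_mono) auto
        then have "real (card Z) * exp (- (real n / 128)) \<le> real (card (integer_grid I t)) * z powr t"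
          using zt by (intro mult_mono) auto
        also have "\<dots> \<le> exp (4 * z * card I)" by (rule card_integer_grid[OF I z])
        also have "4 * z * card I = real n / 128" using n0 N1 by (simp add: z_def R_def N_def)
        finally have "real (card Z) * exp (- (real n / 128)) * exp (real n / 128) \<le> exp (real n / 128) * exp (real n / 128)"
          by (intro mult_right_mono) auto
        then show ?thesis by (simp add: mult.assoc flip: exp_add)
      qed
      have Ine: "I \<noteq> {}" using n by auto
      obtain G where G: "G \<in> sign_matrices I n"
        "\<And>x. x \<in> Z \<Longrightarrow> (\<Sum>r<n. (row_sum I G x r)\<^sup>2) \<le> 4 * real n * (\<Sum>i\<in>I. (x i)\<^sup>2)"
        "\<And>x. x \<in> Z \<Longrightarrow> real n / 4 * (\<Sum>i\<in>I. (x i)\<^sup>2) \<le> (\<Sum>r<n. (row_sum I G x r)\<^sup>2)"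
        "\<And>x. x \<in> Z \<Longrightarrow> off_support_weight I n (real n / (64 * card I)) G x \<le> exp (real n / 16)"
        by (rule exists_good_sign_matrix[OF I Ine _ finZ cardZ]) (use False in \<open>auto simp: Z_def\<close>)
      \<comment> \<open>\<open>Z\<close> leaves out the zero vector, since the probability bounds
        are relative to a positive length; at zero both image bounds are trivial.\<close>
      have zero: "row_sum I G x r = 0" if "x \<in> integer_grid I t" "x \<notin> Z" for x r
      proof -
        have "(\<Sum>i\<in>I. (x i)\<^sup>2) = 0"
          using that sum_nonneg[of I "\<lambda>i. (x i)\<^sup>2"] by (auto simp: Z_def not_less)
        then have "\<forall>i\<in>I. x i = 0" using I by (simp add: sum_nonneg_eq_0_iff)
        then show ?thesis by (simp add: row_sum_def)
      qed
      have zero': "(\<Sum>i\<in>I. (x i)\<^sup>2) = 0" if "x \<in> integer_grid I t" "x \<notin> Z" for x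
        using that sum_nonneg[of I "\<lambda>i. (x i)\<^sup>2"] by (auto simp: Z_def not_less)
      have up: "(\<Sum>r<n. (row_sum I G x r)\<^sup>2) \<le> 4 * real n * (\<Sum>i\<in>I. (x i)\<^sup>2)" if "x \<in> integer_grid I (4 * s)" for x
        using that G(2)[of x] zero[of x] by (cases "x \<in> Z") (auto simp: s sum_nonneg)
      have low: "real n / 4 * (\<Sum>i\<in>I. (x i)\<^sup>2) \<le> (\<Sum>r<n. (row_sum I G x r)\<^sup>2)" if "x \<in> integer_grid I (4 * s)" for x
        using that G(3)[of x] zero'[of x] by (cases "x \<in> Z") (auto simp: s sum_nonneg)
      have off: "off_support_weight I n (real n / (64 * card I)) G x \<le> exp (real n / 16)"
        if "x \<in> integer_grid I (4 * s)" "0 < (\<Sum>i\<in>I. (x i)\<^sup>2)" for x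
        using that G(4)[of x] by (simp add: Z_def s)
      have rho: "s powr (- (1 / 2 - 1 / q)) + q powr (1 / 2) * (8 * card I) powr (1 / q) * real n powr (- 1 / 2) \<le> C1 * A"
      proof -
        define e where "e = 1 / 2 - 1 / q"
        have e: "0 \<le> e" "e \<le> 1" using q by (auto simp: e_def field_simps)
        have "s powr (- e) = (4 / c) powr e * (real n powr (- e) * R powr (2 / q * e))"
        proof -
          have "s = (4 / c) powr (- 1) * (real n * R powr (- 2 / q))"
            using c by (simp add: s_def t_def powr_minus field_simps)
          then have "s powr (- e) = ((4 / c) powr (- 1)) powr (- e) * (real n powr (- e) * (R powr (- 2 / q)) powr (- e))"
            by (simp only: powr_mult)
          then show ?thesis by (simp only: powr_powr) simp
        qed
        \<comment> \<open>The exponent of \<open>R\<close> may be raised to \<open>1 / q\<close>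
          because \<open>1 \<le> R\<close>; the powers of \<open>n\<close> then combine to the
          target order \<open>A\<close>.\<close>
        also have "\<dots> \<le> (4 / c) powr 1 * (real n powr (- e) * R powr (1 / q))"
        proof -
          have "2 / q * e \<le> 1 / q" using q0 by (simp add: e_def field_simps)
          then show ?thesis using c e R
            by (intro mult_mono powr_mono mult_left_mono) auto
        qed
        also have "real n powr (- e) * R powr (1 / q) = A"
        proof -
          have "real n powr (- e) = real n powr (- 1 / 2) * real n powr (1 / q)"
            by (simp add: e_def flip: powr_add)
          then show ?thesis using n0 N1 by (simp add: R_def A_def powr_divide)
        qed
        finally have "s powr (- e) \<le> 4 / c * A" using c by simp
        moreover have "q powr (1 / 2) * (8 * card I) powr (1 / q) * real n powr (- 1 / 2)
            = q powr (1 / 2) * 8 powr (1 / q) * A"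
          by (simp add: powr_mult A_def N_def mult_ac)
        ultimately show ?thesis unfolding C1_def e_def distrib_right by linarith
      qed
      have "\<exists>c. lq_norm I q (\<lambda>i. x i - (\<Sum>r<n. c r * G i r)) \<le> 257 * (C1 * A)" if x: "(\<Sum>i\<in>I. (x i)\<^sup>2) \<le> 1" for x
      proof (rule iterate_approximation[OF I q _ _ x])
        show "0 < C1 * A" using C1 A0 by simp
        fix x :: "'a \<Rightarrow> real" assume x: "(\<Sum>i\<in>I. (x i)\<^sup>2) \<le> 1"
        obtain c u w where "\<And>i. i \<in> I \<Longrightarrow> x i = (\<Sum>r<n. c r * G i r) + u i + w i"
          "lq_norm I q u \<le> s powr (- (1 / 2 - 1 / q)) + q powr (1 / 2) * (8 * card I) powr (1 / q) * real n powr (- 1 / 2)"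
          "(\<Sum>i\<in>I. (w i)\<^sup>2) \<le> 127 / 128"
          by (rule one_step_approximation[OF I s(1) q _ n(2) G(1) up low off x]) (use n in auto)
        then show "\<exists>c u w. (\<forall>i\<in>I. x i = (\<Sum>r<n. c r * G i r) + u i + w i)
            \<and> lq_norm I q u \<le> C1 * A \<and> (\<Sum>i\<in>I. (w i)\<^sup>2) \<le> 127 / 128"
          using rho by (meson order_trans)
      qed
      moreover have "257 * (C1 * A) \<le> C * A" using A0 by (simp add: C_def)
      ultimately show ?thesis unfolding A_def N_def by (meson order_trans)
    qed
  qed
qed

section \<open>Mixed norms and interpolation\<close>

lemma lq_norm_mono:
  assumes "0 < q" "\<And>i. i \<in> I \<Longrightarrow> \<bar>x i\<bar> \<le> \<bar>y i\<bar>"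
  shows "lq_norm I q x \<le> lq_norm I q y"
  unfolding lq_norm_def using assms by (intro powr_mono2 sum_mono sum_nonneg) auto

lemma lq_norm_subset:
  assumes "0 < q" "finite I" "J \<subseteq> I"
  shows "lq_norm J q x \<le> lq_norm I q x"
  unfolding lq_norm_def using assms by (intro powr_mono2 sum_mono2 sum_nonneg) auto

lemma lq_norm_power: "0 < q \<Longrightarrow> lq_norm I q x powr q = (\<Sum>i\<in>I. \<bar>x i\<bar> powr q)"
  by (simp add: lq_norm_def powr_powr sum_nonneg)

lemma lq_norm_eq_0_iff:
  assumes "finite I" "0 < q"
  shows "lq_norm I q x = 0 \<longleftrightarrow> (\<forall>i\<in>I. x i = 0)"
  using assms by (simp add: lq_norm_def sum_nonneg_eq_0_iff)

lemma abs_le_lq_norm: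
  assumes "finite I" "0 < q" "i \<in> I"
  shows "\<bar>x i\<bar> \<le> lq_norm I q x"
proof -
  have "\<bar>x i\<bar> powr q \<le> (\<Sum>i\<in>I. \<bar>x i\<bar> powr q)"
    using assms by (intro member_le_sum) auto
  then have "(\<bar>x i\<bar> powr q) powr (1 / q) \<le> lq_norm I q x"
    unfolding lq_norm_def using assms by (intro powr_mono2) auto
  then show ?thesis using assms by (simp add: powr_powr)
qed

text \<open>No entry exceeds the l_s norm \<open>M\<close>, so \<open>p - s\<close> of the
  \<open>p\<close> powers are spent on \<open>M\<close>.\<close>

lemma lq_norm_antimono:
  assumes I: "finite I" and s: "0 < s" "s \<le> p"
  shows "lq_norm I p x \<le> lq_norm I s x"
proof (cases "lq_norm I s x = 0")
  case True
  then show ?thesis using I s by (simp add: lq_norm_eq_0_iff) (simp add: lq_norm_def)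
next
  case False
  define M where "M = lq_norm I s x"
  have M: "0 < M" using False lq_norm_nonneg[of I s x] unfolding M_def by linarith
  have "(\<Sum>i\<in>I. \<bar>x i\<bar> powr p) \<le> (\<Sum>i\<in>I. M powr (p - s) * \<bar>x i\<bar> powr s)"
  proof (intro sum_mono)
    fix i assume i: "i \<in> I"
    have "\<bar>x i\<bar> powr p = \<bar>x i\<bar> powr ((p - s) + s)" by simp
    also have "\<dots> = \<bar>x i\<bar> powr (p - s) * \<bar>x i\<bar> powr s" by (rule powr_add)
    also have "\<dots> \<le> M powr (p - s) * \<bar>x i\<bar> powr s"
      using abs_le_lq_norm[OF I s(1) i, of x] s by (intro mult_right_mono powr_mono2) (auto simp: M_def)
    finally show "\<bar>x i\<bar> powr p \<le> M powr (p - s) * \<bar>x i\<bar> powr s" .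
  qed
  also have "\<dots> = M powr (p - s) * M powr s"
    unfolding M_def lq_norm_power[OF s(1)] by (simp add: sum_distrib_left)
  also have "\<dots> = M powr p" by (simp flip: powr_add)
  finally show ?thesis using M s by (simp add: lq_norm_le_iff M_def[symmetric])
qed

text \<open>Every entry is compared with the p-mean \<open>\<mu>\<close>: Young's inequality bounds
  \<open>z powr s\<close> by its tangent in \<open>z powr p\<close> at 1, and the tangents sum to
  the claim.\<close>

lemma lq_norm_power_mean:
  assumes I: "finite I" "I \<noteq> {}" and s: "0 < s" "s \<le> p"
  shows "lq_norm I s x \<le> real (card I) powr (1 / s - 1 / p) * lq_norm I p x"
proof (cases "lq_norm I p x = 0")
  case True
  then show ?thesis using I s by (simp add: lq_norm_eq_0_iff) (simp add: lq_norm_def)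
next
  case False
  define N where "N = real (card I)"
  define M where "M = lq_norm I p x"
  have N: "0 < N" using I by (simp add: N_def card_gt_0_iff)
  have M: "0 < M" using False lq_norm_nonneg[of I p x] unfolding M_def by linarith
  define \<mu> where "\<mu> = N powr (- 1 / p) * M"
  have \<mu>: "0 < \<mu>" using N M by (simp add: \<mu>_def)
  have p: "0 < p" using s by simp
  have "(\<Sum>i\<in>I. \<bar>x i\<bar> powr s) \<le> (\<Sum>i\<in>I. \<mu> powr s * (s / p * (\<bar>x i\<bar> powr p / \<mu> powr p) + (1 - s / p)))"
  proof (intro sum_mono)
    fix i
    show "\<bar>x i\<bar> powr s \<le> \<mu> powr s * (s / p * (\<bar>x i\<bar> powr p / \<mu> powr p) + (1 - s / p))"
    proof (cases "x i = 0")
      case False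
      define z where "z = \<bar>x i\<bar> / \<mu>"
      have z: "0 < z" using False \<mu> by (simp add: z_def)
      have "(z powr p) powr (s / p) * 1 powr (1 - s / p) \<le> s / p * z powr p + (1 - s / p) * 1"
        using s z by (intro Youngs_inequality_0) auto
      then have "z powr s \<le> s / p * z powr p + (1 - s / p)" using p by (simp add: powr_powr)
      then have "\<mu> powr s * z powr s \<le> \<mu> powr s * (s / p * z powr p + (1 - s / p))"
        by (intro mult_left_mono) auto
      moreover have "\<mu> powr s * z powr s = \<bar>x i\<bar> powr s"
        using \<mu> by (simp add: z_def powr_divide)
      moreover have "z powr p = \<bar>x i\<bar> powr p / \<mu> powr p" by (simp add: z_def powr_divide)
      ultimately show ?thesis by simp
    qed (use s in auto)
  qed
  also have "\<dots> = \<mu> powr s * (s / p * (M powr p / \<mu> powr p) + N * (1 - s / p))"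
    unfolding M_def lq_norm_power[OF p] N_def
    by (simp add: sum.distrib sum_distrib_left[symmetric] sum_divide_distrib[symmetric])
  also have "M powr p / \<mu> powr p = N"
  proof -
    have "\<mu> powr p = N powr (- 1 / p * p) * M powr p" by (simp only: \<mu>_def powr_mult powr_powr)
    then show ?thesis using M N p by (simp add: powr_minus divide_inverse)
  qed
  also have "\<mu> powr s * (s / p * N + N * (1 - s / p)) = (N powr (1 / s) * \<mu>) powr s"
    using N s by (simp add: powr_mult powr_powr algebra_simps)
  finally have "lq_norm I s x \<le> N powr (1 / s) * \<mu>" using s \<mu> by (simp add: lq_norm_le_iff)
  also have "\<dots> = N powr (1 / s - 1 / p) * M"
    by (simp add: \<mu>_def powr_diff powr_minus divide_inverse)
  finally show ?thesis by (simp add: N_def M_def)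
qed

lemma lq_norm_compare:
  assumes I: "finite I" "I \<noteq> {}" and s: "0 < s" "0 < p"
  shows "lq_norm I s x \<le> real (card I) powr max 0 (1 / s - 1 / p) * lq_norm I p x"
proof (cases "s \<le> p")
  case True
  then have "max 0 (1 / s - 1 / p) = 1 / s - 1 / p" using s by (simp add: frac_le)
  then show ?thesis using lq_norm_power_mean[OF I s(1) True, of x] by simp
next
  case False
  then have "1 / s - 1 / p \<le> 0" using s by (simp add: frac_le)
  moreover have "0 < card I" using I by (simp add: card_gt_0_iff)
  ultimately show ?thesis using lq_norm_antimono[OF I(1) s(2), of s x] False by (simp add: max_def)
qed

section \<open>Mixed norms on a product of index sets\<close>

definition mixed_norm :: "'a set \<Rightarrow> 'b set \<Rightarrow> real \<Rightarrow> real \<Rightarrow> ('a \<times> 'b \<Rightarrow> real) \<Rightarrow> real" where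
  "mixed_norm A B p q x = lq_norm B q (\<lambda>j. lq_norm A p (\<lambda>i. x (i, j)))"

lemma mixed_norm_nonneg [simp]: "0 \<le> mixed_norm A B p q x"
  by (simp add: mixed_norm_def)

lemma mixed_norm_cong:
  "(\<And>i j. i \<in> A \<Longrightarrow> j \<in> B \<Longrightarrow> x (i, j) = y (i, j)) \<Longrightarrow> mixed_norm A B p q x = mixed_norm A B p q y"
  unfolding mixed_norm_def by (intro lq_norm_cong) auto

lemma mixed_norm_scale:
  "0 < p \<Longrightarrow> 0 < q \<Longrightarrow> mixed_norm A B p q (\<lambda>t. c * x t) = \<bar>c\<bar> * mixed_norm A B p q x"
  unfolding mixed_norm_def by (simp add: lq_norm_scale)

lemma mixed_norm_mono:
  assumes "0 < p" "0 < q" "\<And>i j. i \<in> A \<Longrightarrow> j \<in> B \<Longrightarrow> \<bar>x (i, j)\<bar> \<le> \<bar>y (i, j)\<bar>"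
  shows "mixed_norm A B p q x \<le> mixed_norm A B p q y"
  unfolding mixed_norm_def using assms by (intro lq_norm_mono) (auto intro: lq_norm_mono)

lemma mixed_norm_subset:
  assumes "0 < p" "0 < q" "finite A" "finite B" "A' \<subseteq> A" "B' \<subseteq> B"
  shows "mixed_norm A' B' p q x \<le> mixed_norm A B p q x"
proof -
  have "mixed_norm A' B' p q x \<le> mixed_norm A B' p q x"
    unfolding mixed_norm_def using assms by (intro lq_norm_mono) (auto intro: lq_norm_subset)
  also have "\<dots> \<le> mixed_norm A B p q x"
    unfolding mixed_norm_def using assms by (intro lq_norm_subset)
  finally show ?thesis .
qed

lemma mixed_norm_triangle:
  assumes "1 \<le> p" "1 \<le> q"
  shows "mixed_norm A B p q (\<lambda>t. x t + y t) \<le> mixed_norm A B p q x + mixed_norm A B p q y"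
proof -
  have "mixed_norm A B p q (\<lambda>t. x t + y t)
      \<le> lq_norm B q (\<lambda>j. lq_norm A p (\<lambda>i. x (i, j)) + lq_norm A p (\<lambda>i. y (i, j)))"
    unfolding mixed_norm_def using assms
    by (intro lq_norm_mono) (auto intro!: lq_norm_triangle simp: abs_of_nonneg add_nonneg_nonneg)
  also have "\<dots> \<le> mixed_norm A B p q x + mixed_norm A B p q y"
    unfolding mixed_norm_def by (rule lq_norm_triangle[OF assms(2)])
  finally show ?thesis .
qed

text \<open>Serves both directions of the theorem: as inclusion between balls for the upper bounds,
  and with exponents 1 or 2 on the left as Hoelder's inequality for the lower ones.\<close>

lemma mixed_norm_compare:
  assumes "finite A" "A \<noteq> {}" "finite B" "B \<noteq> {}" "0 < s" "0 < p" "0 < t" "0 < q"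
  shows "mixed_norm A B s t x
    \<le> real (card A) powr max 0 (1 / s - 1 / p) * real (card B) powr max 0 (1 / t - 1 / q) * mixed_norm A B p q x"
proof -
  let ?a = "real (card A) powr max 0 (1 / s - 1 / p)"
  have "mixed_norm A B s t x \<le> lq_norm B t (\<lambda>j. ?a * lq_norm A p (\<lambda>i. x (i, j)))"
    unfolding mixed_norm_def using assms
    by (intro lq_norm_mono) (auto intro!: lq_norm_compare simp: abs_mult)
  also have "\<dots> = ?a * lq_norm B t (\<lambda>j. lq_norm A p (\<lambda>i. x (i, j)))"
    using assms by (subst lq_norm_scale) auto
  also have "\<dots> \<le> ?a * (real (card B) powr max 0 (1 / t - 1 / q) * mixed_norm A B p q x)"
    unfolding mixed_norm_def using assms by (intro mult_left_mono lq_norm_compare) auto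
  finally show ?thesis by (simp add: mult.assoc)
qed

lemma mixed_norm_diagonal:
  assumes "0 < q"
  shows "mixed_norm A B q q x = lq_norm (A \<times> B) q x"
proof -
  have "mixed_norm A B q q x = (\<Sum>j\<in>B. \<Sum>i\<in>A. \<bar>x (i, j)\<bar> powr q) powr (1 / q)"
    unfolding mixed_norm_def lq_norm_def[of B] using assms by (simp add: lq_norm_power)
  also have "(\<Sum>j\<in>B. \<Sum>i\<in>A. \<bar>x (i, j)\<bar> powr q) = (\<Sum>t\<in>A \<times> B. \<bar>x t\<bar> powr q)"
    by (subst sum.swap) (simp add: sum.cartesian_product)
  finally show ?thesis by (simp add: lq_norm_def)
qed

lemma lq_norm_2_square: "(lq_norm I 2 x)\<^sup>2 = (\<Sum>i\<in>I. (x i)\<^sup>2)"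
proof -
  have "(lq_norm I 2 x)\<^sup>2 = lq_norm I 2 x powr 2"
    by (cases "lq_norm I 2 x = 0") (auto simp: powr_numeral less_le)
  also have "\<dots> = (\<Sum>i\<in>I. \<bar>x i\<bar> powr 2)" by (rule lq_norm_power) simp
  also have "\<dots> = (\<Sum>i\<in>I. (x i)\<^sup>2)"
  proof (intro sum.cong refl)
    show "\<bar>x i\<bar> powr 2 = (x i)\<^sup>2" for i by (cases "x i = 0") (auto simp: powr_numeral)
  qed
  finally show ?thesis .
qed

text \<open>An entry is its share of the column norm \<open>c j\<close>, times \<open>c j\<close>.
  The two factors are raised separately to the powers that fit the new exponents, so each column of
  shares keeps l_p norm at most 1. If \<open>c j = 0\<close>, division by zero gives 0 and the
  column contributes nothing.\<close>

lemma calderon_factor: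
  fixes x :: "'a \<times> 'b \<Rightarrow> real"
  assumes "finite A" "finite B" "0 < p" "0 < q" "0 < p'" "0 < q'" and x: "mixed_norm A B p' q' x \<le> 1"
  defines "c j \<equiv> lq_norm A p' (\<lambda>i. x (i, j))"
  shows "mixed_norm A B p q (\<lambda>(i, j). (\<bar>x (i, j)\<bar> / c j) powr (p' / p) * c j powr (q' / q)) \<le> 1"
proof -
  have c0: "0 \<le> c j" for j by (simp add: c_def)
  have inner: "lq_norm A p (\<lambda>i. (\<bar>x (i, j)\<bar> / c j) powr (p' / p) * c j powr (q' / q)) \<le> c j powr (q' / q)" for j
  proof -
    have "(\<Sum>i\<in>A. (\<bar>x (i, j)\<bar> / c j) powr p') \<le> 1"
    proof (cases "c j = 0")
      case False
      have "(\<Sum>i\<in>A. (\<bar>x (i, j)\<bar> / c j) powr p') = (\<Sum>i\<in>A. \<bar>x (i, j)\<bar> powr p') / c j powr p'"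
        by (simp add: powr_divide sum_divide_distrib)
      also have "(\<Sum>i\<in>A. \<bar>x (i, j)\<bar> powr p') = c j powr p'"
        unfolding c_def using assms(5) by (simp add: lq_norm_power)
      finally show ?thesis using False by simp
    qed simp
    then have "c j powr (q' / q * p) * (\<Sum>i\<in>A. (\<bar>x (i, j)\<bar> / c j) powr p') \<le> c j powr (q' / q * p) * 1"
      by (intro mult_left_mono) auto
    then show ?thesis using assms c0
      by (simp add: lq_norm_le_iff abs_mult powr_mult powr_powr sum_distrib_left mult.commute)
  qed
  have "mixed_norm A B p q (\<lambda>(i, j). (\<bar>x (i, j)\<bar> / c j) powr (p' / p) * c j powr (q' / q))
      \<le> lq_norm B q (\<lambda>j. c j powr (q' / q))"
    unfolding mixed_norm_def using assms inner by (intro lq_norm_mono) auto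
  also have "\<dots> \<le> 1"
  proof -
    have "(\<Sum>j\<in>B. \<bar>c j\<bar> powr q') \<le> 1 powr q'"
      using x assms unfolding mixed_norm_def c_def[symmetric] by (subst (asm) lq_norm_le_iff) auto
    then show ?thesis using assms c0 by (subst lq_norm_le_iff) (auto simp: powr_powr)
  qed
  finally show ?thesis .
qed

text \<open>The mixed norm with the interpolated exponents is a Calderon product: \<open>\<bar>x\<bar>\<close> is the
  geometric mean of a point of each end ball, so entrywise it is dominated by the larger of the two
  after rescaling by \<open>\<tau>\<close>.\<close>

lemma interpolation_splitting:
  fixes x :: "'a \<times> 'b \<Rightarrow> real"
  assumes fin: "finite A" "finite B" and p: "0 < p0" "0 < q0" "0 < p1" "0 < q1" "0 < p" "0 < q"
    and \<theta>: "0 \<le> \<theta>" "\<theta> \<le> 1"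
    and pp: "1 / p = (1 - \<theta>) / p0 + \<theta> / p1" and qq: "1 / q = (1 - \<theta>) / q0 + \<theta> / q1"
    and x: "mixed_norm A B p q x \<le> 1" and \<tau>: "0 < \<tau>"
  obtains y z where "\<And>t. x t = y t + z t" "mixed_norm A B p0 q0 y \<le> \<tau> powr \<theta>"
    "mixed_norm A B p1 q1 z \<le> \<tau> powr (\<theta> - 1)"
proof -
  define c where "c j = lq_norm A p (\<lambda>i. x (i, j))" for j
  define u where "u = (\<lambda>(i, j). (\<bar>x (i, j)\<bar> / c j) powr (p / p0) * c j powr (q / q0))"
  define v where "v = (\<lambda>(i, j). (\<bar>x (i, j)\<bar> / c j) powr (p / p1) * c j powr (q / q1))"
  have u: "mixed_norm A B p0 q0 u \<le> 1" unfolding u_def c_def using assms by (intro calderon_factor)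
  have v: "mixed_norm A B p1 q1 v \<le> 1" unfolding v_def c_def using assms by (intro calderon_factor)
  \<comment> \<open>Each entry goes as a whole to the side whose bound is larger, so the splitting
    costs no constant.\<close>
  define b where "b t \<longleftrightarrow> \<tau> powr (\<theta> - 1) * v t \<le> \<tau> powr \<theta> * u t" for t
  define y where "y t = (if b t then x t else 0)" for t
  define z where "z t = (if b t then 0 else x t)" for t
  have bound: "\<bar>x (i, j)\<bar> \<le> max (\<tau> powr \<theta> * u (i, j)) (\<tau> powr (\<theta> - 1) * v (i, j))"
    if ij: "i \<in> A" "j \<in> B" for i j
  proof (cases "x (i, j) = 0")
    case True
    then show ?thesis by (simp add: u_def v_def)
  next
    case False
    have "\<bar>x (i, j)\<bar> \<le> c j" unfolding c_def by (rule abs_le_lq_norm[OF fin(1) p(5) ij(1)])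
    then have c: "0 < c j" using False by linarith
    define r where "r = \<bar>x (i, j)\<bar> / c j"
    have r: "0 < r" using False c by (simp add: r_def)
    have u0: "0 < u (i, j)" "u (i, j) = r powr (p / p0) * c j powr (q / q0)"
      using r c by (auto simp: u_def r_def[symmetric])
    have v0: "0 < v (i, j)" "v (i, j) = r powr (p / p1) * c j powr (q / q1)"
      using r c by (auto simp: v_def r_def[symmetric])
    have "p * (1 / p) = p * ((1 - \<theta>) / p0 + \<theta> / p1)" "q * (1 / q) = q * ((1 - \<theta>) / q0 + \<theta> / q1)"
      using pp qq by auto
    then have e: "p / p0 * (1 - \<theta>) + p / p1 * \<theta> = 1" "q / q0 * (1 - \<theta>) + q / q1 * \<theta> = 1"
      using p by (auto simp: field_simps)
    \<comment> \<open>The powers of \<open>\<tau>\<close> cancel in the weighted geometric mean,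
      which is therefore \<open>\<bar>x\<bar>\<close>; Young's inequality passes to the
      maximum.\<close>
    have "(\<tau> powr \<theta> * u (i, j)) powr (1 - \<theta>) * (\<tau> powr (\<theta> - 1) * v (i, j)) powr \<theta>
        = \<tau> powr (\<theta> * (1 - \<theta>) + (\<theta> - 1) * \<theta>) * (r powr (p / p0 * (1 - \<theta>) + p / p1 * \<theta>)
          * c j powr (q / q0 * (1 - \<theta>) + q / q1 * \<theta>))"
      unfolding u0(2) v0(2) powr_add powr_mult powr_powr by (simp add: mult_ac)
    also have "\<theta> * (1 - \<theta>) + (\<theta> - 1) * \<theta> = 0" by (simp add: algebra_simps)
    also have "\<tau> powr 0 * (r powr (p / p0 * (1 - \<theta>) + p / p1 * \<theta>)
          * c j powr (q / q0 * (1 - \<theta>) + q / q1 * \<theta>)) = \<bar>x (i, j)\<bar>"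
      unfolding e using \<tau> c r by (simp add: r_def)
    finally have "\<bar>x (i, j)\<bar> = (\<tau> powr \<theta> * u (i, j)) powr (1 - \<theta>) * (\<tau> powr (\<theta> - 1) * v (i, j)) powr \<theta>" ..
    also have "\<dots> \<le> (1 - \<theta>) * (\<tau> powr \<theta> * u (i, j)) + \<theta> * (\<tau> powr (\<theta> - 1) * v (i, j))"
      using u0 v0 \<tau> \<theta> by (intro Youngs_inequality_0) auto
    also have "\<dots> \<le> (1 - \<theta>) * max (\<tau> powr \<theta> * u (i, j)) (\<tau> powr (\<theta> - 1) * v (i, j))
        + \<theta> * max (\<tau> powr \<theta> * u (i, j)) (\<tau> powr (\<theta> - 1) * v (i, j))"
      using \<theta> by (intro add_mono mult_left_mono) auto
    also have "\<dots> = max (\<tau> powr \<theta> * u (i, j)) (\<tau> powr (\<theta> - 1) * v (i, j))"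
      by (simp add: algebra_simps)
    finally show ?thesis .
  qed
  have "0 \<le> u t" "0 \<le> v t" for t by (auto simp: u_def v_def split: prod.split)
  note uv0 = this
  show ?thesis
  proof (rule that[of y z])
    show "x t = y t + z t" for t by (simp add: y_def z_def)
    have "mixed_norm A B p0 q0 y \<le> mixed_norm A B p0 q0 (\<lambda>t. \<tau> powr \<theta> * u t)"
    proof (rule mixed_norm_mono[OF p(1,2)])
      fix i j assume "i \<in> A" "j \<in> B"
      from bound[OF this] show "\<bar>y (i, j)\<bar> \<le> \<bar>\<tau> powr \<theta> * u (i, j)\<bar>"
        using uv0[of "(i, j)"] by (auto simp: y_def b_def max_def)
    qed
    also have "\<dots> \<le> \<tau> powr \<theta> * 1"
      unfolding mixed_norm_scale[OF p(1,2)] using u by (simp add: mult_left_le)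
    finally show "mixed_norm A B p0 q0 y \<le> \<tau> powr \<theta>" by simp
    have "mixed_norm A B p1 q1 z \<le> mixed_norm A B p1 q1 (\<lambda>t. \<tau> powr (\<theta> - 1) * v t)"
    proof (rule mixed_norm_mono[OF p(3,4)])
      fix i j assume "i \<in> A" "j \<in> B"
      from bound[OF this] show "\<bar>z (i, j)\<bar> \<le> \<bar>\<tau> powr (\<theta> - 1) * v (i, j)\<bar>"
        using uv0[of "(i, j)"] by (auto simp: z_def b_def max_def split: if_splits)
    qed
    also have "\<dots> \<le> \<tau> powr (\<theta> - 1) * 1"
      unfolding mixed_norm_scale[OF p(3,4)] using v by (simp add: mult_left_le)
    finally show "mixed_norm A B p1 q1 z \<le> \<tau> powr (\<theta> - 1)" by simp
  qed
qed

section \<open>Upper bounds\<close>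

lemma lookup_scaleR: "Poly_Mapping.lookup (c *\<^sub>R x) t = c *\<^sub>R Poly_Mapping.lookup x t"
  by (simp add: scaleR_poly_mapping_def)

lemma subspace_lmk_space: "subspace (lmk_space m k)"
proof -
  have "lmk_space m k = {x. \<forall>t. t \<notin> {1..m} \<times> {1..k} \<longrightarrow> Poly_Mapping.lookup x t = 0}"
    unfolding lmk_space_def by (auto simp only: subset_iff in_keys_iff)
  then show ?thesis
    unfolding subspace_def by (simp add: lookup_add lookup_scaleR)
qed

lemma lmk_norm_eq_mixed_norm:
  assumes "0 < p" "0 < q"
  shows "lmk_norm m k p q x = mixed_norm {1..m} {1..k} p q (Poly_Mapping.lookup x)"
  unfolding lmk_norm_def mixed_norm_def lq_norm_def by (simp add: powr_powr)

definition array_of :: "nat \<Rightarrow> nat \<Rightarrow> (nat \<times> nat \<Rightarrow> real) \<Rightarrow> nat \<times> nat \<Rightarrow>\<^sub>0 real" where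
  "array_of m k f = Abs_poly_mapping (\<lambda>t. if t \<in> {1..m} \<times> {1..k} then f t else 0)"

lemma lookup_array_of:
  "Poly_Mapping.lookup (array_of m k f) t = (if t \<in> {1..m} \<times> {1..k} then f t else 0)"
proof -
  have "finite {t. (if t \<in> {1..m} \<times> {1..k} then f t else 0) \<noteq> 0}"
    by (rule finite_subset[of _ "{1..m} \<times> {1..k}"]) auto
  then show ?thesis unfolding array_of_def by simp
qed

lemma array_of_in_lmk_space: "array_of m k f \<in> lmk_space m k"
  unfolding lmk_space_def by (auto simp: in_keys_iff lookup_array_of split: if_splits)

lemma kolmogorov_width_le:
  fixes g :: "nat \<Rightarrow> 'a::real_vector"
  assumes X: "subspace X" "\<And>r. r < n \<Longrightarrow> g r \<in> X"
    and approx: "\<And>x. x \<in> M \<Longrightarrow> \<exists>c. N (x - (\<Sum>r<n. c r *\<^sub>R g r)) \<le> D"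
  shows "kolmogorov_width n M X N \<le> ennreal D"
proof -
  define L where "L = span (g ` {..<n})"
  have "dim L \<le> card (g ` {..<n})" unfolding L_def by (simp add: dim_le_card span_superset)
  also have "\<dots> \<le> n" using card_image_le[of "{..<n}" g] by simp
  finally have dim: "dim L \<le> n" .
  have "L \<subseteq> X" unfolding L_def using X by (intro span_minimal) auto
  then have L: "L \<in> {L. subspace L \<and> L \<subseteq> X \<and> (\<exists>B. finite B \<and> L = span B) \<and> dim L \<le> n}"
    using dim by (auto simp: L_def subspace_span)
  have "(SUP x\<in>M. INF y\<in>L. ennreal (N (x - y))) \<le> ennreal D"
  proof (rule SUP_least)
    fix x assume "x \<in> M"
    then obtain c where c: "N (x - (\<Sum>r<n. c r *\<^sub>R g r)) \<le> D" using approx by blast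
    have "(\<Sum>r<n. c r *\<^sub>R g r) \<in> L"
      unfolding L_def by (intro span_sum span_scale span_base) auto
    then have "(INF y\<in>L. ennreal (N (x - y))) \<le> ennreal (N (x - (\<Sum>r<n. c r *\<^sub>R g r)))"
      by (rule INF_lower)
    also have "\<dots> \<le> ennreal D" using c by (rule ennreal_leI)
    finally show "(INF y\<in>L. ennreal (N (x - y))) \<le> ennreal D" .
  qed
  then show ?thesis unfolding kolmogorov_width_def by (rule INF_lower2[OF L])
qed

text \<open>Splitting at \<open>\<tau> = A\<close> balances the two errors: \<open>y\<close> is not
  approximated and costs \<open>A powr \<theta>\<close>, while \<open>z\<close> has Euclidean norm
  at most \<open>A powr (\<theta> - 1)\<close> and is approximated at the relative cost
  \<open>C * A\<close>. \<open>R\<close> is the inclusion constant between the given ball and the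
  interpolated one.\<close>

lemma kolmogorov_width_upper:
  fixes p2 q2 :: real
  assumes p2: "2 \<le> p2" and q2: "2 \<le> q2"
  obtains C where "0 < C" "\<And>m k n p1 q1 \<theta>. 1 \<le> m \<Longrightarrow> 1 \<le> k \<Longrightarrow> 1 \<le> n \<Longrightarrow> n \<le> m * k \<Longrightarrow>
     1 \<le> p1 \<Longrightarrow> 1 \<le> q1 \<Longrightarrow> 0 \<le> \<theta> \<Longrightarrow> \<theta> \<le> 1 \<Longrightarrow>
     kolmogorov_width n (lmk_ball m k p1 q1) (lmk_space m k) (lmk_norm m k p2 q2)
     \<le> ennreal (C * (real m powr max 0 ((1 - \<theta>) / p2 + \<theta> / 2 - 1 / p1)
          * real k powr max 0 ((1 - \<theta>) / q2 + \<theta> / 2 - 1 / q1)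
          * (real n powr (- 1 / 2) * real m powr (1 / p2) * real k powr (1 / q2)) powr \<theta>))"
proof -
  \<comment> \<open>Going from l_Q to the mixed norm costs
    \<open>m powr (1 / p2 - 1 / Q) * k powr (1 / q2 - 1 / Q)\<close>, which
    \<open>(m * k) powr (1 / Q)\<close> completes to exactly the powers in \<open>A\<close>.\<close>
  define Q where "Q = max p2 q2"
  have Q: "2 \<le> Q" "p2 \<le> Q" "q2 \<le> Q" using p2 by (auto simp: Q_def)
  obtain C where C: "0 < C" and approx: "\<And>(I :: (nat \<times> nat) set) n. finite I \<Longrightarrow> 1 \<le> n \<Longrightarrow> n \<le> card I \<Longrightarrow>
    \<exists>G :: nat \<times> nat \<Rightarrow> nat \<Rightarrow> real. \<forall>x. (\<Sum>i\<in>I. (x i)\<^sup>2) \<le> 1 \<longrightarrow>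
      (\<exists>c. lq_norm I Q (\<lambda>i. x i - (\<Sum>r<n. c r * G i r)) \<le> C * (real n powr (- 1 / 2) * real (card I) powr (1 / Q)))"
    by (rule euclidean_ball_approximation[OF Q(1)]) blast
  show ?thesis
  proof (rule that[of "1 + C"])
    fix m k n :: nat and p1 q1 \<theta> :: real
    assume mkn: "1 \<le> m" "1 \<le> k" "1 \<le> n" "n \<le> m * k" and p1: "1 \<le> p1" and q1: "1 \<le> q1"
      and \<theta>: "0 \<le> \<theta>" "\<theta> \<le> 1"
    let ?A = "{1..m}" and ?B = "{1..k}"
    define A where "A = real n powr (- 1 / 2) * real m powr (1 / p2) * real k powr (1 / q2)"
    have A: "0 < A" using mkn by (simp add: A_def)
    \<comment> \<open>Reciprocals of the interpolated exponents.\<close>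
    define a b where "a = (1 - \<theta>) / p2 + \<theta> / 2" and "b = (1 - \<theta>) / q2 + \<theta> / 2"
    have ab: "0 < a" "0 < b"
      unfolding a_def b_def using p2 q2 \<theta> by (cases "\<theta> = 0"; simp add: add_nonneg_pos)+
    define R where "R = real m powr max 0 (a - 1 / p1) * real k powr max 0 (b - 1 / q1)"
    have R: "0 < R" using mkn by (simp add: R_def)
    have fin: "finite ?A" "?A \<noteq> {}" "finite ?B" "?B \<noteq> {}" using mkn by auto
    have cardI: "card (?A \<times> ?B) = m * k" by simp
    obtain G :: "nat \<times> nat \<Rightarrow> nat \<Rightarrow> real" where G: "\<And>x. (\<Sum>i\<in>?A \<times> ?B. (x i)\<^sup>2) \<le> 1 \<Longrightarrow>
      \<exists>c. lq_norm (?A \<times> ?B) Q (\<lambda>i. x i - (\<Sum>r<n. c r * G i r)) \<le> C * (real n powr (- 1 / 2) * real (m * k) powr (1 / Q))"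
      using approx[of "?A \<times> ?B" n] mkn unfolding cardI by auto
    define g where "g r = array_of m k (\<lambda>t. G t r)" for r
    show "kolmogorov_width n (lmk_ball m k p1 q1) (lmk_space m k) (lmk_norm m k p2 q2)
      \<le> ennreal ((1 + C) * (real m powr max 0 ((1 - \<theta>) / p2 + \<theta> / 2 - 1 / p1)
          * real k powr max 0 ((1 - \<theta>) / q2 + \<theta> / 2 - 1 / q1)
          * (real n powr (- 1 / 2) * real m powr (1 / p2) * real k powr (1 / q2)) powr \<theta>))"
      unfolding a_def[symmetric] b_def[symmetric] A_def[symmetric] R_def[symmetric]
    proof (rule kolmogorov_width_le[OF subspace_lmk_space, of n g])
      show "g r \<in> lmk_space m k" for r unfolding g_def by (rule array_of_in_lmk_space)
      fix X assume "X \<in> lmk_ball m k p1 q1"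
      define x where "x t = 1 / R * Poly_Mapping.lookup X t" for t
      have "mixed_norm ?A ?B p1 q1 (Poly_Mapping.lookup X) \<le> 1"
        using \<open>X \<in> _\<close> p1 q1 by (simp add: lmk_ball_def lmk_norm_eq_mixed_norm)
      moreover have "mixed_norm ?A ?B (1 / a) (1 / b) (Poly_Mapping.lookup X)
          \<le> R * mixed_norm ?A ?B p1 q1 (Poly_Mapping.lookup X)"
        using mixed_norm_compare[OF fin, of "1 / a" p1 "1 / b" q1 "Poly_Mapping.lookup X"] ab p1 q1
        by (simp add: R_def)
      ultimately have "mixed_norm ?A ?B (1 / a) (1 / b) (Poly_Mapping.lookup X) \<le> R * 1"
        using R by (meson mult_left_mono less_imp_le order_trans)
      then have x1: "mixed_norm ?A ?B (1 / a) (1 / b) x \<le> 1"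
        unfolding x_def using ab R by (subst mixed_norm_scale) auto
      obtain y z where yz: "\<And>t. x t = y t + z t" "mixed_norm ?A ?B p2 q2 y \<le> A powr \<theta>"
          "mixed_norm ?A ?B 2 2 z \<le> A powr (\<theta> - 1)"
        by (rule interpolation_splitting[of ?A ?B p2 q2 2 2 "1 / a" "1 / b" \<theta> x A])
          (use p2 q2 ab \<theta> x1 A in \<open>auto simp: a_def b_def\<close>)
      define e where "e = A powr (\<theta> - 1)"
      have e: "0 < e" using A by (simp add: e_def)
      define v where "v t = z t / e" for t
      have "(lq_norm (?A \<times> ?B) 2 z)\<^sup>2 \<le> e\<^sup>2"
        using yz(3) by (intro power_mono) (simp_all add: mixed_norm_diagonal e_def)
      then have "(\<Sum>t\<in>?A \<times> ?B. (v t)\<^sup>2) \<le> 1"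
        unfolding lq_norm_2_square using e by (simp add: v_def power_divide flip: sum_divide_distrib)
      then obtain c where c: "lq_norm (?A \<times> ?B) Q (\<lambda>t. v t - (\<Sum>r<n. c r * G t r)) \<le> C * (real n powr (- 1 / 2) * real (m * k) powr (1 / Q))"
        using G by blast
      define f where "f t = v t - (\<Sum>r<n. c r * G t r)" for t
      have f: "mixed_norm ?A ?B p2 q2 f \<le> C * A"
      proof -
        have mx: "max 0 (1 / p2 - 1 / Q) = 1 / p2 - 1 / Q" "max 0 (1 / q2 - 1 / Q) = 1 / q2 - 1 / Q"
          using p2 q2 Q by (auto simp: max_def frac_le)
        have "mixed_norm ?A ?B p2 q2 f
            \<le> real m powr (1 / p2 - 1 / Q) * real k powr (1 / q2 - 1 / Q) * mixed_norm ?A ?B Q Q f"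
          using mixed_norm_compare[OF fin, of p2 Q q2 Q f] p2 q2 Q unfolding mx by simp
        also have "\<dots> \<le> real m powr (1 / p2 - 1 / Q) * real k powr (1 / q2 - 1 / Q)
            * (C * (real n powr (- 1 / 2) * real (m * k) powr (1 / Q)))"
          using c Q by (intro mult_left_mono) (auto simp: mixed_norm_diagonal f_def[abs_def])
        also have "\<dots> = C * A"
          using mkn by (simp add: A_def powr_mult powr_diff)
        finally show ?thesis .
      qed
      have X: "Poly_Mapping.lookup (X - (\<Sum>r<n. (R * e * c r) *\<^sub>R g r)) (i, j) = R * (y (i, j) + e * f (i, j))"
        if "i \<in> ?A" "j \<in> ?B" for i j
      proof -
        have "Poly_Mapping.lookup X (i, j) = R * (y (i, j) + e * v (i, j))"
          using yz(1)[of "(i, j)"] R e by (simp add: x_def v_def field_simps)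
        moreover have "Poly_Mapping.lookup (\<Sum>r<n. (R * e * c r) *\<^sub>R g r) (i, j) = R * e * (\<Sum>r<n. c r * G (i, j) r)"
          using that by (simp add: lookup_sum lookup_scaleR g_def lookup_array_of sum_distrib_left mult_ac)
        ultimately show ?thesis by (simp add: lookup_minus f_def algebra_simps)
      qed
      have "lmk_norm m k p2 q2 (X - (\<Sum>r<n. (R * e * c r) *\<^sub>R g r))
          = mixed_norm ?A ?B p2 q2 (\<lambda>t. R * (y t + e * f t))"
        using p2 q2 X by (subst lmk_norm_eq_mixed_norm) (auto intro: mixed_norm_cong)
      also have "\<dots> = R * mixed_norm ?A ?B p2 q2 (\<lambda>t. y t + e * f t)"
        using p2 q2 R by (subst mixed_norm_scale) auto
      also have "\<dots> \<le> R * (mixed_norm ?A ?B p2 q2 y + mixed_norm ?A ?B p2 q2 (\<lambda>t. e * f t))"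
        using p2 q2 R by (intro mult_left_mono mixed_norm_triangle) auto
      also have "mixed_norm ?A ?B p2 q2 (\<lambda>t. e * f t) = e * mixed_norm ?A ?B p2 q2 f"
        using p2 q2 e by (subst mixed_norm_scale) auto
      also have "R * (mixed_norm ?A ?B p2 q2 y + e * mixed_norm ?A ?B p2 q2 f) \<le> R * (A powr \<theta> + e * (C * A))"
        using yz f R e by (intro mult_left_mono add_mono) auto
      also have "e * (C * A) = C * A powr \<theta>"
        using A by (simp add: e_def powr_diff)
      also have "R * (A powr \<theta> + C * A powr \<theta>) = (1 + C) * (R * A powr \<theta>)"
        by (simp add: algebra_simps)
      finally show "\<exists>c. lmk_norm m k p2 q2 (X - (\<Sum>r<n. c r *\<^sub>R g r)) \<le> (1 + C) * (R * A powr \<theta>)"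
        by (rule exI[of _ "\<lambda>r. R * e * c r"])
    qed
  qed (use C in simp)
qed

section \<open>Lower bounds\<close>

text \<open>Gram-Schmidt for functions that matter only on \<open>I\<close>: a residual vanishing on
  \<open>I\<close> adds no vector. The last conjunct says that each member of \<open>F\<close>
  equals its own orthogonal projection there.\<close>

lemma orthonormal_system:
  fixes F :: "('a \<Rightarrow> real) set"
  assumes I: "finite I" and F: "finite F"
  shows "\<exists>d (e :: nat \<Rightarrow> 'a \<Rightarrow> real). d \<le> card F
    \<and> (\<forall>r<d. \<forall>s<d. (\<Sum>t\<in>I. e r t * e s t) = of_bool (r = s))
    \<and> (\<forall>f\<in>F. \<forall>t\<in>I. f t = (\<Sum>r<d. (\<Sum>u\<in>I. f u * e r u) * e r t))"
  using F
proof (induction F rule: finite_induct)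
  case empty
  then show ?case by (intro exI[of _ 0]) simp
next
  case (insert f F)
  then obtain d and e :: "nat \<Rightarrow> 'a \<Rightarrow> real" where d: "d \<le> card F"
    and on': "\<forall>r<d. \<forall>s<d. (\<Sum>t\<in>I. e r t * e s t) = of_bool (r = s)"
    and rep': "\<forall>f\<in>F. \<forall>t\<in>I. f t = (\<Sum>r<d. (\<Sum>u\<in>I. f u * e r u) * e r t)" by (elim exE conjE)
  have on: "(\<Sum>t\<in>I. e r t * e s t) = of_bool (r = s)" if "r < d" "s < d" for r s
    using on' that by blast
  have rep: "f t = (\<Sum>r<d. (\<Sum>u\<in>I. f u * e r u) * e r t)" if "f \<in> F" "t \<in> I" for f t
    using rep' that by blast
  define g where "g t = f t - (\<Sum>r<d. (\<Sum>u\<in>I. f u * e r u) * e r t)" for t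
  have orth: "(\<Sum>t\<in>I. g t * e s t) = 0" if s: "s < d" for s
  proof -
    have "(\<Sum>t\<in>I. g t * e s t) = (\<Sum>t\<in>I. f t * e s t) - (\<Sum>t\<in>I. \<Sum>r<d. (\<Sum>u\<in>I. f u * e r u) * (e r t * e s t))"
      by (simp add: g_def algebra_simps sum_subtractf sum_distrib_left)
    also have "(\<Sum>t\<in>I. \<Sum>r<d. (\<Sum>u\<in>I. f u * e r u) * (e r t * e s t))
        = (\<Sum>r<d. (\<Sum>u\<in>I. f u * e r u) * (\<Sum>t\<in>I. e r t * e s t))"
      by (subst sum.swap) (simp add: sum_distrib_left)
    also have "\<dots> = (\<Sum>r<d. (\<Sum>u\<in>I. f u * e r u) * of_bool (r = s))"
      using s on by (intro sum.cong) auto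
    also have "\<dots> = (\<Sum>u\<in>I. f u * e s u)" using s by (simp add: of_bool_def if_distrib sum.delta cong: if_cong)
    finally show ?thesis by simp
  qed
  define \<gamma> where "\<gamma> = L2_set g I"
  show ?case
  proof (cases "\<gamma> = 0")
    case True
    then have "\<forall>t\<in>I. g t = 0" using I by (simp add: \<gamma>_def L2_set_eq_0_iff)
    then have "\<forall>t\<in>I. f t = (\<Sum>r<d. (\<Sum>u\<in>I. f u * e r u) * e r t)" by (simp add: g_def)
    then have "\<forall>h\<in>insert f F. \<forall>t\<in>I. h t = (\<Sum>r<d. (\<Sum>u\<in>I. h u * e r u) * e r t)"
      using rep' by blast
    moreover have "d \<le> card (insert f F)" using d insert.hyps by simp
    ultimately show ?thesis using on' by blast
  next
    case False
    have gg: "(\<Sum>t\<in>I. g t * g t) = \<gamma> * \<gamma>"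
      using L2_set_square[of g I] by (simp add: \<gamma>_def power2_eq_square)
    define e' where "e' = e(d := (\<lambda>t. g t / \<gamma>))"
    have e': "e' r = e r" if "r < d" for r using that by (simp add: e'_def)
    have e'd: "e' d t = g t / \<gamma>" for t by (simp add: e'_def)
    have od: "(\<Sum>t\<in>I. e' d t * e s t) = 0" if "s < d" for s
      using orth[OF that] by (simp add: e'd flip: sum_divide_distrib)
    have dd: "(\<Sum>t\<in>I. e' d t * e' d t) = 1"
      using False by (simp add: e'd gg flip: sum_divide_distrib)
    have fd: "(\<Sum>t\<in>I. f t * e' d t) = \<gamma>"
    proof -
      have "f t * e' d t = g t * e' d t + (\<Sum>r<d. (\<Sum>u\<in>I. f u * e r u) * (e' d t * e r t))" for t
      proof -
        have "f t = g t + (\<Sum>r<d. (\<Sum>u\<in>I. f u * e r u) * e r t)" by (simp add: g_def)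
        then have "f t * e' d t = (g t + (\<Sum>r<d. (\<Sum>u\<in>I. f u * e r u) * e r t)) * e' d t"
          by (rule arg_cong[where f = "\<lambda>z. z * e' d t"])
        also have "\<dots> = g t * e' d t + (\<Sum>r<d. (\<Sum>u\<in>I. f u * e r u) * e r t) * e' d t"
          by (rule distrib_right)
        also have "(\<Sum>r<d. (\<Sum>u\<in>I. f u * e r u) * e r t) * e' d t = (\<Sum>r<d. (\<Sum>u\<in>I. f u * e r u) * (e' d t * e r t))"
          unfolding sum_distrib_right[where A = "{..<d}"] by (intro sum.cong refl) (simp only: mult_ac)
        finally show ?thesis .
      qed
      then have "(\<Sum>t\<in>I. f t * e' d t) = (\<Sum>t\<in>I. g t * e' d t) + (\<Sum>t\<in>I. \<Sum>r<d. (\<Sum>u\<in>I. f u * e r u) * (e' d t * e r t))"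
        by (simp only: sum.distrib)
      also have "(\<Sum>t\<in>I. \<Sum>r<d. (\<Sum>u\<in>I. f u * e r u) * (e' d t * e r t)) = 0"
        using od by (subst sum.swap) (simp flip: sum_distrib_left)
      also have "(\<Sum>t\<in>I. g t * e' d t) = \<gamma>"
        using False by (simp add: e'd gg flip: sum_divide_distrib)
      finally show ?thesis by simp
    qed
    show ?thesis
    proof (intro exI[of _ "Suc d"] exI[of _ e'] conjI ballI allI impI)
      show "Suc d \<le> card (insert f F)" using d insert.hyps by simp
      fix r s assume "r < Suc d" "s < Suc d"
      then consider "r < d" "s < d" | "r = d" "s < d" | "r < d" "s = d" | "r = d" "s = d" by linarith
      then show "(\<Sum>t\<in>I. e' r t * e' s t) = of_bool (r = s)"
      proof cases
        case 3
        then show ?thesis using od[of r] by (simp add: e' mult.commute)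
      qed (use on od dd e' in auto)
    next
      fix h t assume h: "h \<in> insert f F" and t: "t \<in> I"
      show "h t = (\<Sum>r<Suc d. (\<Sum>u\<in>I. h u * e' r u) * e' r t)"
      proof (cases "h = f")
        case True
        have "(\<Sum>r<Suc d. (\<Sum>u\<in>I. f u * e' r u) * e' r t)
            = (\<Sum>r<d. (\<Sum>u\<in>I. f u * e' r u) * e' r t) + \<gamma> * (g t / \<gamma>)"
          by (simp only: sum.lessThan_Suc fd) (simp only: e'd)
        then show ?thesis using False True by (simp add: e' g_def)
      next
        case False
        then have "h \<in> F" using h by simp
        have "(\<Sum>u\<in>I. h u * e' d u) = (\<Sum>u\<in>I. \<Sum>r<d. (\<Sum>u\<in>I. h u * e r u) * (e' d u * e r u))"
        proof (intro sum.cong refl)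
          fix u assume "u \<in> I"
          have "h u * e' d u = (\<Sum>r<d. (\<Sum>u\<in>I. h u * e r u) * e r u) * e' d u"
            using rep[OF \<open>h \<in> F\<close> \<open>u \<in> I\<close>] by (rule arg_cong[where f = "\<lambda>z. z * e' d u"])
          also have "\<dots> = (\<Sum>r<d. (\<Sum>u\<in>I. h u * e r u) * (e' d u * e r u))"
            unfolding sum_distrib_right[where A = "{..<d}"] by (intro sum.cong refl) (simp only: mult_ac)
          finally show "h u * e' d u = (\<Sum>r<d. (\<Sum>u\<in>I. h u * e r u) * (e' d u * e r u))" .
        qed
        also have "\<dots> = 0"
          using od by (subst sum.swap) (simp flip: sum_distrib_left)
        finally show ?thesis using rep[OF \<open>h \<in> F\<close> t] by (simp add: e')
      qed
    qed
  qed
qed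

text \<open>Discarding a heaviest element does not raise the average weight, and this is repeated
  until \<open>r\<close> elements are left.\<close>

lemma light_subset:
  fixes w :: "'a \<Rightarrow> real"
  assumes "finite A" "r \<le> card A"
  shows "\<exists>R\<subseteq>A. card R = r \<and> real (card A) * (\<Sum>i\<in>R. w i) \<le> real r * (\<Sum>i\<in>A. w i)"
  using assms
proof (induction "card A" arbitrary: A)
  case 0
  then show ?case by auto
next
  case (Suc N)
  show ?case
  proof (cases "r = card A")
    case True
    then show ?thesis by auto
  next
    case False
    have "A \<noteq> {}" using Suc by auto
    then have "w ` A \<noteq> {}" "finite (w ` A)" using Suc by auto
    then obtain a where a: "a \<in> A" "Max (w ` A) = w a" by (metis Max_in imageE)
    have max: "w i \<le> w a" if "i \<in> A" for i
      using that Suc a by (metis Max_ge finite_imageI imageI)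
    define A' where "A' = A - {a}"
    have A': "N = card A'" "finite A'" "r \<le> card A'"
      using Suc a False by (auto simp: A'_def)
    from Suc.hyps(1)[OF A'] obtain R where R: "R \<subseteq> A'" "card R = r"
      "real (card A') * (\<Sum>i\<in>R. w i) \<le> real r * (\<Sum>i\<in>A'. w i)" by blast
    have split: "(\<Sum>i\<in>A. w i) = w a + (\<Sum>i\<in>A'. w i)"
      unfolding A'_def using Suc a by (simp add: sum.remove)
    have "(\<Sum>i\<in>A'. w i) \<le> real N * w a"
      unfolding A'(1) by (rule sum_bounded_above) (auto simp: A'_def max)
    then have "real (Suc N) * (\<Sum>i\<in>A'. w i) \<le> real N * (\<Sum>i\<in>A. w i)"
      unfolding split by (simp add: algebra_simps)
    then have "real r * (real (Suc N) * (\<Sum>i\<in>A'. w i)) \<le> real r * (real N * (\<Sum>i\<in>A. w i))"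
      by (rule mult_left_mono) simp
    moreover have "real (Suc N) * (real N * (\<Sum>i\<in>R. w i)) \<le> real (Suc N) * (real r * (\<Sum>i\<in>A'. w i))"
      using R(3) unfolding A'(1)[symmetric] by (rule mult_left_mono) simp
    ultimately have "real N * (real (Suc N) * (\<Sum>i\<in>R. w i)) \<le> real N * (real r * (\<Sum>i\<in>A. w i))"
      by (simp only: mult_ac)
    then have "real (Suc N) * (\<Sum>i\<in>R. w i) \<le> real r * (\<Sum>i\<in>A. w i)"
    \<comment> \<open>The factor \<open>N\<close> cancels unless \<open>A\<close> is a singleton,
      where \<open>r < card A\<close> forces \<open>r = 0\<close>.\<close>
    proof (cases "N = 0")
      case True
      then have "r = 0" using A' by simp
      then have "R = {}" using R A' finite_subset by fastforce
      then show ?thesis using \<open>r = 0\<close> by simp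
    qed simp
    then show ?thesis using R Suc by (intro exI[of _ R]) (auto simp: A'_def)
  qed
qed

text \<open>\<open>R\<close> is chosen by total weight over \<open>B\<close>, and \<open>S\<close>
  by the weight inside \<open>R\<close> only, so the two averaging factors multiply.\<close>

lemma light_rectangle:
  fixes w :: "'a \<times> 'b \<Rightarrow> real"
  assumes "finite A" "r \<le> card A" "finite B" "l \<le> card B"
  obtains R S where "R \<subseteq> A" "card R = r" "S \<subseteq> B" "card S = l"
    "real (card A) * real (card B) * (\<Sum>t\<in>R \<times> S. w t) \<le> real r * real l * (\<Sum>t\<in>A \<times> B. w t)"
proof -
  obtain R where R: "R \<subseteq> A" "card R = r"
    "real (card A) * (\<Sum>i\<in>R. \<Sum>j\<in>B. w (i, j)) \<le> real r * (\<Sum>i\<in>A. \<Sum>j\<in>B. w (i, j))"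
    using light_subset[OF assms(1,2), of "\<lambda>i. \<Sum>j\<in>B. w (i, j)"] by blast
  obtain S where S: "S \<subseteq> B" "card S = l"
    "real (card B) * (\<Sum>j\<in>S. \<Sum>i\<in>R. w (i, j)) \<le> real l * (\<Sum>j\<in>B. \<Sum>i\<in>R. w (i, j))"
    using light_subset[OF assms(3,4), of "\<lambda>j. \<Sum>i\<in>R. w (i, j)"] by blast
  have "real (card A) * (real (card B) * (\<Sum>j\<in>S. \<Sum>i\<in>R. w (i, j)))
      \<le> real (card A) * (real l * (\<Sum>j\<in>B. \<Sum>i\<in>R. w (i, j)))"
    using S(3) by (rule mult_left_mono) simp
  also have "\<dots> = real l * (real (card A) * (\<Sum>i\<in>R. \<Sum>j\<in>B. w (i, j)))"
    by (subst sum.swap) simp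
  also have "\<dots> \<le> real l * (real r * (\<Sum>i\<in>A. \<Sum>j\<in>B. w (i, j)))"
    using R(3) by (rule mult_left_mono) simp
  finally have "real (card A) * real (card B) * (\<Sum>t\<in>R \<times> S. w t) \<le> real r * real l * (\<Sum>t\<in>A \<times> B. w t)"
    by (subst (asm) sum.swap) (simp add: sum.cartesian_product mult_ac)
  then show ?thesis using that R S by blast
qed

lemma exists_le_average:
  fixes f :: "'a \<Rightarrow> real"
  assumes "finite M" "M \<noteq> {}" "(\<Sum>x\<in>M. f x) \<le> real (card M) * c"
  obtains x where "x \<in> M" "f x \<le> c"
proof -
  have "\<exists>x\<in>M. f x \<le> c"
  proof (rule ccontr)
    assume "\<not> ?thesis"
    then have "(\<Sum>x\<in>M. c) < (\<Sum>x\<in>M. f x)" using assms by (intro sum_strict_mono) auto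
    then show False using assms(3) by simp
  qed
  then show ?thesis using that by blast
qed

text \<open>Averaging over signs kills the cross terms, so some signed indicator of the rectangle has
  small projection on the orthonormal system.\<close>

lemma signed_rectangle_small_projection:
  fixes e :: "nat \<Rightarrow> 'a \<times> 'b \<Rightarrow> real"
  assumes fin: "finite A" "finite B" and r: "r \<le> card A" and l: "l \<le> card B"
    and on: "\<And>s. s < d \<Longrightarrow> (\<Sum>t\<in>A \<times> B. (e s t)\<^sup>2) = 1"
  obtains R S \<epsilon> where "R \<subseteq> A" "card R = r" "S \<subseteq> B" "card S = l" "\<epsilon> \<in> signs (R \<times> S)"
    "real (card A) * real (card B) * (\<Sum>s<d. (\<Sum>t\<in>R \<times> S. \<epsilon> t * e s t)\<^sup>2) \<le> real r * real l * real d"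
proof -
  obtain R S where RS: "R \<subseteq> A" "card R = r" "S \<subseteq> B" "card S = l"
    and le: "real (card A) * real (card B) * (\<Sum>t\<in>R \<times> S. \<Sum>s<d. (e s t)\<^sup>2) \<le> real r * real l * (\<Sum>t\<in>A \<times> B. \<Sum>s<d. (e s t)\<^sup>2)"
    by (rule light_rectangle[OF fin(1) r fin(2) l])
  have tot: "(\<Sum>t\<in>A \<times> B. \<Sum>s<d. (e s t)\<^sup>2) = real d"
    by (subst sum.swap) (simp add: on)
  have finRS: "finite (R \<times> S)" 
    using finite_subset[OF RS(1) fin(1)] finite_subset[OF RS(3) fin(2)] by simp
  have "(\<Sum>\<epsilon>\<in>signs (R \<times> S). \<Sum>s<d. (\<Sum>t\<in>R \<times> S. \<epsilon> t * e s t)\<^sup>2)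
      = (\<Sum>s<d. \<Sum>\<epsilon>\<in>signs (R \<times> S). (0 + (\<Sum>t\<in>R \<times> S. \<epsilon> t * e s t))\<^sup>2)"
    by (subst sum.swap) simp
  also have "\<dots> = (\<Sum>s<d. 2 ^ card (R \<times> S) * (0\<^sup>2 + (\<Sum>t\<in>R \<times> S. (e s t)\<^sup>2)))"
    by (intro sum.cong refl sum_signs_square[OF finRS])
  also have "\<dots> = real (card (signs (R \<times> S))) * (\<Sum>t\<in>R \<times> S. \<Sum>s<d. (e s t)\<^sup>2)"
    using finRS sum.swap[of "\<lambda>t s. (e s t)\<^sup>2" "{..<d}" "R \<times> S"]
    by (simp add: card_signs flip: sum_distrib_left)
  finally have "(\<Sum>\<epsilon>\<in>signs (R \<times> S). \<Sum>s<d. (\<Sum>t\<in>R \<times> S. \<epsilon> t * e s t)\<^sup>2)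
      \<le> real (card (signs (R \<times> S))) * (\<Sum>t\<in>R \<times> S. \<Sum>s<d. (e s t)\<^sup>2)" by simp
  moreover have "signs (R \<times> S) \<noteq> {}" by (auto simp: signs_def PiE_eq_empty_iff)
  ultimately obtain \<epsilon> where \<epsilon>: "\<epsilon> \<in> signs (R \<times> S)"
    "(\<Sum>s<d. (\<Sum>t\<in>R \<times> S. \<epsilon> t * e s t)\<^sup>2) \<le> (\<Sum>t\<in>R \<times> S. \<Sum>s<d. (e s t)\<^sup>2)"
    using exists_le_average[of "signs (R \<times> S)" "\<lambda>\<epsilon>. \<Sum>s<d. (\<Sum>t\<in>R \<times> S. \<epsilon> t * e s t)\<^sup>2"
        "\<Sum>t\<in>R \<times> S. \<Sum>s<d. (e s t)\<^sup>2"] finite_signs[OF finRS] by blast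
  have "real (card A) * real (card B) * (\<Sum>s<d. (\<Sum>t\<in>R \<times> S. \<epsilon> t * e s t)\<^sup>2)
      \<le> real (card A) * real (card B) * (\<Sum>t\<in>R \<times> S. \<Sum>s<d. (e s t)\<^sup>2)"
    using \<epsilon>(2) by (intro mult_left_mono) auto
  also have "\<dots> \<le> real r * real l * real d" using le unfolding tot .
  finally show ?thesis using that RS \<epsilon> by blast
qed

text \<open>Reduces the width to finding one far point per subspace. A basis supplies a spanning set
  of at most \<open>n\<close> elements, the only form in which the dimension is used.\<close>

lemma le_kolmogorov_width:
  assumes "\<And>L F. L \<subseteq> X \<Longrightarrow> finite F \<Longrightarrow> card F \<le> n \<Longrightarrow> L \<subseteq> span F \<Longrightarrow> \<exists>x\<in>M. \<forall>y\<in>L. D \<le> N (x - y)"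
  shows "ennreal D \<le> kolmogorov_width n M X N"
  unfolding kolmogorov_width_def
proof (rule INF_greatest)
  fix L assume "L \<in> {L. subspace L \<and> L \<subseteq> X \<and> (\<exists>B. finite B \<and> L = span B) \<and> dim L \<le> n}"
  then obtain B where L: "L \<subseteq> X" "finite B" "L = span B" "dim L \<le> n" by blast
  obtain F where F: "F \<subseteq> L" "independent F" "L \<subseteq> span F" "card F = dim L" by (rule basis_exists)
  have "finite F" using F(1,2) L(2,3) independent_span_bound[of B F] by blast
  then obtain x where x: "x \<in> M" "\<forall>y\<in>L. D \<le> N (x - y)"
    using assms[of L F] L F by auto
  have "ennreal D \<le> (INF y\<in>L. ennreal (N (x - y)))"
    using x by (intro INF_greatest ennreal_leI) auto
  then show "ennreal D \<le> (SUP x\<in>M. INF y\<in>L. ennreal (N (x - y)))"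
    by (rule order_trans) (rule SUP_upper[OF x(1)])
qed

lemma lq_norm_indicator:
  assumes "finite I" "J \<subseteq> I" "0 < q" "\<And>i. i \<in> J \<Longrightarrow> \<bar>x i\<bar> = c" "\<And>i. i \<in> I \<Longrightarrow> i \<notin> J \<Longrightarrow> x i = 0" "0 \<le> c"
  shows "lq_norm I q x = real (card J) powr (1 / q) * c"
proof -
  have "(\<Sum>i\<in>I. \<bar>x i\<bar> powr q) = (\<Sum>i\<in>J. c powr q)"
    using assms by (intro sum.mono_neutral_cong_right) auto
  then show ?thesis using assms by (simp add: lq_norm_def powr_mult powr_powr)
qed

text \<open>Duality: the pairing of \<open>x / \<nu> - y\<close> with \<open>x - P x\<close> is
  \<open>(r * l - H) / \<nu>\<close> whatever \<open>y\<close> is. Hoelder on the rectangle bounds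
  the \<open>x\<close> part by \<open>\<alpha> * Z\<close>, Cauchy-Schwarz the \<open>P x\<close>
  part by \<open>\<beta> * Z\<close>. As \<open>?D1 * \<alpha>\<close> and
  \<open>?D2 * \<beta>\<close> both equal \<open>r * l / \<nu>\<close>, and \<open>H\<close> is at
  most half of \<open>r * l\<close>, the factor is 1/4.\<close>

lemma kolmogorov_width_lower:
  fixes p1 q1 p2 q2 :: real and m k n r l :: nat
  assumes p: "1 \<le> p1" "2 \<le> p2" and q: "1 \<le> q1" "2 \<le> q2"
    and r: "1 \<le> r" "r \<le> m" and l: "1 \<le> l" "l \<le> k" and n: "1 \<le> n" "2 * n \<le> m * k"
  shows "ennreal (1 / 4 * min (real r powr (1 / p2 - 1 / p1) * real l powr (1 / q2 - 1 / q1))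
      (real r powr (1 / 2 - 1 / p1) * real l powr (1 / 2 - 1 / q1)
        * (real n powr (- 1 / 2) * real m powr (1 / p2) * real k powr (1 / q2))))
    \<le> kolmogorov_width n (lmk_ball m k p1 q1) (lmk_space m k) (lmk_norm m k p2 q2)"
    (is "ennreal (1 / 4 * min ?D1 ?D2) \<le> _")
proof (rule le_kolmogorov_width)
  fix L F :: "(nat \<times> nat \<Rightarrow>\<^sub>0 real) set"
  assume F: "finite F" "card F \<le> n" "L \<subseteq> span F"
  let ?A = "{1..m}" and ?B = "{1..k}"
  define I where "I = ?A \<times> ?B"
  have finI: "finite I" by (simp add: I_def)
  obtain d and e :: "nat \<Rightarrow> nat \<times> nat \<Rightarrow> real" where d: "d \<le> card (Poly_Mapping.lookup ` F)"
    and on': "\<forall>r<d. \<forall>s<d. (\<Sum>t\<in>I. e r t * e s t) = of_bool (r = s)"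
    and rep': "\<forall>f\<in>Poly_Mapping.lookup ` F. \<forall>t\<in>I. f t = (\<Sum>r<d. (\<Sum>u\<in>I. f u * e r u) * e r t)"
    using orthonormal_system[OF finI finite_imageI[OF F(1)], of Poly_Mapping.lookup] by (elim exE conjE)
  have dn: "d \<le> n" using d card_image_le[OF F(1), of Poly_Mapping.lookup] F(2) by linarith
  have on: "(\<Sum>t\<in>I. e r t * e s t) = of_bool (r = s)" if "r < d" "s < d" for r s
    using on' that by blast
  \<comment> \<open>Being reproduced by \<open>e\<close> on \<open>I\<close> is a linear condition,
    so it passes from \<open>F\<close> to its span.\<close>
  have rep: "Poly_Mapping.lookup y t = (\<Sum>r<d. (\<Sum>u\<in>I. Poly_Mapping.lookup y u * e r u) * e r t)"
    if "y \<in> L" "t \<in> I" for y t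
  proof -
    define S where "S = {y. \<forall>t\<in>I. Poly_Mapping.lookup y t = (\<Sum>r<d. (\<Sum>u\<in>I. Poly_Mapping.lookup y u * e r u) * e r t)}"
    have "subspace S"
      unfolding subspace_def
    proof (intro conjI ballI allI)
      show "0 \<in> S" by (simp add: S_def)
      fix x y assume x: "x \<in> S" and y: "y \<in> S"
      show "x + y \<in> S"
        unfolding S_def
      proof (intro CollectI ballI)
        fix t assume t: "t \<in> I"
        have "Poly_Mapping.lookup (x + y) t = (\<Sum>r<d. (\<Sum>u\<in>I. Poly_Mapping.lookup x u * e r u) * e r t)
            + (\<Sum>r<d. (\<Sum>u\<in>I. Poly_Mapping.lookup y u * e r u) * e r t)"
          unfolding lookup_add using x y t by (intro arg_cong2[where f = "(+)"]) (auto simp: S_def)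
        then show "Poly_Mapping.lookup (x + y) t = (\<Sum>r<d. (\<Sum>u\<in>I. Poly_Mapping.lookup (x + y) u * e r u) * e r t)"
          by (simp add: lookup_add distrib_right sum.distrib)
      qed
    next
      fix c x assume x: "x \<in> S"
      show "c *\<^sub>R x \<in> S"
        unfolding S_def
      proof (intro CollectI ballI)
        fix t assume t: "t \<in> I"
        have "Poly_Mapping.lookup (c *\<^sub>R x) t = c * (\<Sum>r<d. (\<Sum>u\<in>I. Poly_Mapping.lookup x u * e r u) * e r t)"
          unfolding lookup_scaleR real_scaleR_def using x t by (intro arg_cong2[where f = "(*)"]) (auto simp: S_def)
        then show "Poly_Mapping.lookup (c *\<^sub>R x) t = (\<Sum>r<d. (\<Sum>u\<in>I. Poly_Mapping.lookup (c *\<^sub>R x) u * e r u) * e r t)"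
          by (simp add: lookup_scaleR mult.assoc flip: sum_distrib_left)
      qed
    qed
    moreover have "F \<subseteq> S" unfolding S_def using rep' by blast
    ultimately have "span F \<subseteq> S" by (intro span_minimal)
    then have "y \<in> S" using F(3) that by blast
    then show ?thesis using that unfolding S_def by blast
  qed
  have on1: "(\<Sum>t\<in>?A \<times> ?B. (e s t)\<^sup>2) = 1" if "s < d" for s
    using on[OF that that] by (simp add: power2_eq_square I_def)
  obtain R S \<epsilon> where RS: "R \<subseteq> ?A" "card R = r" "S \<subseteq> ?B" "card S = l" and \<epsilon>: "\<epsilon> \<in> signs (R \<times> S)"
    and small: "real (card ?A) * real (card ?B) * (\<Sum>s<d. (\<Sum>t\<in>R \<times> S. \<epsilon> t * e s t)\<^sup>2) \<le> real r * real l * real d"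
    by (rule signed_rectangle_small_projection[OF _ _ _ _ on1, of r l]) (use r l in auto)
  define x where "x t = (if t \<in> R \<times> S then \<epsilon> t else 0)" for t
  define \<nu> where "\<nu> = real r powr (1 / p1) * real l powr (1 / q1)"
  define X where "X = array_of m k (\<lambda>t. x t / \<nu>)"
  have \<nu>: "0 < \<nu>" using r l by (simp add: \<nu>_def)
  have RSI: "R \<times> S \<subseteq> I" using RS by (auto simp: I_def)
  have lookupX: "Poly_Mapping.lookup X t = 1 / \<nu> * x t" for t
    using RSI by (auto simp: X_def lookup_array_of x_def I_def)
  have absx: "\<bar>x t\<bar> = 1" if "t \<in> R \<times> S" for t using that signs_abs[OF \<epsilon>] by (simp add: x_def)
  have X_ball: "X \<in> lmk_ball m k p1 q1"
  proof -
    have inner: "lq_norm ?A p1 (\<lambda>i. x (i, j)) = (if j \<in> S then real r powr (1 / p1) else 0)" for j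
    proof (cases "j \<in> S")
      case True
      have "lq_norm ?A p1 (\<lambda>i. x (i, j)) = real (card R) powr (1 / p1) * 1"
        using RS p True absx by (intro lq_norm_indicator) (auto simp: x_def)
      then show ?thesis using True RS by simp
    next
      case False
      then show ?thesis using p by (simp add: lq_norm_eq_0_iff x_def)
    qed
    have "mixed_norm ?A ?B p1 q1 x = real (card S) powr (1 / q1) * (real r powr (1 / p1))"
      unfolding mixed_norm_def inner using RS q by (intro lq_norm_indicator) auto
    then have "mixed_norm ?A ?B p1 q1 x = \<nu>" using RS by (simp add: \<nu>_def mult.commute)
    moreover have "mixed_norm ?A ?B p1 q1 (Poly_Mapping.lookup X) = \<bar>1 / \<nu>\<bar> * mixed_norm ?A ?B p1 q1 x"
      unfolding lookupX using p q by (intro mixed_norm_scale) auto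
    ultimately show ?thesis using \<nu> p q array_of_in_lmk_space
      by (simp add: lmk_ball_def lmk_norm_eq_mixed_norm X_def)
  qed
  have "1 / 4 * min ?D1 ?D2 \<le> lmk_norm m k p2 q2 (X - y)" if y: "y \<in> L" for y
  proof -
    define z where "z = Poly_Mapping.lookup (X - y)"
    define Z where "Z = mixed_norm ?A ?B p2 q2 z"
    define a where "a s = (\<Sum>t\<in>I. x t * e s t)" for s
    define b where "b s = (\<Sum>t\<in>I. Poly_Mapping.lookup y t * e s t)" for s
    define P where "P t = (\<Sum>s<d. a s * e s t)" for t
    define H where "H = (\<Sum>s<d. (a s)\<^sup>2)"
    have a_eq: "a s = (\<Sum>t\<in>R \<times> S. \<epsilon> t * e s t)" for s
      unfolding a_def x_def using RSI finI by (intro sum.mono_neutral_cong_right) auto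
    have pairP: "(\<Sum>t\<in>I. f t * P t) = (\<Sum>s<d. a s * (\<Sum>t\<in>I. f t * e s t))" for f
      unfolding P_def sum_distrib_left by (subst sum.swap) (simp add: mult_ac)
    have yx: "(\<Sum>t\<in>I. Poly_Mapping.lookup y t * x t) = (\<Sum>s<d. a s * b s)"
    proof -
      have "(\<Sum>t\<in>I. Poly_Mapping.lookup y t * x t) = (\<Sum>t\<in>I. \<Sum>s<d. b s * (x t * e s t))"
      proof (intro sum.cong refl)
        fix t assume "t \<in> I"
        have "Poly_Mapping.lookup y t * x t = (\<Sum>s<d. b s * e s t) * x t"
          unfolding b_def using rep[OF y \<open>t \<in> I\<close>] by (rule arg_cong[where f = "\<lambda>z. z * x t"])
        also have "\<dots> = (\<Sum>s<d. b s * (x t * e s t))"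
          unfolding sum_distrib_right[where A = "{..<d}"] by (intro sum.cong refl) (simp only: mult_ac)
        finally show "Poly_Mapping.lookup y t * x t = (\<Sum>s<d. b s * (x t * e s t))" .
      qed
      also have "\<dots> = (\<Sum>s<d. a s * b s)"
        unfolding a_def by (subst sum.swap) (simp add: mult.commute flip: sum_distrib_left)
      finally show ?thesis .
    qed
    have xx: "(\<Sum>t\<in>I. x t * x t) = real r * real l"
    proof -
      have "(\<Sum>t\<in>I. x t * x t) = (\<Sum>t\<in>R \<times> S. 1)"
      proof (intro sum.mono_neutral_cong_right)
        fix t assume "t \<in> R \<times> S"
        then show "x t * x t = 1" using absx[of t] by (metis abs_mult_self_eq mult_1)
      qed (use RSI finI in \<open>auto simp: x_def\<close>)
      then show ?thesis using RS by (simp add: card_cartesian_product)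
    qed
    have zt: "z t = 1 / \<nu> * x t - Poly_Mapping.lookup y t" for t
      by (simp add: z_def lookup_minus lookupX)
    have PP: "(\<Sum>t\<in>I. P t * P t) = H"
    proof -
      have "(\<Sum>t\<in>I. P t * e s t) = a s" if "s < d" for s
      proof -
        have "(\<Sum>t\<in>I. P t * e s t) = (\<Sum>s'<d. a s' * (\<Sum>t\<in>I. e s t * e s' t))"
          by (subst pairP[of "e s", symmetric]) (simp add: mult.commute)
        also have "\<dots> = (\<Sum>s'<d. if s' = s then a s' else 0)"
          using on that by (intro sum.cong) auto
        finally show ?thesis using that by simp
      qed
      then show ?thesis unfolding pairP H_def by (simp add: power2_eq_square)
    qed
    have key: "(\<Sum>t\<in>I. z t * x t) - (\<Sum>t\<in>I. z t * P t) = 1 / \<nu> * (real r * real l - H)"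
    proof -
      have "(\<Sum>t\<in>I. z t * x t) = 1 / \<nu> * (\<Sum>t\<in>I. x t * x t) - (\<Sum>t\<in>I. Poly_Mapping.lookup y t * x t)"
        unfolding zt by (simp add: left_diff_distrib sum_subtractf sum_divide_distrib)
      moreover have "(\<Sum>t\<in>I. z t * P t) = 1 / \<nu> * (\<Sum>t\<in>I. x t * P t) - (\<Sum>t\<in>I. Poly_Mapping.lookup y t * P t)"
        unfolding zt by (simp add: left_diff_distrib sum_subtractf sum_divide_distrib)
      moreover have "(\<Sum>t\<in>I. x t * P t) = H"
        unfolding pairP a_def[symmetric] H_def by (simp add: power2_eq_square)
      moreover have "(\<Sum>t\<in>I. Poly_Mapping.lookup y t * P t) = (\<Sum>s<d. a s * b s)"
        unfolding pairP b_def ..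
      ultimately show ?thesis using xx yx by (simp add: right_diff_distrib)
    qed
    have mk: "0 < real m" "0 < real k" "0 < real r" "0 < real l" "0 < real n" using r l n by auto
    \<comment> \<open>This form, proportional to \<open>n\<close>, yields the small dual norm
      \<open>\<beta>\<close>; its consequence \<open>H_half\<close> keeps the pairing large.\<close>
    have H_le: "H \<le> real r * real l * real n / (real m * real k)"
    proof -
      have "real m * real k * H \<le> real r * real l * real d"
        using small unfolding a_eq[symmetric] H_def by simp
      also have "\<dots> \<le> real r * real l * real n" using dn by (intro mult_left_mono) auto
      finally show ?thesis using mk by (simp add: field_simps)
    qed
    have H_half: "H \<le> real r * real l / 2"
    proof -
      have "real r * real l * real n / (real m * real k) \<le> real r * real l / 2"
      proof -
        have "2 * real n \<le> real m * real k" using n(2) by (metis of_nat_le_iff of_nat_mult of_nat_numeral)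
        then have "real r * real l * (2 * real n) \<le> real r * real l * (real m * real k)"
          by (intro mult_left_mono) auto
        then show ?thesis using mk by (simp add: field_simps)
      qed
      then show ?thesis using H_le by linarith
    qed
    define \<alpha> where "\<alpha> = real r powr (1 - 1 / p2) * real l powr (1 - 1 / q2)"
    define \<beta> where "\<beta> = real m powr (- 1 / p2) * real k powr (- 1 / q2) * (real r * real l * real n) powr (1 / 2)"
    have Z0: "0 \<le> Z" by (simp add: Z_def)
    have fin: "finite R" "finite S" "R \<noteq> {}" "S \<noteq> {}"
      using RS r l by (auto intro: finite_subset)
    have zx: "(\<Sum>t\<in>I. z t * x t) \<le> \<alpha> * Z"
    proof -
      have "(\<Sum>t\<in>I. z t * x t) = (\<Sum>t\<in>R \<times> S. z t * x t)"
        using RSI finI by (intro sum.mono_neutral_right) (auto simp: x_def)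
      also have "\<dots> \<le> (\<Sum>t\<in>R \<times> S. \<bar>z t\<bar>)"
      proof (intro sum_mono)
        fix t assume "t \<in> R \<times> S"
        then have "\<bar>z t * x t\<bar> = \<bar>z t\<bar>" using absx by (simp add: abs_mult)
        then show "z t * x t \<le> \<bar>z t\<bar>" by linarith
      qed
      also have "\<dots> = mixed_norm R S 1 1 z"
        by (simp add: mixed_norm_diagonal lq_norm_def sum_nonneg)
      also have "\<dots> \<le> \<alpha> * mixed_norm R S p2 q2 z"
      proof -
        have "max 0 (1 / 1 - 1 / p2) = 1 - 1 / p2" "max 0 (1 / 1 - 1 / q2) = 1 - 1 / q2"
          using p q by (auto simp: field_simps)
        then show ?thesis
          using mixed_norm_compare[of R S 1 p2 1 q2 z] fin p q RS by (simp add: \<alpha>_def)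
      qed
      also have "\<dots> \<le> \<alpha> * Z"
        unfolding Z_def using RS p q by (intro mult_left_mono mixed_norm_subset) (auto simp: \<alpha>_def)
      finally show ?thesis .
    qed
    \<comment> \<open>\<open>\<delta>\<close> is the cost of passing from the mixed norm to the
      Euclidean one, and the bound on \<open>H\<close> supplies the rest of
      \<open>\<beta>\<close>.\<close>
    have zP: "- (\<Sum>t\<in>I. z t * P t) \<le> \<beta> * Z"
    proof (rule power2_le_imp_le[OF order_trans[OF _ order_trans]])
      show "(- (\<Sum>t\<in>I. z t * P t))\<^sup>2 \<le> (\<Sum>t\<in>I. (z t)\<^sup>2) * (\<Sum>t\<in>I. (P t)\<^sup>2)"
        unfolding power2_minus by (rule Cauchy_Schwarz_ineq_sum)
      define \<delta> where "\<delta> = real m powr (1 / 2 - 1 / p2) * real k powr (1 / 2 - 1 / q2)"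
      have "mixed_norm ?A ?B 2 2 z \<le> \<delta> * Z"
      proof -
        have "max 0 (1 / 2 - 1 / p2) = 1 / 2 - 1 / p2" "max 0 (1 / 2 - 1 / q2) = 1 / 2 - 1 / q2"
          using p q by (auto simp: field_simps)
        then show ?thesis
          using mixed_norm_compare[of ?A ?B 2 p2 2 q2 z] mk p q by (simp add: \<delta>_def Z_def)
      qed
      then have "(lq_norm I 2 z)\<^sup>2 \<le> (\<delta> * Z)\<^sup>2"
        by (intro power_mono) (simp_all add: mixed_norm_diagonal I_def)
      then have z2: "(\<Sum>t\<in>I. (z t)\<^sup>2) \<le> (\<delta> * Z)\<^sup>2" by (simp add: lq_norm_2_square)
      have "(\<Sum>t\<in>I. (P t)\<^sup>2) = H" using PP by (simp add: power2_eq_square)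
      then show "(\<Sum>t\<in>I. (z t)\<^sup>2) * (\<Sum>t\<in>I. (P t)\<^sup>2) \<le> (\<delta> * Z)\<^sup>2 * (real r * real l * real n / (real m * real k))"
        using z2 H_le by (intro mult_mono) (auto simp: H_def sum_nonneg)
      have sq: "(c powr (1 / 2))\<^sup>2 = c" if "0 < c" for c :: real
        using that by (simp add: powr_half_sqrt)
      have "\<beta> = \<delta> * ((real r * real l * real n) powr (1 / 2) * (real m powr (- (1 / 2)) * real k powr (- (1 / 2))))"
      proof -
        have "c powr (- 1 / u) = c powr (1 / 2 - 1 / u) * c powr (- (1 / 2))" for c u :: real
          by (simp flip: powr_add)
        then show ?thesis unfolding \<beta>_def \<delta>_def by (simp only: mult_ac)
      qed
      then have "\<beta>\<^sup>2 = \<delta>\<^sup>2 * (((real r * real l * real n) powr (1 / 2))\<^sup>2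
          * ((real m powr (- (1 / 2)))\<^sup>2 * (real k powr (- (1 / 2)))\<^sup>2))"
        by (simp only: power_mult_distrib)
      moreover have "((real r * real l * real n) powr (1 / 2))\<^sup>2 = real r * real l * real n"
        using mk by (intro sq) simp
      moreover have "(real m powr (- (1 / 2)))\<^sup>2 = inverse (real m)" "(real k powr (- (1 / 2)))\<^sup>2 = inverse (real k)"
        using sq[OF mk(1)] sq[OF mk(2)] by (simp_all only: powr_minus power_inverse)
      ultimately have "\<beta>\<^sup>2 = \<delta>\<^sup>2 * (real r * real l * real n / (real m * real k))"
        by (simp only: divide_inverse inverse_mult_distrib)
      then show "(\<delta> * Z)\<^sup>2 * (real r * real l * real n / (real m * real k)) \<le> (\<beta> * Z)\<^sup>2"
        by (simp add: power_mult_distrib mult_ac)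
    qed (use Z0 in \<open>simp add: \<beta>_def\<close>)
    have \<alpha>\<beta>: "0 < \<alpha>" "0 < \<beta>" using mk by (auto simp: \<alpha>_def \<beta>_def)
    have D1: "?D1 * \<alpha> = real r * real l / \<nu>"
    proof -
      have e: "c powr (1 / u - 1 / v) * c powr (1 - 1 / u) = c / c powr (1 / v)" if "0 < c" for c u v :: real
      proof -
        have "c powr (1 / u - 1 / v) * c powr (1 - 1 / u) = c powr (1 - 1 / v)" by (simp flip: powr_add)
        then show ?thesis using that by (simp add: powr_diff)
      qed
      have "?D1 * \<alpha> = (real r powr (1 / p2 - 1 / p1) * real r powr (1 - 1 / p2))
          * (real l powr (1 / q2 - 1 / q1) * real l powr (1 - 1 / q2))"
        unfolding \<alpha>_def by (simp only: mult_ac)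
      then show ?thesis unfolding e[OF mk(3)] e[OF mk(4)] \<nu>_def by simp
    qed
    have D2: "?D2 * \<beta> = real r * real l / \<nu>"
    proof -
      have e: "c powr (1 / 2 - 1 / v) * c powr (1 / 2) = c / c powr (1 / v)" if "0 < c" for c v :: real
      proof -
        have "c powr (1 / 2 - 1 / v) * c powr (1 / 2) = c powr (1 - 1 / v)" by (simp flip: powr_add)
        then show ?thesis using that by (simp add: powr_diff)
      qed
      have o: "c powr u * c powr v = 1" if "0 < c" "v = - u" for c u v :: real
        using that by (simp flip: powr_add)
      have "?D2 * \<beta> = (real r powr (1 / 2 - 1 / p1) * real r powr (1 / 2))
          * (real l powr (1 / 2 - 1 / q1) * real l powr (1 / 2))
          * ((real n powr (1 / 2) * real n powr (- 1 / 2))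
          * (real m powr (1 / p2) * real m powr (- 1 / p2)) * (real k powr (1 / q2) * real k powr (- 1 / q2)))"
        unfolding \<beta>_def powr_mult by (simp only: mult_ac)
      also have "real n powr (1 / 2) * real n powr (- 1 / 2) = 1" using mk by (intro o) auto
      also have "real m powr (1 / p2) * real m powr (- 1 / p2) = 1" using mk by (intro o) auto
      also have "real k powr (1 / q2) * real k powr (- 1 / q2) = 1" using mk by (intro o) auto
      finally show ?thesis unfolding e[OF mk(3)] e[OF mk(4)] \<nu>_def by simp
    qed
    have "1 / 4 * min ?D1 ?D2 * (\<alpha> + \<beta>) = 1 / 4 * (min ?D1 ?D2 * \<alpha> + min ?D1 ?D2 * \<beta>)"
      by (simp add: distrib_left)
    also have "\<dots> \<le> 1 / 4 * (?D1 * \<alpha> + ?D2 * \<beta>)"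
      using \<alpha>\<beta> by (intro mult_left_mono add_mono mult_right_mono) auto
    also have "\<dots> = 1 / \<nu> * (real r * real l - real r * real l / 2)"
      unfolding D1 D2 by simp
    also have "\<dots> \<le> 1 / \<nu> * (real r * real l - H)"
    proof (intro mult_left_mono)
      show "real r * real l - real r * real l / 2 \<le> real r * real l - H" using H_half by linarith
    qed (use \<nu> in simp)
    also have "\<dots> \<le> \<alpha> * Z + \<beta> * Z" using key zx zP by linarith
    also have "\<dots> = Z * (\<alpha> + \<beta>)" by (simp add: distrib_left mult.commute)
    finally have "1 / 4 * min ?D1 ?D2 \<le> Z"
      using \<alpha>\<beta> by (subst (asm) mult_le_cancel_right_pos) auto
    then show ?thesis using p q by (simp add: lmk_norm_eq_mixed_norm Z_def z_def)
  qed
  then show "\<exists>x\<in>lmk_ball m k p1 q1. \<forall>y\<in>L. 1 / 4 * min ?D1 ?D2 \<le> lmk_norm m k p2 q2 (x - y)"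
    using X_ball by blast
qed

text \<open>The ceiling lies between \<open>\<rho>\<close> and \<open>2 * \<rho>\<close>, so a power
  with exponent in [-1, 1] loses at most a factor 2.\<close>

lemma round_up:
  fixes \<rho> :: real
  assumes "1 \<le> \<rho>" "\<rho> \<le> real m"
  obtains r where "1 \<le> r" "r \<le> m" "\<And>e. -1 \<le> e \<Longrightarrow> e \<le> 1 \<Longrightarrow> \<rho> powr e / 2 \<le> real r powr e"
proof (rule that[of "nat \<lceil>\<rho>\<rceil>"])
  have r: "\<rho> \<le> real (nat \<lceil>\<rho>\<rceil>)" "real (nat \<lceil>\<rho>\<rceil>) \<le> \<rho> + 1"
    using assms of_int_ceiling_le_add_one[of \<rho>] by (auto simp: le_of_int_ceiling)
  show "1 \<le> nat \<lceil>\<rho>\<rceil>" using r assms by linarith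
  show "nat \<lceil>\<rho>\<rceil> \<le> m" using assms by (simp add: nat_le_iff ceiling_le_iff)
  fix e :: real assume e: "-1 \<le> e" "e \<le> 1"
  show "\<rho> powr e / 2 \<le> real (nat \<lceil>\<rho>\<rceil>) powr e"
  proof (cases "0 \<le> e")
    case True
    then have "\<rho> powr e \<le> real (nat \<lceil>\<rho>\<rceil>) powr e" using r assms by (intro powr_mono2) auto
    moreover have "0 \<le> \<rho> powr e" by simp
    ultimately show ?thesis by linarith
  next
    case False
    have "1 / 2 * \<rho> powr e \<le> 2 powr e * \<rho> powr e"
    proof (intro mult_right_mono)
      have "2 powr (-1) \<le> (2::real) powr e" using e by (intro powr_mono) auto
      then show "1 / 2 \<le> (2::real) powr e" by (simp add: powr_minus)
    qed simp
    also have "\<dots> = (2 * \<rho>) powr e" by (simp add: powr_mult)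
    also have "\<dots> \<le> real (nat \<lceil>\<rho>\<rceil>) powr e" using False r assms by (intro powr_mono2'; linarith)
    finally show ?thesis by simp
  qed
qed

text \<open>Real side lengths can be tuned exactly; rounding both costs a factor 4, which turns 1/4
  into 1/16.\<close>

lemma kolmogorov_width_lower_real:
  fixes p1 q1 p2 q2 \<rho> \<sigma> :: real and m k n :: nat
  assumes p: "1 \<le> p1" "2 \<le> p2" and q: "1 \<le> q1" "2 \<le> q2"
    and \<rho>: "1 \<le> \<rho>" "\<rho> \<le> real m" and \<sigma>: "1 \<le> \<sigma>" "\<sigma> \<le> real k" and n: "1 \<le> n" "2 * n \<le> m * k"
  shows "ennreal (1 / 16 * min (\<rho> powr (1 / p2 - 1 / p1) * \<sigma> powr (1 / q2 - 1 / q1))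
      (\<rho> powr (1 / 2 - 1 / p1) * \<sigma> powr (1 / 2 - 1 / q1)
        * (real n powr (- 1 / 2) * real m powr (1 / p2) * real k powr (1 / q2))))
    \<le> kolmogorov_width n (lmk_ball m k p1 q1) (lmk_space m k) (lmk_norm m k p2 q2)"
proof -
  obtain r where r: "1 \<le> r" "r \<le> m" "\<And>e. -1 \<le> e \<Longrightarrow> e \<le> 1 \<Longrightarrow> \<rho> powr e / 2 \<le> real r powr e"
    using round_up[OF \<rho>] by blast
  obtain l where l: "1 \<le> l" "l \<le> k" "\<And>e. -1 \<le> e \<Longrightarrow> e \<le> 1 \<Longrightarrow> \<sigma> powr e / 2 \<le> real l powr e"
    using round_up[OF \<sigma>] by blast
  define A where "A = real n powr (- 1 / 2) * real m powr (1 / p2) * real k powr (1 / q2)"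
  have A: "0 \<le> A" by (simp add: A_def)
  have inv: "0 \<le> 1 / p1" "1 / p1 \<le> 1" "0 \<le> 1 / p2" "1 / p2 \<le> 1" "0 \<le> 1 / q1" "1 / q1 \<le> 1" "0 \<le> 1 / q2" "1 / q2 \<le> 1"
    using p q by auto
  have prod: "\<rho> powr e * \<sigma> powr f \<le> 4 * (real r powr e * real l powr f)"
    if "-1 \<le> e" "e \<le> 1" "-1 \<le> f" "f \<le> 1" for e f
  proof -
    have "\<rho> powr e / 2 * (\<sigma> powr f / 2) \<le> real r powr e * real l powr f"
      using r(3) l(3) that by (intro mult_mono) auto
    then show ?thesis by simp
  qed
  have 1: "\<rho> powr (1 / p2 - 1 / p1) * \<sigma> powr (1 / q2 - 1 / q1)
      \<le> 4 * (real r powr (1 / p2 - 1 / p1) * real l powr (1 / q2 - 1 / q1))"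
    using inv by (intro prod) linarith+
  have "\<rho> powr (1 / 2 - 1 / p1) * \<sigma> powr (1 / 2 - 1 / q1)
      \<le> 4 * (real r powr (1 / 2 - 1 / p1) * real l powr (1 / 2 - 1 / q1))"
    using inv by (intro prod) linarith+
  from mult_right_mono[OF this A]
  have 2: "\<rho> powr (1 / 2 - 1 / p1) * \<sigma> powr (1 / 2 - 1 / q1) * A
      \<le> 4 * (real r powr (1 / 2 - 1 / p1) * real l powr (1 / 2 - 1 / q1) * A)" by simp
  have "ennreal (1 / 16 * min (\<rho> powr (1 / p2 - 1 / p1) * \<sigma> powr (1 / q2 - 1 / q1))
      (\<rho> powr (1 / 2 - 1 / p1) * \<sigma> powr (1 / 2 - 1 / q1) * A))
    \<le> ennreal (1 / 4 * min (real r powr (1 / p2 - 1 / p1) * real l powr (1 / q2 - 1 / q1))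
      (real r powr (1 / 2 - 1 / p1) * real l powr (1 / 2 - 1 / q1) * A))"
    using 1 2 by (intro ennreal_leI) linarith
  also have "\<dots> \<le> kolmogorov_width n (lmk_ball m k p1 q1) (lmk_space m k) (lmk_norm m k p2 q2)"
    unfolding A_def by (rule kolmogorov_width_lower[OF p q r(1,2) l(1,2) n])
  finally show ?thesis unfolding A_def .
qed

section \<open>Two-sided estimates\<close>

lemma lam_nonneg: "1 \<le> p1 \<Longrightarrow> p1 \<le> p2 \<Longrightarrow> 0 \<le> lam p1 p2"
  unfolding lam_def by (auto intro!: divide_nonneg_nonneg simp: frac_le)

text \<open>If \<open>lam q1 q2 < 1\<close>, it is exactly the parameter whose interpolated exponent
  is \<open>q1\<close>, and equality holds; if it is 1, the claim says
  \<open>q1 \<le> 2\<close>.\<close>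

lemma lam_interpolation_le:
  assumes "1 \<le> q1" "q1 \<le> q2" "2 \<le> q2"
  shows "(1 - lam q1 q2) / q2 + lam q1 q2 / 2 \<le> 1 / q1"
proof (cases "lam q1 q2 < 1")
  case True
  then show ?thesis using lam_exponent[OF True] by (simp add: diff_divide_distrib)
next
  case False
  then have "lam q1 q2 = 1" using lam_le_1[of q1 q2] by linarith
  moreover from this have "q1 \<le> 2" using lam_eq_1_iff[OF assms] by simp
  ultimately show ?thesis using assms by (simp add: field_simps)
qed

lemma interpolated_exponent_mono:
  fixes \<theta> \<theta>' q :: real
  assumes "2 \<le> q" "\<theta> \<le> \<theta>'"
  shows "(1 - \<theta>) / q + \<theta> / 2 \<le> (1 - \<theta>') / q + \<theta>' / 2"
proof -
  have "0 \<le> (\<theta>' - \<theta>) * (1 / 2 - 1 / q)"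
    using assms by (intro mult_nonneg_nonneg) (auto simp: field_simps)
  then show ?thesis by (simp add: algebra_simps diff_divide_distrib)
qed

text \<open>Real \<open>m\<close>, \<open>k\<close>, \<open>n\<close> and an abstract
  \<open>W\<close> allow the pairs (p, m) and (q, k) to be exchanged, although the mixed norm is not
  symmetric. \<open>B\<close> is \<open>A\<close> with \<open>p2\<close> replaced by 2 in the power
  of \<open>m\<close>. The ranges \<open>1 \<le> A\<close>, \<open>A < 1 \<le> B\<close> and
  \<open>B < 1\<close> correspond to rectangles that are a single entry, a piece of one column, and
  whole columns.\<close>

lemma two_sided_bound:
  fixes p1 p2 q1 q2 C m k n :: real and W :: ennreal
  assumes p: "1 \<le> p1" "p1 \<le> p2" "2 \<le> p2" and q: "1 \<le> q1" "q1 \<le> q2" "2 \<le> q2"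
    and mkn: "1 \<le> m" "1 \<le> k" "1 \<le> n" "n \<le> m * k"
    and lam: "lam p1 p2 \<le> lam q1 q2" "lam p1 p2 < 1"
    and upper: "\<And>\<theta>. 0 \<le> \<theta> \<Longrightarrow> \<theta> \<le> 1 \<Longrightarrow> W \<le> ennreal (C * (m powr max 0 ((1 - \<theta>) / p2 + \<theta> / 2 - 1 / p1)
          * k powr max 0 ((1 - \<theta>) / q2 + \<theta> / 2 - 1 / q1)
          * (n powr (- 1 / 2) * m powr (1 / p2) * k powr (1 / q2)) powr \<theta>))"
    and lower: "\<And>\<rho> \<sigma>. 1 \<le> \<rho> \<Longrightarrow> \<rho> \<le> m \<Longrightarrow> 1 \<le> \<sigma> \<Longrightarrow> \<sigma> \<le> k \<Longrightarrow>
      ennreal (1 / 16 * min (\<rho> powr (1 / p2 - 1 / p1) * \<sigma> powr (1 / q2 - 1 / q1))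
        (\<rho> powr (1 / 2 - 1 / p1) * \<sigma> powr (1 / 2 - 1 / q1)
          * (n powr (- 1 / 2) * m powr (1 / p2) * k powr (1 / q2)))) \<le> W"
  defines "\<Phi> \<equiv> Min {1, (n powr (- 1 / 2) * m powr (1 / p2) * k powr (1 / q2)) powr lam p1 p2,
      m powr (1 / p2 - 1 / p1) * (n powr (- 1 / 2) * m powr (1 / 2) * k powr (1 / q2)) powr lam q1 q2}"
  shows "ennreal (1 / 16 * \<Phi>) \<le> W" "W \<le> ennreal (C * \<Phi>)"
proof -
  define A where "A = n powr (- 1 / 2) * m powr (1 / p2) * k powr (1 / q2)"
  define B where "B = n powr (- 1 / 2) * m powr (1 / 2) * k powr (1 / q2)"
  define \<kappa> \<mu> where "\<kappa> = lam p1 p2" and "\<mu> = lam q1 q2"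
  have pos: "0 < m" "0 < k" "0 < n" using mkn by auto
  have A: "0 < A" and B: "0 < B" using pos by (auto simp: A_def B_def)
  have \<Phi>: "\<Phi> = Min {1, A powr \<kappa>, m powr (1 / p2 - 1 / p1) * B powr \<mu>}"
    by (simp add: \<Phi>_def A_def B_def \<kappa>_def \<mu>_def)
  have \<kappa>: "0 \<le> \<kappa>" "\<kappa> < 1" "\<kappa> \<le> \<mu>" "\<mu> \<le> 1" "0 \<le> \<mu>"
    using lam lam_nonneg[OF p(1,2)] lam_le_1[of q1 q2] unfolding \<kappa>_def \<mu>_def by linarith+
  have exp\<kappa>: "1 / p2 - 1 / p1 + \<kappa> / 2 = \<kappa> / p2" unfolding \<kappa>_def by (rule lam_exponent[OF lam(2)])
  have q\<mu>: "(1 - \<mu>) / q2 + \<mu> / 2 \<le> 1 / q1" unfolding \<mu>_def by (rule lam_interpolation_le[OF q])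
  have q\<kappa>: "(1 - \<kappa>) / q2 + \<kappa> / 2 \<le> 1 / q1"
    using interpolated_exponent_mono[OF q(3) \<kappa>(3)] q\<mu> by linarith
  have p\<kappa>: "(1 - \<kappa>) / p2 + \<kappa> / 2 = 1 / p1" using exp\<kappa> by (simp add: diff_divide_distrib)
  have p\<mu>: "1 / p1 \<le> (1 - \<mu>) / p2 + \<mu> / 2"
    using interpolated_exponent_mono[OF p(3) \<kappa>(3)] p\<kappa> by linarith
  have "W \<le> ennreal (C * 1)"
  proof -
    have "max 0 (1 / p2 - 1 / p1) = 0" "max 0 (1 / q2 - 1 / q1) = 0"
      using p q by (auto simp: frac_le)
    then show ?thesis using upper[of 0] pos A unfolding A_def[symmetric] by simp
  qed
  moreover have "W \<le> ennreal (C * A powr \<kappa>)"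
  proof -
    have "max 0 ((1 - \<kappa>) / p2 + \<kappa> / 2 - 1 / p1) = 0" "max 0 ((1 - \<kappa>) / q2 + \<kappa> / 2 - 1 / q1) = 0"
      using p\<kappa> q\<kappa> by auto
    then show ?thesis using upper[of \<kappa>] \<kappa> pos unfolding A_def[symmetric] by simp
  qed
  moreover have "W \<le> ennreal (C * (m powr (1 / p2 - 1 / p1) * B powr \<mu>))"
  proof -
    have mx: "max 0 ((1 - \<mu>) / p2 + \<mu> / 2 - 1 / p1) = (1 - \<mu>) / p2 + \<mu> / 2 - 1 / p1"
      "max 0 ((1 - \<mu>) / q2 + \<mu> / 2 - 1 / q1) = 0"
      using p\<mu> q\<mu> by auto
    have "m powr ((1 - \<mu>) / p2 + \<mu> / 2 - 1 / p1) * A powr \<mu> = m powr (1 / p2 - 1 / p1) * B powr \<mu>"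
    proof -
      have "m powr ((1 - \<mu>) / p2 + \<mu> / 2 - 1 / p1) * (m powr (1 / p2)) powr \<mu>
          = m powr (1 / p2 - 1 / p1) * (m powr (1 / 2)) powr \<mu>"
        unfolding powr_powr powr_add[symmetric]
        by (rule arg_cong[where f = "(powr) m"]) (simp add: diff_divide_distrib)
      then show ?thesis unfolding A_def B_def powr_mult by (simp add: mult_ac)
    qed
    then show ?thesis using upper[of \<mu>] \<kappa> pos unfolding A_def[symmetric] mx by simp
  qed
  moreover have "\<Phi> \<in> {1, A powr \<kappa>, m powr (1 / p2 - 1 / p1) * B powr \<mu>}"
    unfolding \<Phi> by (rule Min_in) auto
  ultimately show "W \<le> ennreal (C * \<Phi>)" by auto
  have \<Phi>_le: "\<Phi> \<le> 1" "\<Phi> \<le> A powr \<kappa>" "\<Phi> \<le> m powr (1 / p2 - 1 / p1) * B powr \<mu>"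
    unfolding \<Phi> by (auto intro: Min_le)
  have p2: "2 < p2" using lam(2) by (auto simp: lam_def split: if_splits)
  define h where "h = 1 / 2 - 1 / p2"
  have h: "0 < h" using p2 by (simp add: h_def field_simps)
  have mhA: "m powr h * A = B" using pos by (simp add: h_def A_def B_def powr_diff)
  have witness: "ennreal (1 / 16 * \<Phi>) \<le> W"
    if "1 \<le> \<rho>" "\<rho> \<le> m" "1 \<le> \<sigma>" "\<sigma> \<le> k" "\<Phi> \<le> \<rho> powr (1 / p2 - 1 / p1) * \<sigma> powr (1 / q2 - 1 / q1)"
      "\<Phi> \<le> \<rho> powr (1 / 2 - 1 / p1) * \<sigma> powr (1 / 2 - 1 / q1) * A" for \<rho> \<sigma>
    using lower[OF that(1-4)] that(5,6) unfolding A_def[symmetric]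
    by (elim order_trans[rotated]) (intro ennreal_leI, simp)
  consider "1 \<le> A" | "A < 1" "1 \<le> B" | "B < 1" by linarith
  then show "ennreal (1 / 16 * \<Phi>) \<le> W"
  proof cases
    case 1
    then show ?thesis using mkn \<Phi>_le by (intro witness[of 1 1]) auto
  next
    case 2
    \<comment> \<open>Solves \<open>\<rho> powr h * A = 1\<close>, which makes the two terms of the
      lower bound equal; \<open>\<rho> \<le> m\<close> is the assumption
      \<open>1 \<le> B = m powr h * A\<close>.\<close>
    define \<rho> where "\<rho> = A powr (- 1 / h)"
    have \<rho>0: "0 < \<rho>" using A by (simp add: \<rho>_def)
    have "ln A \<le> 0" using 2 A by simp
    then have "1 \<le> \<rho>" unfolding \<rho>_def using A h by (simp add: powr_def divide_nonpos_pos)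
    have "\<rho> powr h = A powr (- 1)" using h by (simp add: \<rho>_def powr_powr)
    then have \<rho>hA: "\<rho> powr h * A = 1" using A by (simp add: powr_minus)
    have "\<rho> powr h \<le> m powr h"
    proof -
      have "\<rho> powr h * A \<le> m powr h * A" using 2 \<rho>hA mhA by simp
      then show ?thesis using A by simp
    qed
    then have "\<rho> \<le> m" using powr_less_mono2[of h m \<rho>] h pos by (meson linorder_not_le less_imp_le)
    have "\<rho> powr (1 / p2 - 1 / p1) = A powr \<kappa>"
    proof -
      have "\<kappa> / p2 - \<kappa> / 2 = 1 / p2 - 1 / p1" using exp\<kappa> by linarith
      then have "1 / p2 - 1 / p1 = - (\<kappa> * h)" by (simp add: h_def algebra_simps)
      then have "- 1 / h * (1 / p2 - 1 / p1) = \<kappa>" using h by simp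
      then show ?thesis by (simp only: \<rho>_def powr_powr)
    qed
    moreover have "\<rho> powr (1 / 2 - 1 / p1) * A = \<rho> powr (1 / p2 - 1 / p1)"
    proof -
      have "1 / 2 - 1 / p1 = (1 / p2 - 1 / p1) + h" by (simp add: h_def)
      then have "\<rho> powr (1 / 2 - 1 / p1) = \<rho> powr (1 / p2 - 1 / p1) * \<rho> powr h" by (simp only: powr_add)
      then show ?thesis using \<rho>hA by (simp add: mult.assoc)
    qed
    ultimately show ?thesis
      using mkn \<Phi>_le \<open>1 \<le> \<rho>\<close> \<open>\<rho> \<le> m\<close> by (intro witness[of \<rho> 1]) auto
  next
    case 3
    have mA: "m powr (1 / 2 - 1 / p1) * A = m powr (1 / p2 - 1 / p1) * B"
    proof -
      have "1 / 2 - 1 / p1 = (1 / p2 - 1 / p1) + h" by (simp add: h_def)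
      then have "m powr (1 / 2 - 1 / p1) = m powr (1 / p2 - 1 / p1) * m powr h" by (simp only: powr_add)
      then show ?thesis using mhA by (simp add: mult.assoc)
    qed
    show ?thesis
    proof (cases "\<mu> < 1")
      \<comment> \<open>One whole column suffices: \<open>\<Phi>\<close> is bounded by a multiple of
        \<open>B\<close>, and \<open>B < 1\<close>.\<close>
      case False
      then have "\<mu> = 1" using \<kappa> by simp
      then have le: "\<Phi> \<le> m powr (1 / p2 - 1 / p1) * B" using \<Phi>_le(3) B by simp
      also have "\<dots> \<le> m powr (1 / p2 - 1 / p1) * 1" using 3 by (intro mult_left_mono) auto
      finally have "\<Phi> \<le> m powr (1 / p2 - 1 / p1)" by simp
      then show ?thesis using mkn le mA by (intro witness[of m 1]) auto
    next
      case True
      have q2: "2 < q2" using True by (auto simp: \<mu>_def lam_def split: if_splits)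
      have exp\<mu>: "1 / q2 - 1 / q1 + \<mu> / 2 = \<mu> / q2"
        using True unfolding \<mu>_def by (rule lam_exponent)
      define g where "g = 1 / 2 - 1 / q2"
      have g: "0 < g" using q2 by (simp add: g_def field_simps)
      \<comment> \<open>The same balance with \<open>\<rho> = m\<close>:
        \<open>\<sigma> powr g * B = 1\<close>. It fits into \<open>k\<close> columns because
        \<open>k powr g * B\<close> is the square root of \<open>m * k / n\<close>.\<close>
      define \<sigma> where "\<sigma> = B powr (- 1 / g)"
      have "ln B \<le> 0" using 3 B by simp
      then have "1 \<le> \<sigma>" unfolding \<sigma>_def using B g by (simp add: powr_def divide_nonpos_pos)
      have "\<sigma> powr g = B powr (- 1)" using g by (simp add: \<sigma>_def powr_powr)
      then have \<sigma>gB: "\<sigma> powr g * B = 1" using B by (simp add: powr_minus)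
      have "\<sigma> powr g \<le> k powr g"
      proof -
        have "1 \<le> (m * k / n) powr (1 / 2)" using mkn by (intro ge_one_powr_ge_zero) auto
        also have "\<dots> = k powr g * B"
        proof -
          have "k powr (1 / 2) = k powr g * k powr (1 / q2)" by (simp add: g_def flip: powr_add)
          moreover have "n powr (- 1 / 2) = 1 / n powr (1 / 2)" by (simp add: powr_minus_divide)
          moreover have "(m * k / n) powr (1 / 2) = m powr (1 / 2) * k powr (1 / 2) / n powr (1 / 2)"
            by (simp only: powr_divide powr_mult)
          ultimately show ?thesis unfolding B_def by simp
        qed
        finally have "\<sigma> powr g * B \<le> k powr g * B" using \<sigma>gB by simp
        then show ?thesis using B by simp
      qed
      then have "\<sigma> \<le> k" using powr_less_mono2[of g k \<sigma>] g pos by (meson linorder_not_le less_imp_le)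
      have \<sigma>\<mu>: "\<sigma> powr (1 / q2 - 1 / q1) = B powr \<mu>"
      proof -
        have "\<mu> / q2 - \<mu> / 2 = 1 / q2 - 1 / q1" using exp\<mu> by linarith
        then have "1 / q2 - 1 / q1 = - (\<mu> * g)" by (simp add: g_def algebra_simps)
        then have "- 1 / g * (1 / q2 - 1 / q1) = \<mu>" using g by simp
        then show ?thesis by (simp only: \<sigma>_def powr_powr)
      qed
      have "m powr (1 / 2 - 1 / p1) * \<sigma> powr (1 / 2 - 1 / q1) * A
          = m powr (1 / p2 - 1 / p1) * B powr \<mu>"
      proof -
        have "1 / 2 - 1 / q1 = (1 / q2 - 1 / q1) + g" by (simp add: g_def)
        then have "\<sigma> powr (1 / 2 - 1 / q1) = B powr \<mu> * \<sigma> powr g" by (simp only: powr_add \<sigma>\<mu>)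
        moreover have "m powr (1 / 2 - 1 / p1) * \<sigma> powr (1 / 2 - 1 / q1) * A
            = (m powr (1 / 2 - 1 / p1) * A) * \<sigma> powr (1 / 2 - 1 / q1)" by simp
        ultimately have "m powr (1 / 2 - 1 / p1) * \<sigma> powr (1 / 2 - 1 / q1) * A
            = m powr (1 / p2 - 1 / p1) * B powr \<mu> * (\<sigma> powr g * B)" unfolding mA by (simp only: mult_ac)
        then show ?thesis unfolding \<sigma>gB by simp
      qed
      then show ?thesis
        using mkn \<Phi>_le \<sigma>\<mu> \<open>1 \<le> \<sigma>\<close> \<open>\<sigma> \<le> k\<close> by (intro witness[of m \<sigma>]) auto
    qed
  qed
qed

theorem theorem2:
  fixes p2 q2 :: real
  assumes "2 \<le> p2" and "2 \<le> q2"
  shows "\<exists>a>0. \<forall>p1 q1 :: real. 1 \<le> p1 \<and> p1 \<le> p2 \<and> 1 \<le> q1 \<and> q1 \<le> q2 \<longrightarrow>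
    (\<exists>c>0. \<exists>C>0. \<forall>m k n :: nat.
       1 \<le> m \<and> 1 \<le> k \<and> 1 \<le> n \<and> real n \<le> a * real m * real k \<longrightarrow>
         ennreal (c * Phi0 m k n p1 p2 q1 q2)
           \<le> kolmogorov_width n (lmk_ball m k p1 q1) (lmk_space m k) (lmk_norm m k p2 q2) \<and>
         kolmogorov_width n (lmk_ball m k p1 q1) (lmk_space m k) (lmk_norm m k p2 q2)
           \<le> ennreal (C * Phi0 m k n p1 p2 q1 q2))"
proof -
  obtain C where C: "0 < C" and upper: "\<And>m k n p1 q1 \<theta>. 1 \<le> m \<Longrightarrow> 1 \<le> k \<Longrightarrow> 1 \<le> n \<Longrightarrow> n \<le> m * k \<Longrightarrow>
     1 \<le> p1 \<Longrightarrow> 1 \<le> q1 \<Longrightarrow> 0 \<le> \<theta> \<Longrightarrow> \<theta> \<le> 1 \<Longrightarrow>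
     kolmogorov_width n (lmk_ball m k p1 q1) (lmk_space m k) (lmk_norm m k p2 q2)
     \<le> ennreal (C * (real m powr max 0 ((1 - \<theta>) / p2 + \<theta> / 2 - 1 / p1)
          * real k powr max 0 ((1 - \<theta>) / q2 + \<theta> / 2 - 1 / q1)
          * (real n powr (- 1 / 2) * real m powr (1 / p2) * real k powr (1 / q2)) powr \<theta>))"
    using kolmogorov_width_upper[OF assms] by blast
  have main: "ennreal (1 / 16 * Phi0 m k n p1 p2 q1 q2)
           \<le> kolmogorov_width n (lmk_ball m k p1 q1) (lmk_space m k) (lmk_norm m k p2 q2) \<and>
         kolmogorov_width n (lmk_ball m k p1 q1) (lmk_space m k) (lmk_norm m k p2 q2)
           \<le> ennreal (C * Phi0 m k n p1 p2 q1 q2)"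
    if p: "1 \<le> p1" "p1 \<le> p2" and q: "1 \<le> q1" "q1 \<le> q2"
      and mk: "1 \<le> m" "1 \<le> k" and n: "1 \<le> n" "real n \<le> 1 / 2 * real m * real k"
    for p1 q1 :: real and m k n :: nat
  proof -
    define W where "W = kolmogorov_width n (lmk_ball m k p1 q1) (lmk_space m k) (lmk_norm m k p2 q2)"
    have p': "1 \<le> p1" "p1 \<le> p2" "2 \<le> p2" and q': "1 \<le> q1" "q1 \<le> q2" "2 \<le> q2" using p q assms by auto
    have "real (2 * n) \<le> real (m * k)" using n by simp
    then have n2: "2 * n \<le> m * k" by (simp only: of_nat_le_iff)
    then have n1: "n \<le> m * k" by simp
    have nr: "1 \<le> real m" "1 \<le> real k" "1 \<le> real n" "real n \<le> real m * real k" "real n \<le> real k * real m"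
      using mk n by (auto simp: mult.commute)
    define A where "A = real n powr (- 1 / 2) * real m powr (1 / p2) * real k powr (1 / q2)"
    have A: "A = real n powr (- 1 / 2) * real k powr (1 / q2) * real m powr (1 / p2)" by (simp add: A_def)
    have U: "W \<le> ennreal (C * (real m powr max 0 ((1 - \<theta>) / p2 + \<theta> / 2 - 1 / p1)
          * real k powr max 0 ((1 - \<theta>) / q2 + \<theta> / 2 - 1 / q1) * A powr \<theta>))" if "0 \<le> \<theta>" "\<theta> \<le> 1" for \<theta>
      unfolding W_def A_def by (rule upper[OF mk n(1) n1 p(1) q(1) that])
    have Lo: "ennreal (1 / 16 * min (\<rho> powr (1 / p2 - 1 / p1) * \<sigma> powr (1 / q2 - 1 / q1))
        (\<rho> powr (1 / 2 - 1 / p1) * \<sigma> powr (1 / 2 - 1 / q1) * A)) \<le> W"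
      if "1 \<le> \<rho>" "\<rho> \<le> real m" "1 \<le> \<sigma>" "\<sigma> \<le> real k" for \<rho> \<sigma>
      unfolding W_def A_def
      by (rule kolmogorov_width_lower_real[OF p(1) assms(1) q(1) assms(2) that n(1) n2])
    consider "p1 \<le> 2" "q1 \<le> 2" | "lam p1 p2 \<le> lam q1 q2" "lam p1 p2 < 1"
      | "lam q1 q2 \<le> lam p1 p2" "lam q1 q2 < 1"
      using Phi0_cases(4)[OF p' q'] by blast
    then have "ennreal (1 / 16 * Phi0 m k n p1 p2 q1 q2) \<le> W \<and> W \<le> ennreal (C * Phi0 m k n p1 p2 q1 q2)"
    proof cases
      \<comment> \<open>The parameters 0 and 1 give the upper bound, and a single entry the lower
        one.\<close>
      case 1
      have \<Phi>: "Phi0 m k n p1 p2 q1 q2 = min 1 A"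
        unfolding A_def using Phi0_cases(1)[OF p' q' 1] .
      have "W \<le> ennreal (C * 1)"
      proof -
        have "max 0 (1 / p2 - 1 / p1) = 0" "max 0 (1 / q2 - 1 / q1) = 0"
          using p' q' by (auto simp: frac_le)
        moreover have "A \<noteq> 0" using mk n by (simp add: A_def)
        ultimately show ?thesis using U[of 0] mk by simp
      qed
      moreover have "W \<le> ennreal (C * A)"
      proof -
        have "max 0 (1 / 2 - 1 / p1) = 0" "max 0 (1 / 2 - 1 / q1) = 0"
          using 1 p' q' by (auto simp: frac_le)
        moreover have "0 \<le> A" by (simp add: A_def)
        ultimately show ?thesis using U[of 1] mk by simp
      qed
      ultimately have "W \<le> ennreal (C * min 1 A)" by (simp add: min_def)
      moreover have "ennreal (1 / 16 * min 1 A) \<le> W" using Lo[of 1 1] mk by simp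
      ultimately show ?thesis unfolding \<Phi> by blast
    next
      case 2
      show ?thesis
        unfolding Phi0_cases(2)[OF p' q' 2]
        using two_sided_bound[OF p' q' nr(1-4) 2 U[unfolded A_def] Lo[unfolded A_def]] by blast
    next
      \<comment> \<open>\<open>U\<close> and \<open>Lo\<close> keep their form when (p, m) and (q,
        k) change places, so the second case is applied with the roles exchanged.\<close>
      case 3
      have U': "W \<le> ennreal (C * (real k powr max 0 ((1 - \<theta>) / q2 + \<theta> / 2 - 1 / q1)
          * real m powr max 0 ((1 - \<theta>) / p2 + \<theta> / 2 - 1 / p1) * A powr \<theta>))" if "0 \<le> \<theta>" "\<theta> \<le> 1" for \<theta>
        using U[OF that] by (simp add: mult.commute)
      have Lo': "ennreal (1 / 16 * min (\<sigma> powr (1 / q2 - 1 / q1) * \<rho> powr (1 / p2 - 1 / p1))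
        (\<sigma> powr (1 / 2 - 1 / q1) * \<rho> powr (1 / 2 - 1 / p1) * A)) \<le> W"
        if "1 \<le> \<sigma>" "\<sigma> \<le> real k" "1 \<le> \<rho>" "\<rho> \<le> real m" for \<rho> \<sigma>
        using Lo[OF that(3,4,1,2)] by (simp add: mult.commute)
      have swap: "real n powr (- 1 / 2) * real m powr (1 / p2) * real k powr (1 / 2)
          = real n powr (- 1 / 2) * real k powr (1 / 2) * real m powr (1 / p2)" by simp
      show ?thesis
        unfolding Phi0_cases(3)[OF p' q' 3] A_def[symmetric] swap
        using two_sided_bound[OF q' p' nr(2,1,3,5) 3 U'[unfolded A] Lo'[unfolded A], folded A] by blast
    qed
    then show ?thesis unfolding W_def .
  qed
  show ?thesis
  \<comment> \<open>The value 1/2 is the condition \<open>2 * n \<le> m * k\<close> of the lower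
    bound. The lower constant is absolute, and \<open>C\<close> depends on \<open>p2\<close>,
    \<open>q2\<close> only.\<close>
  proof (rule exI[of _ "1 / 2"], intro conjI allI impI)
    fix p1 q1 :: real
    assume "1 \<le> p1 \<and> p1 \<le> p2 \<and> 1 \<le> q1 \<and> q1 \<le> q2"
    then show "\<exists>c>0. \<exists>C>0. \<forall>m k n :: nat.
       1 \<le> m \<and> 1 \<le> k \<and> 1 \<le> n \<and> real n \<le> 1 / 2 * real m * real k \<longrightarrow>
         ennreal (c * Phi0 m k n p1 p2 q1 q2)
           \<le> kolmogorov_width n (lmk_ball m k p1 q1) (lmk_space m k) (lmk_norm m k p2 q2) \<and>
         kolmogorov_width n (lmk_ball m k p1 q1) (lmk_space m k) (lmk_norm m k p2 q2)
           \<le> ennreal (C * Phi0 m k n p1 p2 q1 q2)"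
      using main C by (intro exI[of _ "1 / 16"] exI[of _ C]) auto
  qed simp
qed

end
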